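(* Let $g\in\mathbb{R}$ and $T>0$. For any given radial initial datum $\phi_0$, there is at most one solution $\phi\in L^\infty_{t\in[0,T)}H^{2/3}(\mathbb{R}^2)$ with $\phi(0)=\phi_0$ to the radial Chern-Simons-Schrödinger system $$\begin{cases}(i\partial_t+\Delta)\phi=A_0\phi+\frac1{r^2}A_\theta^2\phi-g|\phi|^2\phi\\ \partial_rA_0=\frac1rA_\theta|\phi|^2\\ \partial_tA_\theta=r\,\mathrm{Im}(\bar\phi\,\partial_r\phi)\\ \partial_rA_\theta=-\frac12|\phi|^2r\\ A_r=0.\end{cases}$$
   Context: Here $\phi=\phi(t,r)$ is a complex-valued function on $[0,T)\times\mathbb{R}^2$, radial in space, $r=|x|$, and $A_0=A_0(t,r)$, $A_\theta=A_\theta(t,r)$ are real-valued radial functions. The natural boundary conditions are adopted, so that $$A_\theta(t,r)=-\tfrac12\int_0^r|\phi(t,s)|^2s\,ds,\qquad A_0(t,r)=-\int_r^\infty A_\theta(t,s)|\phi(t,s)|^2\frac{ds}{s}.$$ Solutions are understood in the mild (Duhamel) sense: $$\phi(t)=e^{it\Delta}\phi_0-i\int_0^te^{i(t-s)\Delta}\Big(A_0\phi+\tfrac1{r^2}A_\theta^2\phi-g|\phi|^2\phi\Big)(s)\,ds .$$ *)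

theory Defs
  imports "HOL-Analysis.Analysis"
begin

type_synonym plane = "real ^ 2"

text \<open>Square-integrable functions on the plane, as Borel representatives; equality in
  \<open>L\<^sup>2\<close> is almost-everywhere equality.\<close>

definition L2 :: "(plane \<Rightarrow> complex) set" where
  "L2 = {f \<in> borel_measurable lborel. integrable lborel (\<lambda>x. (cmod (f x))\<^sup>2)}"

definition L2_inner :: "(plane \<Rightarrow> complex) \<Rightarrow> (plane \<Rightarrow> complex) \<Rightarrow> complex" where
  "L2_inner f h = (\<integral>x. f x * cnj (h x) \<partial>lborel)"

text \<open>The \<open>L\<^sup>2\<close> (Plancherel) Fourier transform, with the unitary normalisation: the limit in
  \<open>L\<^sup>2\<close> of the transforms of the truncations to balls, which lie in \<open>L\<^sup>1\<close>.\<close>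

definition has_fourier :: "(plane \<Rightarrow> complex) \<Rightarrow> (plane \<Rightarrow> complex) \<Rightarrow> bool" where
  "has_fourier f F \<longleftrightarrow> f \<in> L2 \<and> F \<in> L2 \<and>
     ((\<lambda>R. \<integral>\<^sup>+\<xi>. ennreal ((cmod (F \<xi> -
          (1 / (2 * pi)) *\<^sub>R (LINT x:cball 0 R|lborel. cis (- (x \<bullet> \<xi>)) * f x)))\<^sup>2) \<partial>lborel)
       \<longlongrightarrow> 0) at_top"

text \<open>By Plancherel's theorem a transform of \<open>f \<in> L2\<close> exists and is unique up to null sets;
  \<open>fourier f\<close> is some representative of it.\<close>

definition fourier :: "(plane \<Rightarrow> complex) \<Rightarrow> plane \<Rightarrow> complex" where
  "fourier f = (SOME F. has_fourier f F)"

definition sobolev :: "real \<Rightarrow> (plane \<Rightarrow> complex) set" where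
  "sobolev s = {f \<in> L2. integrable lborel
     (\<lambda>\<xi>. (1 + (norm \<xi>)\<^sup>2) powr s * (cmod (fourier f \<xi>))\<^sup>2)}"

definition sobolev_norm :: "real \<Rightarrow> (plane \<Rightarrow> complex) \<Rightarrow> real" where
  "sobolev_norm s f =
     sqrt (\<integral>\<xi>. (1 + (norm \<xi>)\<^sup>2) powr s * (cmod (fourier f \<xi>))\<^sup>2 \<partial>lborel)"

text \<open>The free propagator \<open>e\<^bsup>it\<Delta>\<^esup>\<close> on \<open>L\<^sup>2\<close>, i.e. the Fourier multiplier with symbol
  \<open>e\<^bsup>-it|\<xi>|\<^sup>2\<^esup>\<close>; the value is again a representative, fixed up to null sets.\<close>

definition free_propagator :: "real \<Rightarrow> (plane \<Rightarrow> complex) \<Rightarrow> plane \<Rightarrow> complex" where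
  "free_propagator t f =
     (SOME u. has_fourier u (\<lambda>\<xi>. cis (- t * (norm \<xi>)\<^sup>2) * fourier f \<xi>))"

text \<open>Integral of an \<open>L\<^sup>2\<close>-valued function of time, taken weakly in the Hilbert space \<open>L\<^sup>2\<close>.
  It equals the Bochner integral whenever the latter exists.  A pointwise integral
  \<open>\<integral> G s x ds\<close> would not do, since each \<open>G s\<close> is only determined up to a null set depending on
  \<open>s\<close>.  Completed Lebesgue measure is used so that null sets of times are irrelevant.\<close>

definition has_L2_integral ::
    "(real \<Rightarrow> plane \<Rightarrow> complex) \<Rightarrow> real set \<Rightarrow> (plane \<Rightarrow> complex) \<Rightarrow> bool" where
  "has_L2_integral G S U \<longleftrightarrow> U \<in> L2 \<and> (AE s in lebesgue. s \<in> S \<longrightarrow> G s \<in> L2) \<and>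
     (\<forall>h\<in>L2. set_integrable lebesgue S (\<lambda>s. L2_inner (G s) h) \<and>
             L2_inner U h = (LINT s:S|lebesgue. L2_inner (G s) h))"

text \<open>Radial functions on the plane are given by their profile on \<open>[0,\<infinity>)\<close>.\<close>

definition radial :: "(real \<Rightarrow> complex) \<Rightarrow> plane \<Rightarrow> complex" where
  "radial f = (\<lambda>x. f (norm x))"

text \<open>The gauge potentials at a fixed time, as functionals of the profile \<open>f = \<phi>(t)\<close>: the
  solutions of \<open>\<partial>\<^sub>rA\<^sub>\<theta> = -|f|\<^sup>2r/2\<close> and \<open>\<partial>\<^sub>rA\<^sub>0 = A\<^sub>\<theta>|f|\<^sup>2/r\<close> with \<open>A\<^sub>\<theta> = 0\<close> at the origin and
  \<open>A\<^sub>0 = 0\<close> at infinity.\<close>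

definition A_theta :: "(real \<Rightarrow> complex) \<Rightarrow> real \<Rightarrow> real" where
  "A_theta f r = - (1/2) * (LBINT s:{0..r}. (cmod (f s))\<^sup>2 * s)"

definition A_zero :: "(real \<Rightarrow> complex) \<Rightarrow> real \<Rightarrow> real" where
  "A_zero f r = - (LBINT s:{r..}. A_theta f s * (cmod (f s))\<^sup>2 / s)"

definition css_nonlinearity :: "real \<Rightarrow> (real \<Rightarrow> complex) \<Rightarrow> real \<Rightarrow> complex" where
  "css_nonlinearity g f r =
     of_real (A_zero f r) * f r
     + of_real ((A_theta f r)\<^sup>2 / r\<^sup>2) * f r
     - of_real (g * (cmod (f r))\<^sup>2) * f r"

definition Linf_sobolev :: "real \<Rightarrow> real \<Rightarrow> (real \<Rightarrow> real \<Rightarrow> complex) set" where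
  "Linf_sobolev T \<sigma> = {\<phi>.
     set_borel_measurable lborel ({0..<T} \<times> {0..}) (\<lambda>(t, r). \<phi> t r) \<and>
     (\<exists>C. AE t in lborel. t \<in> {0..<T} \<longrightarrow>
        radial (\<phi> t) \<in> sobolev \<sigma> \<and> sobolev_norm \<sigma> (radial (\<phi> t)) \<le> C)}"

text \<open>Mild solutions in the class \<open>L\<^sup>\<infinity>\<^sub>tH\<^bsup>2/3\<^esup>\<close>.  As an element of this class is only defined for
  almost every time, so is the Duhamel formula, and the formula itself carries the datum: its
  right-hand side is continuous in time with values in \<open>L\<^sup>2\<close> and equals \<open>\<phi>\<^sub>0\<close> at time \<open>0\<close>.  The
  condition at \<open>t = 0\<close> only normalises the representative.  The remaining equation
  \<open>\<partial>\<^sub>tA\<^sub>\<theta> = r Im(cnj \<phi> \<partial>\<^sub>r\<phi>)\<close> is the conservation law for \<open>|\<phi>|\<^sup>2\<close> implied by the formula and is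
  not imposed; \<open>A\<^sub>r = 0\<close> is the gauge choice already used in writing the system.\<close>

definition css_mild_solution ::
    "real \<Rightarrow> real \<Rightarrow> (real \<Rightarrow> complex) \<Rightarrow> (real \<Rightarrow> real \<Rightarrow> complex) \<Rightarrow> bool" where
  "css_mild_solution g T \<phi>0 \<phi> \<longleftrightarrow>
     \<phi> \<in> Linf_sobolev T (2/3) \<and>
     (AE x in lborel. radial (\<phi> 0) x = radial \<phi>0 x) \<and>
     (AE t in lborel. t \<in> {0..<T} \<longrightarrow>
        (\<exists>D. has_L2_integral
               (\<lambda>s. free_propagator (t - s) (radial (css_nonlinearity g (\<phi> s)))) {0..t} D \<and>
             (AE x in lborel.
                radial (\<phi> t) x = free_propagator t (radial \<phi>0) x - \<i> * D x)))"

end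

theory Submission
  imports Defs "HOL-Probability.Probability"
begin

text \<open>Let \<open>w\<close> be the difference of two solutions.  By the endpoint Sobolev embedding both are bounded in
  \<open>L\<^sup>2 \<inter> L\<^sup>6\<close>, uniformly in time; the exponent \<open>6\<close> puts the nonlinearity in \<open>L\<^sup>2\<close>.  In radial
  variables, estimates of \<open>A\<^sub>\<theta>\<close> and \<open>A\<^sub>0\<close> show that the nonlinearities differ in
  \<open>L\<^bsup>4/3\<^esup>\<close> by at most a constant times the \<open>L\<^sup>4\<close> norm of \<open>w\<close>.  The free propagator maps \<open>L\<^bsup>4/3\<^esup>\<close> to
  \<open>L\<^sup>4\<close> with norm \<open>O(\<bar>t\<bar>\<^bsup>-1/2\<^esup>)\<close>, which is integrable in time, so Duhamel's formula
  is a contraction for \<open>w\<close> in a weighted \<open>L\<^sup>\<infinity>\<^sub>t L\<^sup>4\<^sub>x\<close> norm; no Strichartz estimate is needed.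
  The Sobolev embedding and the dispersive estimate both follow from one layer-cake argument, which
  needs only Plancherel's theorem and bounds by explicit Gaussian integrals.\<close>

section \<open>Gaussian and radial integrals\<close>

text \<open>The exponent 2/3 is the endpoint for L^6 in two dimensions, since 1/2 - (2/3)/2 = 1/6.
  Nothing is lost there because the splitting is chosen anew at every level of the layer cake. L^6
  has a second use: the Duhamel integral is known only through its pairings with L^2 functions, and
  the L^4 norm of \<open>w\<close> is read off by pairing with |w|^2 w, which lies in L^2 because
  \<open>w\<close> lies in L^6. The obstacle is that A_0 is nonlocal with a singular weight. At the
  origin a bound of A_\<theta> linear in r absorbs the singularity. At infinity \<open>w\<close> is
  only known in L^4, so the difference of two A_\<theta> may grow like sqrt r and that of two A_0
  decays only like r^(-3/2). This is still square-integrable for r dr, so every product in the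
  difference of the nonlinearities is an L^2 factor times an L^4 factor; hence the exponent 4/3. The
  contraction takes the form of repeatedly halving a bound valid at almost every time, started from
  the bounds in L^2 and L^6. No measurability in time of the L^4 norm and no fixed-point theorem
  enters.\<close>

lemma gaussian_fourier_real:
  fixes c w :: real
  assumes c: "c > 0"
  shows "integrable lborel (\<lambda>x::real. complex_of_real (exp (- c * x\<^sup>2)) * cis (- (x * w)))"
    and "(LINT x|lborel. complex_of_real (exp (- c * x\<^sup>2)) * cis (- (x * w)))
          = complex_of_real (sqrt (pi / c) * exp (- w\<^sup>2 / (4 * c)))"
proof -
  \<comment> \<open>Integrand of the characteristic function of the standard normal law at - w /
    sqrt (2 c). Replacing x by sqrt (2 c) x turns the exponent x^2 / 2 into c x^2 and the phase into
    - x w.\<close>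
  define f where "f x = std_normal_density x *\<^sub>R iexp ((- w / sqrt (2*c)) * x)" for x
  have intf: "integrable lborel f"
    unfolding f_def
    by (rule Bochner_Integration.integrable_bound[OF integrable_normal_moment[where k=0 and \<mu>=0 and \<sigma>=1]])
       (auto simp: normal_density_nonneg)
  have If: "(LINT x|lborel. f x) = exp (- ((- w / sqrt (2*c))\<^sup>2) / 2)"
  proof -
    have "(LINT x|lborel. f x) = char std_normal_distribution (- w / sqrt (2*c))"
      unfolding char_def f_def by (subst integral_density) (auto simp: normal_density_nonneg)
    then show ?thesis by (simp add: char_std_normal_distribution)
  qed
  have s: "sqrt (2*c) \<noteq> 0" using c by simp
  have eq: "f (0 + sqrt (2*c) * x) = complex_of_real (1 / sqrt (2*pi)) * (complex_of_real (exp (- c * x\<^sup>2)) * cis (- (x * w)))" for x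
    using c by (simp add: f_def std_normal_density_def power_mult_distrib cis_conv_exp scaleR_conv_of_real field_simps)
  have eq': "complex_of_real (sqrt (2*pi)) * f (0 + sqrt (2*c) * x)
      = complex_of_real (exp (- c * x\<^sup>2)) * cis (- (x * w))" for x
    unfolding eq mult.assoc[symmetric] of_real_mult[symmetric] by simp
  have "integrable lborel (\<lambda>x. f (0 + sqrt (2*c) * x))"
    by (rule lborel_integrable_real_affine[OF intf s])
  then have "integrable lborel (\<lambda>x. complex_of_real (sqrt (2*pi)) * f (0 + sqrt (2*c) * x))"
    by simp
  then show "integrable lborel (\<lambda>x::real. complex_of_real (exp (- c * x\<^sup>2)) * cis (- (x * w)))"
    by (simp only: eq')
  have "(LINT x|lborel. f x) = \<bar>sqrt (2*c)\<bar> *\<^sub>R (LINT x|lborel. f (0 + sqrt (2*c) * x))"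
    by (rule lborel_integral_real_affine[OF s])
  also have "(LINT x|lborel. f (0 + sqrt (2*c) * x))
     = complex_of_real (1 / sqrt (2*pi)) * (LINT x|lborel. (complex_of_real (exp (- c * x\<^sup>2)) * cis (- (x * w))))"
    unfolding eq by simp
  finally have "complex_of_real (sqrt c / sqrt pi) * (LINT x|lborel. (complex_of_real (exp (- c * x\<^sup>2)) * cis (- (x * w))))
      = (LINT x|lborel. f x)"
    using c by (simp add: real_sqrt_mult scaleR_conv_of_real)
  then have *: "complex_of_real (sqrt c / sqrt pi) * (LINT x|lborel. (complex_of_real (exp (- c * x\<^sup>2)) * cis (- (x * w))))
      = exp (- ((- w / sqrt (2*c))\<^sup>2) / 2)" using If by simp
  have e: "- ((- w / sqrt (2*c))\<^sup>2) / 2 = - w\<^sup>2 / (4 * c)"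
    using c by (simp add: power_divide)
  have "complex_of_real (sqrt (pi/c)) * (complex_of_real (sqrt c / sqrt pi) * (LINT x|lborel. (complex_of_real (exp (- c * x\<^sup>2)) * cis (- (x * w)))))
     = complex_of_real (sqrt (pi / c) * exp (- w\<^sup>2 / (4 * c)))"
    unfolding * e by (simp add: exp_of_real)
  then have "(complex_of_real (sqrt (pi/c)) * complex_of_real (sqrt c / sqrt pi)) * (LINT x|lborel. (complex_of_real (exp (- c * x\<^sup>2)) * cis (- (x * w))))
     = complex_of_real (sqrt (pi / c) * exp (- w\<^sup>2 / (4 * c)))"
    by (simp only: mult.assoc)
  moreover have "complex_of_real (sqrt (pi/c)) * complex_of_real (sqrt c / sqrt pi) = 1"
    using c by (simp add: real_sqrt_divide flip: of_real_mult)
  ultimately show "(LINT x|lborel. complex_of_real (exp (- c * x\<^sup>2)) * cis (- (x * w)))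
          = complex_of_real (sqrt (pi / c) * exp (- w\<^sup>2 / (4 * c)))"
    by (simp only: mult_1_left)
qed

text \<open>The integrand factors over the coordinates, and \<open>lborel\<close> is the image of a
  product of one-dimensional Lebesgue measures, so the integral is a product of one-dimensional
  ones.\<close>

lemma gaussian_fourier_euclidean:
  fixes w :: "'a::euclidean_space"
  assumes c: "c > 0"
  shows "integrable lborel (\<lambda>x::'a. complex_of_real (exp (- c * (norm x)\<^sup>2)) * cis (- (x \<bullet> w)))"
    and "(LINT x|lborel. complex_of_real (exp (- c * (norm x)\<^sup>2)) * cis (- (x \<bullet> w)))
          = complex_of_real (sqrt (pi / c) ^ DIM('a) * exp (- (norm w)\<^sup>2 / (4 * c)))"
proof -
  let ?g = "\<lambda>b y. complex_of_real (exp (- c * y\<^sup>2)) * cis (- (y * (w \<bullet> b)))"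
  interpret product_sigma_finite "\<lambda>_::'a. lborel :: real measure" ..
  have nrm: "(norm x)\<^sup>2 = (\<Sum>b\<in>Basis. (x \<bullet> b)\<^sup>2)" for x :: 'a
    unfolding power2_norm_eq_inner by (subst euclidean_inner) (simp add: power2_eq_square)
  have cp: "cis (\<Sum>b\<in>S. h b) = (\<Prod>b\<in>S. cis (h b))" if "finite S" for S and h :: "'a \<Rightarrow> real"
    using that by (induction S) (auto simp: cis_mult[symmetric])
  have pr: "complex_of_real (exp (- c * (norm x)\<^sup>2)) * cis (- (x \<bullet> w)) = (\<Prod>b\<in>Basis. ?g b (x \<bullet> b))" for x
    by (simp add: nrm euclidean_inner[of x w] prod.distrib cp[symmetric] exp_sum[symmetric]
         sum_distrib_left sum_negf[symmetric] flip: of_real_prod)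
  have m: "(\<lambda>f. \<Sum>b\<in>Basis. f b *\<^sub>R b) \<in> measurable (\<Pi>\<^sub>M b\<in>(Basis::'a set). lborel) borel"
    by measurable
  have gm: "(\<lambda>x::'a. complex_of_real (exp (- c * (norm x)\<^sup>2)) * cis (- (x \<bullet> w))) \<in> borel_measurable borel"
    by (intro borel_measurable_continuous_onI continuous_intros)
  have eqb: "(\<Prod>b\<in>Basis. ?g b ((\<Sum>b\<in>Basis. f b *\<^sub>R b) \<bullet> b)) = (\<Prod>b\<in>(Basis::'a set). ?g b (f b))" for f
    by (rule prod.cong) (auto simp: inner_sum_left inner_Basis if_distrib cong: if_cong)
  have "integrable (\<Pi>\<^sub>M b\<in>(Basis::'a set). lborel) (\<lambda>f. \<Prod>b\<in>Basis. ?g b (f b))"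
    by (rule product_integrable_prod[OF finite_Basis], rule gaussian_fourier_real(1)[OF c])
  then show "integrable lborel (\<lambda>x::'a. complex_of_real (exp (- c * (norm x)\<^sup>2)) * cis (- (x \<bullet> w)))"
    by (subst lborel_eq, subst integrable_distr_eq[OF m gm]) (simp only: pr eqb)
  have "(LINT x|lborel. complex_of_real (exp (- c * (norm x)\<^sup>2)) * cis (- (x \<bullet> w)))
     = integral\<^sup>L (\<Pi>\<^sub>M b\<in>(Basis::'a set). lborel) (\<lambda>f. \<Prod>b\<in>Basis. ?g b (f b))"
    by (subst lborel_eq, subst integral_distr[OF m gm]) (simp only: pr eqb)
  also have "\<dots> = (\<Prod>b\<in>Basis. (LINT y|lborel. ?g b y))"
    by (rule product_integral_prod[OF finite_Basis], rule gaussian_fourier_real(1)[OF c])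
  also have "\<dots> = (\<Prod>b\<in>(Basis::'a set). complex_of_real (sqrt (pi / c) * exp (- (w \<bullet> b)\<^sup>2 / (4 * c))))"
    by (intro prod.cong refl gaussian_fourier_real[OF c])
  also have "\<dots> = complex_of_real (sqrt (pi / c) ^ DIM('a) * exp (- (norm w)\<^sup>2 / (4 * c)))"
    by (simp add: nrm prod.distrib exp_sum[symmetric] sum_divide_distrib sum_negf
       flip: of_real_prod)
  finally show "(LINT x|lborel. complex_of_real (exp (- c * (norm x)\<^sup>2)) * cis (- (x \<bullet> w)))
          = complex_of_real (sqrt (pi / c) ^ DIM('a) * exp (- (norm w)\<^sup>2 / (4 * c)))" .
qed

lemma gaussian_fourier_plane:
  fixes w :: plane
  assumes c: "c > 0"
  shows "integrable lborel (\<lambda>x::plane. complex_of_real (exp (- c * (norm x)\<^sup>2)) * cis (- (x \<bullet> w)))"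
    and "(LINT x|lborel. complex_of_real (exp (- c * (norm x)\<^sup>2)) * cis (- (x \<bullet> w)))
          = complex_of_real (pi / c * exp (- (norm w)\<^sup>2 / (4 * c)))"
  using gaussian_fourier_euclidean[OF c, of w] c by simp_all

lemma gaussian_integral_plane:
  assumes c: "c > 0"
  shows "integrable lborel (\<lambda>x::plane. exp (- c * (norm x)\<^sup>2))"
    and "(LINT x|lborel. exp (- c * (norm (x::plane))\<^sup>2)) = pi / c"
proof -
  have "integrable lborel (\<lambda>x::plane. complex_of_real (exp (- c * (norm x)\<^sup>2)))"
    using gaussian_fourier_plane(1)[OF c, of 0] by simp
  then show 1: "integrable lborel (\<lambda>x::plane. exp (- c * (norm x)\<^sup>2))"
    by (simp only: complex_of_real_integrable_eq)
  have "complex_of_real (LINT x|lborel. exp (- c * (norm (x::plane))\<^sup>2)) = complex_of_real (pi / c)"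
    using gaussian_fourier_plane(2)[OF c, of 0] by (simp flip: integral_complex_of_real)
  then show "(LINT x|lborel. exp (- c * (norm (x::plane))\<^sup>2)) = pi / c"
    using of_real_eq_iff by blast
qed

section \<open>Polar coordinates for radial functions\<close>

text \<open>Both measures give a half-line \<open>{..a}\<close> with a >= 0 the area pi a^2 of the
  disc, and half-lines generate the Borel sets. This yields polar coordinates for radial functions
  without a change of variables.\<close>

lemma distr_norm_plane:
  "distr lborel borel (norm :: plane \<Rightarrow> real) = density lborel (\<lambda>r. ennreal (2 * pi * r) * indicator {0..} r)"
    (is "?M = ?N")
proof (rule measure_eqI_generator_eq[where E = "range (\<lambda>a::real. {..a})" and \<Omega> = UNIV and A = "\<lambda>n. {..real n}"])
  show "Int_stable (range (\<lambda>a::real. {..a}))"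
    by (auto simp: Int_stable_def)
  have sb: "sets borel = sigma_sets UNIV (range (\<lambda>a::real. {..a}))"
    unfolding borel_eq_atMost by (subst sets_measure_of) auto
  show "sets ?M = sigma_sets UNIV (range (\<lambda>a::real. {..a}))" "sets ?N = sigma_sets UNIV (range (\<lambda>a::real. {..a}))"
    using sb by auto
  have em: "emeasure ?M {..a} = ennreal (if a \<ge> 0 then pi * a\<^sup>2 else 0)" for a
  proof -
    have "emeasure ?M {..a} = emeasure lborel (norm -` {..a} :: plane set)"
      by (subst emeasure_distr) auto
    also have "norm -` {..a} = (if a \<ge> 0 then cball 0 a else {} :: plane set)"
      by (auto intro: order_trans[OF norm_ge_zero])
    finally show ?thesis by (simp add: emeasure_cball eval_unit_ball_vol)
  qed
  have en: "emeasure ?N {..a} = ennreal (if a \<ge> 0 then pi * a\<^sup>2 else 0)" for a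
  proof (cases "a \<ge> 0")
    case True
    have "emeasure ?N {..a} = (\<integral>\<^sup>+ r. ennreal (2 * pi * r) * indicator {0..a} r \<partial>lborel)"
      by (subst emeasure_density) (auto intro!: nn_integral_cong split: split_indicator)
    also have "\<dots> = ennreal (pi * a\<^sup>2 - pi * 0\<^sup>2)"
      by (rule nn_integral_FTC_Icc) (auto intro!: derivative_eq_intros True)
    finally show ?thesis using True by simp
  next
    case False
    have "emeasure ?N {..a} = (\<integral>\<^sup>+ r. (ennreal (2 * pi * r) * indicator {0..} r) * indicator {..a} r \<partial>lborel)"
      by (rule emeasure_density) auto
    also have "\<dots> = (\<integral>\<^sup>+ r. 0 \<partial>(lborel::real measure))"
      using False by (intro nn_integral_cong) (auto split: split_indicator)
    finally show ?thesis using False by simp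
  qed
  show "emeasure ?M X = emeasure ?N X" if "X \<in> range (\<lambda>a::real. {..a})" for X
    using that em en by auto
  show "emeasure ?M {..real n} \<noteq> \<infinity>" for n by (simp add: em)
  show "(\<Union>n. {..real n}) = UNIV"
    by (auto intro: real_arch_simple)
qed auto

lemma nn_integral_radial_plane:
  assumes [measurable]: "f \<in> borel_measurable borel"
  shows "(\<integral>\<^sup>+ x. f (norm (x::plane)) \<partial>lborel) = ennreal (2 * pi) * (\<integral>\<^sup>+ r. ennreal r * f r * indicator {0..} r \<partial>lborel)"
proof -
  have "(\<integral>\<^sup>+ x. f (norm (x::plane)) \<partial>lborel) = (\<integral>\<^sup>+ r. f r \<partial>distr lborel borel (norm :: plane \<Rightarrow> real))"
    by (subst nn_integral_distr) auto
  also have "\<dots> = (\<integral>\<^sup>+ r. ennreal (2 * pi) * (ennreal r * f r * indicator {0..} r) \<partial>lborel)"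
    unfolding distr_norm_plane
    by (subst nn_integral_density) (auto intro!: nn_integral_cong simp: ennreal_mult' mult_ac split: split_indicator)
  also have "\<dots> = ennreal (2 * pi) * (\<integral>\<^sup>+ r. ennreal r * f r * indicator {0..} r \<partial>lborel)"
    by (rule nn_integral_cmult) auto
  finally show ?thesis .
qed

section \<open>Square-integrable functions\<close>

lemma borel_measurable_cnj [measurable]: "cnj \<in> borel_measurable borel"
  by (intro borel_measurable_continuous_onI continuous_intros)

lemma L2_measurable [measurable_dest]: "f \<in> L2 \<Longrightarrow> f \<in> borel_measurable borel"
  by (simp add: L2_def)

lemma L2_square_integrable: "f \<in> L2 \<Longrightarrow> integrable lborel (\<lambda>x. (cmod (f x))\<^sup>2)"
  by (simp add: L2_def)

lemma L2_iff_nn_integral: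
  "f \<in> L2 \<longleftrightarrow> f \<in> borel_measurable borel \<and> (\<integral>\<^sup>+x. ennreal ((cmod (f x))\<^sup>2) \<partial>lborel) < \<infinity>"
  unfolding L2_def by (auto simp: integrable_iff_bounded)

lemma L2_dominated:
  assumes [measurable]: "f \<in> borel_measurable borel" and h: "h \<in> L2"
    and le: "\<And>x. cmod (f x) \<le> C * cmod (h x)"
  shows "f \<in> L2"
proof -
  have "integrable lborel (\<lambda>x. C\<^sup>2 * (cmod (h x))\<^sup>2)"
    using L2_square_integrable[OF h] by simp
  then have "integrable lborel (\<lambda>x. (cmod (f x))\<^sup>2)"
  proof (rule Bochner_Integration.integrable_bound)
    show "AE x in lborel. norm ((cmod (f x))\<^sup>2) \<le> norm (C\<^sup>2 * (cmod (h x))\<^sup>2)"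
    proof (rule AE_I2)
      fix x
      have "(cmod (f x))\<^sup>2 \<le> (C * cmod (h x))\<^sup>2"
        by (intro power_mono le) auto
      then show "norm ((cmod (f x))\<^sup>2) \<le> norm (C\<^sup>2 * (cmod (h x))\<^sup>2)"
        by (simp add: power_mult_distrib)
    qed
  qed auto
  then show ?thesis by (simp add: L2_def)
qed

lemma L2_cmult: "f \<in> L2 \<Longrightarrow> (\<lambda>x. c * f x) \<in> L2"
  by (rule L2_dominated[where h=f and C="cmod c"]) (auto dest: L2_measurable simp: norm_mult)

lemma L2_cnj: "f \<in> L2 \<Longrightarrow> (\<lambda>x. cnj (f x)) \<in> L2"
  by (rule L2_dominated[where h=f and C=1]) (auto dest!: L2_measurable)

lemma L2_add:
  assumes f: "f \<in> L2" and h: "h \<in> L2"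
  shows "(\<lambda>x. f x + h x) \<in> L2"
proof -
  have [measurable]: "f \<in> borel_measurable borel" "h \<in> borel_measurable borel"
    using f h by (auto dest: L2_measurable)
  have "integrable lborel (\<lambda>x. 2 * (cmod (f x))\<^sup>2 + 2 * (cmod (h x))\<^sup>2)"
    using L2_square_integrable[OF f] L2_square_integrable[OF h] by simp
  then have "integrable lborel (\<lambda>x. (cmod (f x + h x))\<^sup>2)"
  proof (rule Bochner_Integration.integrable_bound)
    have "(cmod (f x + h x))\<^sup>2 \<le> 2 * (cmod (f x))\<^sup>2 + 2 * (cmod (h x))\<^sup>2" for x
    proof -
      have "(cmod (f x + h x))\<^sup>2 \<le> (cmod (f x) + cmod (h x))\<^sup>2"
        by (intro power_mono norm_triangle_ineq) auto
      also have "\<dots> \<le> 2 * (cmod (f x))\<^sup>2 + 2 * (cmod (h x))\<^sup>2"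
        using sum_squares_bound[of "cmod (f x)" "cmod (h x)"] by (simp add: power2_sum)
      finally show ?thesis .
    qed
    then show "AE x in lborel. norm ((cmod (f x + h x))\<^sup>2) \<le> norm (2 * (cmod (f x))\<^sup>2 + 2 * (cmod (h x))\<^sup>2)"
      by auto
  qed auto
  then show ?thesis by (simp add: L2_def)
qed

lemma L2_diff: "f \<in> L2 \<Longrightarrow> h \<in> L2 \<Longrightarrow> (\<lambda>x. f x - h x) \<in> L2"
  using L2_add[of f "\<lambda>x. - 1 * h x"] L2_cmult[of h "-1"] by simp

lemma L2_mult_bounded:
  assumes "f \<in> L2" "m \<in> borel_measurable borel" "\<And>x. cmod (m x) \<le> C"
  shows "(\<lambda>x. m x * f x) \<in> L2"
proof (rule L2_dominated[OF _ assms(1)])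
  show "(\<lambda>x. m x * f x) \<in> borel_measurable borel"
    using assms(2) L2_measurable[OF assms(1)] by measurable
  show "cmod (m x * f x) \<le> C * cmod (f x)" for x
    using assms(3)[of x] by (simp add: norm_mult mult_right_mono)
qed

lemma L2_indicator:
  "f \<in> L2 \<Longrightarrow> A \<in> sets borel \<Longrightarrow> (\<lambda>x. indicator A x * f x) \<in> L2"
  by (rule L2_mult_bounded[where C=1]) (auto split: split_indicator)

lemma L2_mult_integrable:
  assumes f: "f \<in> L2" and h: "h \<in> L2"
  shows "integrable lborel (\<lambda>x. f x * h x)"
proof -
  have [measurable]: "f \<in> borel_measurable borel" "h \<in> borel_measurable borel"
    using f h by (auto dest: L2_measurable)
  have "integrable lborel (\<lambda>x. (cmod (f x))\<^sup>2 + (cmod (h x))\<^sup>2)"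
    using L2_square_integrable[OF f] L2_square_integrable[OF h] by simp
  then show ?thesis
  proof (rule Bochner_Integration.integrable_bound)
    have "cmod (f x * h x) \<le> (cmod (f x))\<^sup>2 + (cmod (h x))\<^sup>2" for x
    proof -
      have "0 \<le> cmod (f x) * cmod (h x)" by simp
      then show ?thesis
        using sum_squares_bound[of "cmod (f x)" "cmod (h x)"] unfolding norm_mult by linarith
    qed
    then show "AE x in lborel. norm (f x * h x) \<le> norm ((cmod (f x))\<^sup>2 + (cmod (h x))\<^sup>2)"
      by auto
  qed auto
qed

section \<open>Inner product and norm of L^2\<close>

lemma L2_inner_integrable:
  "f \<in> L2 \<Longrightarrow> h \<in> L2 \<Longrightarrow> integrable lborel (\<lambda>x. f x * cnj (h x))"
  by (intro L2_mult_integrable L2_cnj)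

lemma L2_inner_diff_left:
  "f \<in> L2 \<Longrightarrow> f' \<in> L2 \<Longrightarrow> h \<in> L2 \<Longrightarrow> L2_inner (\<lambda>x. f x - f' x) h = L2_inner f h - L2_inner f' h"
  unfolding L2_inner_def by (simp add: L2_inner_integrable left_diff_distrib)

lemma L2_inner_cmult_left: "L2_inner (\<lambda>x. c * f x) h = c * L2_inner f h"
  unfolding L2_inner_def by (simp add: mult.assoc)

lemma L2_inner_commute: "L2_inner f h = cnj (L2_inner h f)"
  unfolding L2_inner_def by (simp add: mult.commute flip: Bochner_Integration.integral_cnj)

lemma L2_inner_diff_right:
  "f \<in> L2 \<Longrightarrow> f' \<in> L2 \<Longrightarrow> h \<in> L2 \<Longrightarrow> L2_inner h (\<lambda>x. f x - f' x) = L2_inner h f - L2_inner h f'"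
  unfolding L2_inner_def by (simp add: L2_inner_integrable right_diff_distrib)

definition L2_norm :: "(plane \<Rightarrow> complex) \<Rightarrow> real" where
  "L2_norm f = sqrt (\<integral>x. (cmod (f x))\<^sup>2 \<partial>lborel)"

lemma L2_norm_nonneg [simp]: "L2_norm f \<ge> 0"
  by (simp add: L2_norm_def)

lemma L2_norm_power2: "(L2_norm f)\<^sup>2 = (\<integral>x. (cmod (f x))\<^sup>2 \<partial>lborel)"
  by (simp add: L2_norm_def)

lemma L2_inner_self: "L2_inner f f = complex_of_real ((L2_norm f)\<^sup>2)"
  unfolding L2_inner_def L2_norm_power2
  by (subst integral_complex_of_real[symmetric]) (simp add: complex_norm_square flip: of_real_power)

lemma L2_norm_nn_integral:
  "f \<in> L2 \<Longrightarrow> (\<integral>\<^sup>+x. ennreal ((cmod (f x))\<^sup>2) \<partial>lborel) = ennreal ((L2_norm f)\<^sup>2)"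
  unfolding L2_norm_power2 by (rule nn_integral_eq_integral) (auto simp: L2_def)

lemma L2_inner_cong:
  assumes "AE x in lborel. f x = f' x" "f \<in> borel_measurable borel" "f' \<in> borel_measurable borel"
    and "h \<in> borel_measurable borel"
  shows "L2_inner f h = L2_inner f' h"
  unfolding L2_inner_def
proof (rule integral_cong_AE)
  show "AE x in lborel. f x * cnj (h x) = f' x * cnj (h x)"
    using assms(1) by eventually_elim simp
qed (use assms(2-4) in measurable)

lemma L2_norm_cong:
  assumes "AE x in lborel. f x = f' x" "f \<in> borel_measurable borel" "f' \<in> borel_measurable borel"
  shows "L2_norm f = L2_norm f'"
  unfolding L2_norm_def using assms by (intro arg_cong[where f=sqrt] integral_cong_AE) auto

lemma L2_Cauchy_Schwarz_integral:
  assumes f: "f \<in> L2" and h: "h \<in> L2"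
  shows "(\<integral>x. cmod (f x) * cmod (h x) \<partial>lborel) \<le> L2_norm f * L2_norm h"
proof -
  have [measurable]: "f \<in> borel_measurable borel" "h \<in> borel_measurable borel"
    using f h by (auto dest: L2_measurable)
  have int: "integrable lborel (\<lambda>x. cmod (f x) * cmod (h x))"
    using integrable_norm[OF L2_mult_integrable[OF f h]] by (simp add: norm_mult)
  have "(\<integral>\<^sup>+x. ennreal (cmod (f x)) * ennreal (cmod (h x)) \<partial>lborel)\<^sup>2
     \<le> (\<integral>\<^sup>+x. ennreal (cmod (f x)) ^ 2 \<partial>lborel) * (\<integral>\<^sup>+x. ennreal (cmod (h x)) ^ 2 \<partial>lborel)"
    by (rule Cauchy_Schwarz_nn_integral) auto
  also have "\<dots> = ennreal ((L2_norm f * L2_norm h)\<^sup>2)"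
    by (simp add: ennreal_power L2_norm_nn_integral f h power_mult_distrib ennreal_mult)
  also have "(\<integral>\<^sup>+x. ennreal (cmod (f x)) * ennreal (cmod (h x)) \<partial>lborel)
      = ennreal (\<integral>x. cmod (f x) * cmod (h x) \<partial>lborel)"
    by (simp add: ennreal_mult[symmetric] nn_integral_eq_integral[OF int])
  finally have "(\<integral>x. cmod (f x) * cmod (h x) \<partial>lborel)\<^sup>2 \<le> (L2_norm f * L2_norm h)\<^sup>2"
    by (simp add: ennreal_power)
  then show ?thesis
    by (rule power2_le_imp_le) simp
qed

lemma L2_inner_Cauchy_Schwarz:
  assumes f: "f \<in> L2" and h: "h \<in> L2"
  shows "cmod (L2_inner f h) \<le> L2_norm f * L2_norm h"
proof -
  have "cmod (L2_inner f h) \<le> (\<integral>x. cmod (f x * cnj (h x)) \<partial>lborel)"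
    unfolding L2_inner_def by (rule integral_norm_bound)
  then show ?thesis
    using L2_Cauchy_Schwarz_integral[OF f h] by (simp add: norm_mult)
qed

text \<open>The law of cosines. It is the source of polarisation in \<open>Plancherel_inner\<close>
  and identifies the inverse transform in \<open>has_fourier_inverse_exists\<close>.\<close>

lemma L2_norm_diff_power2:
  assumes f: "f \<in> L2" and h: "h \<in> L2"
  shows "(L2_norm (\<lambda>x. f x - h x))\<^sup>2 = (L2_norm f)\<^sup>2 + (L2_norm h)\<^sup>2 - 2 * Re (L2_inner f h)"
proof -
  have "complex_of_real ((L2_norm (\<lambda>x. f x - h x))\<^sup>2) = L2_inner f f - L2_inner f h - (L2_inner h f - L2_inner h h)"
    unfolding L2_inner_self[symmetric]
    by (simp add: L2_inner_diff_left L2_inner_diff_right L2_diff f h)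
  also have "L2_inner h f = cnj (L2_inner f h)" by (rule L2_inner_commute)
  finally have "Re (complex_of_real ((L2_norm (\<lambda>x. f x - h x))\<^sup>2))
     = Re (L2_inner f f - L2_inner f h - (cnj (L2_inner f h) - L2_inner h h))"
    by (rule arg_cong)
  then show ?thesis by (simp add: L2_inner_self)
qed

lemma L2_norm_cmult: "L2_norm (\<lambda>x. c * f x) = cmod c * L2_norm f"
  unfolding L2_norm_def by (simp add: norm_mult power_mult_distrib real_sqrt_mult)

lemma L2_norm_triangle_diff:
  assumes f: "f \<in> L2" and h: "h \<in> L2"
  shows "L2_norm (\<lambda>x. f x - h x) \<le> L2_norm f + L2_norm h"
proof (rule power2_le_imp_le)
  have "- Re (L2_inner f h) \<le> L2_norm f * L2_norm h"
    using L2_inner_Cauchy_Schwarz[OF f h] abs_Re_le_cmod[of "L2_inner f h"] by linarith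
  then show "(L2_norm (\<lambda>x. f x - h x))\<^sup>2 \<le> (L2_norm f + L2_norm h)\<^sup>2"
    unfolding L2_norm_diff_power2[OF f h] by (simp add: power2_sum)
qed simp

lemma L2_norm_diff_commute: "L2_norm (\<lambda>x. f x - h x) = L2_norm (\<lambda>x. h x - f x)"
  unfolding L2_norm_def by (simp add: norm_minus_commute)

lemma L2_norm_triangle3:
  assumes f: "f \<in> L2" and h: "h \<in> L2" and k: "k \<in> L2"
  shows "L2_norm (\<lambda>x. f x - k x) \<le> L2_norm (\<lambda>x. f x - h x) + L2_norm (\<lambda>x. h x - k x)"
  using L2_norm_triangle_diff[of "\<lambda>x. f x - h x" "\<lambda>x. k x - h x"] assms
  by (simp add: L2_diff L2_norm_diff_commute[of k h])

lemma L2_norm_reverse_triangle: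
  assumes f: "f \<in> L2" and h: "h \<in> L2"
  shows "\<bar>L2_norm f - L2_norm h\<bar> \<le> L2_norm (\<lambda>x. f x - h x)"
proof -
  have "L2_norm f \<le> L2_norm (\<lambda>x. f x - h x) + L2_norm h"
    using L2_norm_triangle3[of f h "\<lambda>x. 0"] f h by (simp add: L2_def)
  moreover have "L2_norm h \<le> L2_norm (\<lambda>x. f x - h x) + L2_norm f"
    using L2_norm_triangle3[of h f "\<lambda>x. 0"] f h by (simp add: L2_def L2_norm_diff_commute[of h f])
  ultimately show ?thesis by linarith
qed

lemma L2_norm_eq_0_AE:
  assumes f: "f \<in> L2" and z: "L2_norm f = 0"
  shows "AE x in lborel. f x = 0"
proof -
  have "(\<integral>x. (cmod (f x))\<^sup>2 \<partial>lborel) = 0" using z by (simp add: L2_norm_def)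
  then have "AE x in lborel. (cmod (f x))\<^sup>2 = 0"
    using integral_nonneg_eq_0_iff_AE[OF L2_square_integrable[OF f]] by auto
  then show ?thesis by auto
qed

lemma L2_norm_diff_0_AE:
  assumes "f \<in> L2" "h \<in> L2" "L2_norm (\<lambda>x. f x - h x) = 0"
  shows "AE x in lborel. f x = h x"
  using L2_norm_eq_0_AE[OF L2_diff[OF assms(1,2)] assms(3)] by auto

lemma L2_tendsto_norm:
  assumes "\<And>n. f n \<in> L2" "g \<in> L2" "((\<lambda>n. L2_norm (\<lambda>x. f n x - g x)) \<longlongrightarrow> 0) F"
  shows "((\<lambda>n. L2_norm (f n)) \<longlongrightarrow> L2_norm g) F"
proof -
  have "((\<lambda>n. L2_norm (f n) - L2_norm g) \<longlongrightarrow> 0) F"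
    by (rule Lim_null_comparison[OF _ assms(3)])
       (auto intro!: always_eventually L2_norm_reverse_triangle assms)
  then show ?thesis by (simp add: LIM_zero_iff)
qed

lemma L2_tendsto_inner:
  assumes "\<And>n. f n \<in> L2" "g \<in> L2" "((\<lambda>n. L2_norm (\<lambda>x. f n x - g x)) \<longlongrightarrow> 0) F"
    and h: "h \<in> L2"
  shows "((\<lambda>n. L2_inner (f n) h) \<longlongrightarrow> L2_inner g h) F"
proof -
  have "((\<lambda>n. L2_inner (f n) h - L2_inner g h) \<longlongrightarrow> 0) F"
  proof (rule Lim_null_comparison)
    show "\<forall>\<^sub>F n in F. norm (L2_inner (f n) h - L2_inner g h) \<le> L2_norm (\<lambda>x. f n x - g x) * L2_norm h"
      using L2_inner_Cauchy_Schwarz[OF L2_diff[OF assms(1,2)] h]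
      by (intro always_eventually) (simp add: L2_inner_diff_left assms)
    show "((\<lambda>n. L2_norm (\<lambda>x. f n x - g x) * L2_norm h) \<longlongrightarrow> 0) F"
      by (rule tendsto_mult_left_zero[OF assms(3)])
  qed
  then show ?thesis by (simp add: LIM_zero_iff)
qed

lemma L2_dominated_convergence:
  assumes f: "\<And>n. f n \<in> borel_measurable borel" and g: "g \<in> borel_measurable borel" and h: "h \<in> L2"
    and lim: "AE x in lborel. (\<lambda>n. f n x) \<longlonglongrightarrow> g x"
    and le: "\<And>n x. cmod (f n x) \<le> cmod (h x)" "\<And>x. cmod (g x) \<le> cmod (h x)"
  shows "(\<lambda>n. L2_norm (\<lambda>x. f n x - g x)) \<longlonglongrightarrow> 0"
proof -
  have "(\<lambda>n. \<integral>x. (cmod (f n x - g x))\<^sup>2 \<partial>lborel) \<longlonglongrightarrow> (\<integral>x. 0 \<partial>(lborel :: plane measure))"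
  proof (rule integral_dominated_convergence)
    show "integrable lborel (\<lambda>x. 4 * (cmod (h x))\<^sup>2)"
      using L2_square_integrable[OF h] by simp
    show "AE x in lborel. (\<lambda>n. (cmod (f n x - g x))\<^sup>2) \<longlonglongrightarrow> 0"
      using lim
    proof eventually_elim
      case (elim x)
      have "(\<lambda>n. (cmod (f n x - g x))\<^sup>2) \<longlonglongrightarrow> (cmod (g x - g x))\<^sup>2"
        by (intro tendsto_intros elim)
      then show ?case by simp
    qed
    show "AE x in lborel. norm ((cmod (f n x - g x))\<^sup>2) \<le> 4 * (cmod (h x))\<^sup>2" for n
    proof (rule AE_I2)
      fix x
      have "cmod (f n x - g x) \<le> 2 * cmod (h x)"
        using norm_triangle_ineq4[of "f n x" "g x"] le(1)[of n x] le(2)[of x] by linarith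
      then have "(cmod (f n x - g x))\<^sup>2 \<le> (2 * cmod (h x))\<^sup>2"
        by (intro power_mono) auto
      then show "norm ((cmod (f n x - g x))\<^sup>2) \<le> 4 * (cmod (h x))\<^sup>2" by (simp add: power_mult_distrib)
    qed
  qed (use f g in measurable)
  then have "(\<lambda>n. sqrt (\<integral>x. (cmod (f n x - g x))\<^sup>2 \<partial>lborel)) \<longlonglongrightarrow> sqrt 0"
    by (intro tendsto_real_sqrt) simp
  then show ?thesis by (simp add: L2_norm_def)
qed

text \<open>Riesz-Fischer by a fast subsequence: it converges almost everywhere, and Fatou's lemma
  turns this into norm convergence of the whole sequence. The limits that define Plancherel
  transforms come from here.\<close>

lemma L2_complete:
  assumes F: "\<And>n. F n \<in> L2"
    and Cauchy: "\<And>e. e > 0 \<Longrightarrow> \<exists>N. \<forall>m\<ge>N. \<forall>n\<ge>N. L2_norm (\<lambda>x. F m x - F n x) \<le> e"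
  shows "\<exists>G\<in>L2. (\<lambda>n. L2_norm (\<lambda>x. F n x - G x)) \<longlonglongrightarrow> 0"
proof -
  have [measurable]: "F n \<in> borel_measurable borel" for n using F[of n] by (rule L2_measurable)
  obtain N where N: "\<And>k m n. m \<ge> N k \<Longrightarrow> n \<ge> N k \<Longrightarrow> L2_norm (\<lambda>x. F m x - F n x) \<le> (1/4)^k"
    using Cauchy[of "(1/4)^_"] by (metis zero_less_power zero_less_divide_1_iff zero_less_numeral)
  \<comment> \<open>Adding up all earlier \<open>N i\<close> makes \<open>r j\<close> at least
    \<open>N k\<close> whenever k <= j, although \<open>N\<close> itself need not be
    monotone.\<close>
  define r where "r k = k + (\<Sum>i\<le>k. N i)" for k
  have r1: "r j \<ge> N k" if "j \<ge> k" for j k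
  proof -
    have "N k \<le> (\<Sum>i\<le>j. N i)" using that by (intro member_le_sum) auto
    then show ?thesis by (simp add: r_def)
  qed
  define D where "D k x = F (r (Suc k)) x - F (r k) x" for k x
  have DL: "D k \<in> L2" for k unfolding D_def by (intro L2_diff F)
  have [measurable]: "D k \<in> borel_measurable borel" for k using DL by (rule L2_measurable)
  have Dn: "L2_norm (D k) \<le> (1/4)^k" for k
    unfolding D_def by (rule N) (auto intro: r1)
  \<comment> \<open>The squared norm of \<open>D k\<close> is at most 16^(-k), so the weight 4^k
    still leaves the summable series of 4^(-k). Finiteness at a point then forces |D k x| <= 2^(-k)
    eventually, hence convergence of the telescoping series.\<close>
  have "(\<integral>\<^sup>+x. (\<Sum>k. ennreal (4^k * (cmod (D k x))\<^sup>2)) \<partial>lborel)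
      = (\<Sum>k. \<integral>\<^sup>+x. ennreal (4^k * (cmod (D k x))\<^sup>2) \<partial>lborel)"
    by (rule nn_integral_suminf) simp
  also have "\<dots> \<le> (\<Sum>k. ennreal ((1/4)^k))"
  proof (rule suminf_le)
    fix k
    have "(\<integral>\<^sup>+x. ennreal (4^k * (cmod (D k x))\<^sup>2) \<partial>lborel) = ennreal (4^k) * ennreal ((L2_norm (D k))\<^sup>2)"
      by (simp add: ennreal_mult nn_integral_cmult L2_norm_nn_integral[OF DL])
    also have "\<dots> \<le> ennreal (4^k) * ennreal (((1/4)^k)\<^sup>2)"
      by (intro mult_left_mono ennreal_leI power_mono Dn) auto
    also have "\<dots> = ennreal ((1/4)^k)"
      by (simp add: ennreal_mult[symmetric] power2_eq_square power_mult_distrib[symmetric])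
    finally show "(\<integral>\<^sup>+x. ennreal (4^k * (cmod (D k x))\<^sup>2) \<partial>lborel) \<le> ennreal ((1/4)^k)" .
  qed auto
  also have "\<dots> = ennreal (\<Sum>k. (1/4)^k)"
    by (rule suminf_ennreal2) (auto intro: summable_geometric)
  finally have "(\<integral>\<^sup>+x. (\<Sum>k. ennreal (4^k * (cmod (D k x))\<^sup>2)) \<partial>lborel) \<noteq> \<infinity>"
    by (auto simp: top_unique)
  then have AEfin: "AE x in lborel. (\<Sum>k. ennreal (4^k * (cmod (D k x))\<^sup>2)) \<noteq> \<infinity>"
    by (intro nn_integral_PInf_AE) auto
  define G where "G x = lim (\<lambda>k. F (r k) x)" for x
  have G_meas [measurable]: "G \<in> borel_measurable borel"
    unfolding G_def by measurable
  have conv: "AE x in lborel. (\<lambda>k. F (r k) x) \<longlonglongrightarrow> G x"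
    using AEfin
  proof eventually_elim
    case (elim x)
    have "summable (\<lambda>k. 4^k * (cmod (D k x))\<^sup>2)"
      using elim by (intro summable_suminf_not_top) auto
    then have "(\<lambda>k. 4^k * (cmod (D k x))\<^sup>2) \<longlonglongrightarrow> 0" by (rule summable_LIMSEQ_zero)
    then have "\<forall>\<^sub>F k in sequentially. 4^k * (cmod (D k x))\<^sup>2 < 1"
      by (rule order_tendstoD(2)) simp
    then have "\<forall>\<^sub>F k in sequentially. norm (D k x) \<le> (1/2)^k"
    proof eventually_elim
      case (elim k)
      have "(2^k * cmod (D k x))\<^sup>2 \<le> 1\<^sup>2"
        using elim power_mult_distrib[of "2::real" 2 k] by (simp add: power2_eq_square mult_ac)
      then have "2^k * cmod (D k x) \<le> 1"
        by (rule power2_le_imp_le) simp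
      then show ?case by (simp add: field_simps power_divide)
    qed
    then have "summable (\<lambda>k. D k x)"
      by (rule summable_comparison_test_ev) (auto intro: summable_geometric)
    then have "convergent (\<lambda>n. \<Sum>k<n. D k x)"
      by (simp add: summable_iff_convergent)
    moreover have "(\<Sum>k<n. D k x) = F (r n) x - F (r 0) x" for n
      unfolding D_def by (rule sum_lessThan_telescope)
    ultimately have "convergent (\<lambda>n. F (r n) x - F (r 0) x)" by simp
    then have "convergent (\<lambda>n. (F (r n) x - F (r 0) x) + F (r 0) x)"
      by (intro convergent_add convergent_const)
    then have "convergent (\<lambda>n. F (r n) x)" by simp
    then show ?case unfolding G_def by (simp add: convergent_LIMSEQ_iff)
  qed
  \<comment> \<open>Fatou along the subsequence: the integrand is the limit of |F n - F (r k)|^2,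
    whose integrals are bounded as soon as both indices have passed \<open>N j\<close>.\<close>
  have bound: "(\<integral>\<^sup>+x. ennreal ((cmod (F n x - G x))\<^sup>2) \<partial>lborel) \<le> ennreal (((1/4)^j)\<^sup>2)" if n: "n \<ge> r j" for n j
  proof -
    have "(\<integral>\<^sup>+x. ennreal ((cmod (F n x - G x))\<^sup>2) \<partial>lborel)
       = (\<integral>\<^sup>+x. liminf (\<lambda>k. ennreal ((cmod (F n x - F (r k) x))\<^sup>2)) \<partial>lborel)"
    proof (rule nn_integral_cong_AE, use conv in eventually_elim)
      case (elim x)
      have "(\<lambda>k. ennreal ((cmod (F n x - F (r k) x))\<^sup>2)) \<longlonglongrightarrow> ennreal ((cmod (F n x - G x))\<^sup>2)"
        by (intro tendsto_intros elim)
      then show ?case by (intro lim_imp_Liminf[symmetric]) auto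
    qed
    also have "\<dots> \<le> liminf (\<lambda>k. \<integral>\<^sup>+x. ennreal ((cmod (F n x - F (r k) x))\<^sup>2) \<partial>lborel)"
      by (rule nn_integral_liminf) simp
    also have "\<dots> \<le> ennreal (((1/4)^j)\<^sup>2)"
    proof (rule Liminf_le)
      show "\<forall>\<^sub>F k in sequentially. (\<integral>\<^sup>+x. ennreal ((cmod (F n x - F (r k) x))\<^sup>2) \<partial>lborel) \<le> ennreal (((1/4)^j)\<^sup>2)"
        using eventually_ge_at_top[of j]
      proof eventually_elim
        case (elim k)
        have "L2_norm (\<lambda>x. F n x - F (r k) x) \<le> (1/4)^j"
          using n r1[of j j] r1[OF elim] by (intro N) auto
        then show ?case
          by (subst L2_norm_nn_integral) (auto intro!: L2_diff F ennreal_leI power_mono)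
      qed
    qed simp
    finally show ?thesis .
  qed
  have dL: "(\<lambda>x. F n x - G x) \<in> L2" if "n \<ge> r 0" for n
    unfolding L2_iff_nn_integral using bound[OF that] by (auto simp: less_top[symmetric] top_unique)
  have "(\<lambda>x. F (r 0) x - (F (r 0) x - G x)) \<in> L2"
    by (intro L2_diff F dL) simp
  then have GL: "G \<in> L2" by simp
  have nb: "L2_norm (\<lambda>x. F n x - G x) \<le> (1/4)^j" if "n \<ge> r j" for n j
  proof (rule power2_le_imp_le)
    show "(L2_norm (\<lambda>x. F n x - G x))\<^sup>2 \<le> ((1/4)^j)\<^sup>2"
      using bound[OF that] by (subst (asm) L2_norm_nn_integral) (auto intro: L2_diff F GL)
  qed simp
  have "(\<lambda>n. L2_norm (\<lambda>x. F n x - G x)) \<longlonglongrightarrow> 0"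
  proof (rule LIMSEQ_I)
    fix e :: real assume "e > 0"
    then obtain j where j: "(1/4)^j < e"
      using real_arch_pow_inv[of e "1/4"] by auto
    show "\<exists>no. \<forall>n\<ge>no. norm (L2_norm (\<lambda>x. F n x - G x) - 0) < e"
      using nb[of j] j by (intro exI[of _ "r j"]) (auto intro: le_less_trans)
  qed
  with GL show ?thesis by blast
qed

section \<open>The Fourier transform\<close>

lemma integral_norm_le:
  fixes f :: "'a \<Rightarrow> 'b::{banach, second_countable_topology}"
  assumes g: "integrable M g" and le: "\<And>x. norm (f x) \<le> g x"
  shows "norm (\<integral>x. f x \<partial>M) \<le> (\<integral>x. g x \<partial>M)"
proof -
  have "norm (\<integral>x. f x \<partial>M) \<le> (\<integral>x. norm (f x) \<partial>M)"
    by (rule integral_norm_bound)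
  also have "\<dots> \<le> (\<integral>x. g x \<partial>M)"
    using le by (intro integral_mono'[OF g]) (auto intro: order_trans[OF norm_ge_zero])
  finally show ?thesis .
qed

lemma integrable_mult_pair:
  fixes f :: "'a::euclidean_space \<Rightarrow> complex" and h :: "'b::euclidean_space \<Rightarrow> complex"
  assumes f: "integrable lborel f" and h: "integrable lborel h"
  shows "integrable (lborel \<Otimes>\<^sub>M lborel) (\<lambda>(x, y). f x * h y)"
proof (rule lborel_pair.Fubini_integrable)
  have [measurable]: "f \<in> borel_measurable borel" "h \<in> borel_measurable borel"
    using f h by (auto dest: borel_measurable_integrable)
  show "(\<lambda>(x, y). f x * h y) \<in> borel_measurable (lborel \<Otimes>\<^sub>M lborel)"
    by measurable
  show "integrable lborel (\<lambda>x. \<integral>y. norm (case (x, y) of (x, y) \<Rightarrow> f x * h y) \<partial>lborel)"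
    using f by (simp add: norm_mult)
  show "AE x in lborel. integrable lborel (\<lambda>y. case (x, y) of (x, y) \<Rightarrow> f x * h y)"
    using h by simp
qed

text \<open>As the kernel has modulus at most 1, the integrand is dominated by |f x| |h y|,
  integrable on the product. One statement serves both the multiplication formula and the multiplier
  formula.\<close>

lemma Fubini_bounded_kernel:
  fixes f :: "'a::euclidean_space \<Rightarrow> complex" and h :: "'b::euclidean_space \<Rightarrow> complex"
  assumes f: "integrable lborel f" and h: "integrable lborel h"
    and k [measurable]: "(\<lambda>(x, y). k x y) \<in> borel_measurable (borel \<Otimes>\<^sub>M borel)"
    and k1: "\<And>x y. cmod (k x y) \<le> 1"
  shows "(\<integral>x. f x * (\<integral>y. k x y * h y \<partial>lborel) \<partial>lborel) = (\<integral>y. h y * (\<integral>x. k x y * f x \<partial>lborel) \<partial>lborel)"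
proof -
  have [measurable]: "f \<in> borel_measurable borel" "h \<in> borel_measurable borel"
    using f h by (auto dest: borel_measurable_integrable)
  have int: "integrable (lborel \<Otimes>\<^sub>M lborel) (\<lambda>(x, y). k x y * (f x * h y))"
  proof (rule Bochner_Integration.integrable_bound[OF integrable_mult_pair[OF f h]])
    show "AE p in lborel \<Otimes>\<^sub>M lborel. norm (case p of (x, y) \<Rightarrow> k x y * (f x * h y)) \<le> norm (case p of (x, y) \<Rightarrow> f x * h y)"
    proof (rule AE_I2, clarify)
      fix x y
      show "norm (k x y * (f x * h y)) \<le> norm (f x * h y)"
        using mult_right_mono[OF k1[of x y], of "norm (f x * h y)"] by (simp add: norm_mult)
    qed
  qed measurable
  have "(\<integral>x. f x * (\<integral>y. k x y * h y \<partial>lborel) \<partial>lborel) = (\<integral>x. (\<integral>y. k x y * (f x * h y) \<partial>lborel) \<partial>lborel)"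
    by (simp flip: Bochner_Integration.integral_mult_right_zero) (simp add: mult_ac)
  also have "\<dots> = (\<integral>y. (\<integral>x. k x y * (f x * h y) \<partial>lborel) \<partial>lborel)"
    by (rule lborel_pair.Fubini_integral[OF int, symmetric])
  also have "\<dots> = (\<integral>y. h y * (\<integral>x. k x y * f x \<partial>lborel) \<partial>lborel)"
    by (simp flip: Bochner_Integration.integral_mult_right_zero) (simp add: mult_ac)
  finally show ?thesis .
qed

lemma integral_affine_euclidean:
  fixes F :: "'a::euclidean_space \<Rightarrow> 'b::{banach, second_countable_topology}"
  assumes [measurable]: "F \<in> borel_measurable borel" and c: "c \<noteq> 0"
  shows "(\<integral>x. F x \<partial>lborel) = \<bar>c\<bar> ^ DIM('a) *\<^sub>R (\<integral>u. F (t + c *\<^sub>R u) \<partial>lborel)"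
  by (subst lborel_affine[OF c, of t]) (simp add: integral_density integral_distr)

lemma nn_integral_affine_euclidean:
  fixes F :: "'a::euclidean_space \<Rightarrow> ennreal"
  assumes [measurable]: "F \<in> borel_measurable borel" and c: "c \<noteq> 0"
  shows "(\<integral>\<^sup>+x. F x \<partial>lborel) = ennreal (\<bar>c\<bar> ^ DIM('a)) * (\<integral>\<^sup>+u. F (t + c *\<^sub>R u) \<partial>lborel)"
  by (subst lborel_affine[OF c, of t]) (simp add: nn_integral_density nn_integral_distr nn_integral_cmult)

section \<open>The Fourier transform of integrable functions\<close>

definition fourier_L1 :: "(plane \<Rightarrow> complex) \<Rightarrow> plane \<Rightarrow> complex" where
  "fourier_L1 f \<xi> = (1 / (2 * pi)) *\<^sub>R (LINT x|lborel. cis (- (x \<bullet> \<xi>)) * f x)"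

lemma cis_measurable [measurable]: "cis \<in> borel_measurable borel"
  by (intro borel_measurable_continuous_onI continuous_intros)

lemma integrable_cis_mult:
  assumes f: "integrable lborel f" and [measurable]: "a \<in> borel_measurable borel"
  shows "integrable lborel (\<lambda>x. cis (a x) * f x)"
proof (rule Bochner_Integration.integrable_bound[OF f])
  have [measurable]: "f \<in> borel_measurable borel"
    using f by (auto dest: borel_measurable_integrable)
  show "(\<lambda>x. cis (a x) * f x) \<in> borel_measurable lborel" by measurable
qed (simp add: norm_mult)

lemma fourier_L1_measurable [measurable]:
  assumes [measurable]: "f \<in> borel_measurable borel"
  shows "fourier_L1 f \<in> borel_measurable borel"
proof -
  have "(\<lambda>\<xi>. LINT x|lborel. cis (- (x \<bullet> \<xi>)) * f x) \<in> borel_measurable borel"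
    by (rule lborel.borel_measurable_lebesgue_integral) measurable
  then show ?thesis unfolding fourier_L1_def by measurable
qed

lemma fourier_L1_bound:
  "cmod (fourier_L1 f \<xi>) \<le> (1 / (2 * pi)) * (\<integral>x. cmod (f x) \<partial>lborel)"
proof -
  have "cmod (LINT x|lborel. cis (- (x \<bullet> \<xi>)) * f x) \<le> (\<integral>x. cmod (cis (- (x \<bullet> \<xi>)) * f x) \<partial>lborel)"
    by (rule integral_norm_bound)
  then show ?thesis
    unfolding fourier_L1_def by (simp add: norm_mult divide_right_mono)
qed

lemma fourier_L1_diff:
  assumes f: "integrable lborel f" and h: "integrable lborel h"
  shows "fourier_L1 (\<lambda>x. f x - h x) \<xi> = fourier_L1 f \<xi> - fourier_L1 h \<xi>"
proof -
  have "(LINT x|lborel. cis (- (x \<bullet> \<xi>)) * (f x - h x))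
     = (LINT x|lborel. cis (- (x \<bullet> \<xi>)) * f x) - (LINT x|lborel. cis (- (x \<bullet> \<xi>)) * h x)"
    unfolding right_diff_distrib
    by (rule Bochner_Integration.integral_diff) (auto intro!: integrable_cis_mult f h)
  then show ?thesis by (simp add: fourier_L1_def scaleR_diff_right)
qed

text \<open>The multiplication formula. Its extension to L^2 is what yields inversion.\<close>

lemma fourier_L1_transfer:
  assumes f: "integrable lborel f" and h: "integrable lborel h"
  shows "(\<integral>x. fourier_L1 f x * h x \<partial>lborel) = (\<integral>x. f x * fourier_L1 h x \<partial>lborel)"
proof -
  have "(\<integral>x. h x * (\<integral>y. cis (- (y \<bullet> x)) * f y \<partial>lborel) \<partial>lborel)
     = (\<integral>y. f y * (\<integral>x. cis (- (y \<bullet> x)) * h x \<partial>lborel) \<partial>lborel)"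
    by (rule Fubini_bounded_kernel[OF h f]) auto
  then show ?thesis
    unfolding fourier_L1_def by (simp add: scaleR_conv_of_real mult_ac inner_commute)
qed

text \<open>This reduces bounds on a Fourier multiplier to bounds on its kernel.\<close>

lemma fourier_L1_multiplier:
  assumes f: "integrable lborel f" and h: "integrable lborel h" and m: "integrable lborel m"
  shows "(\<integral>\<xi>. m \<xi> * (fourier_L1 f \<xi> * cnj (fourier_L1 h \<xi>)) \<partial>lborel)
     = (1 / (2 * pi))\<^sup>2 *\<^sub>R
        (\<integral>p. f (fst p) * cnj (h (snd p)) * (\<integral>\<xi>. cis (- (\<xi> \<bullet> (fst p - snd p))) * m \<xi> \<partial>lborel) \<partial>(lborel \<Otimes>\<^sub>M lborel))"
proof -
  have [measurable]: "f \<in> borel_measurable borel" "h \<in> borel_measurable borel" "m \<in> borel_measurable borel"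
    using f h m by (auto dest: borel_measurable_integrable)
  let ?g = "\<lambda>p::plane \<times> plane. f (fst p) * cnj (h (snd p))"
  have hc: "integrable lborel (\<lambda>y. cnj (h y))"
    using h by (simp add: integrable_cnj)
  have gi: "integrable lborel ?g"
    using integrable_mult_pair[OF f hc] by (simp add: lborel_prod case_prod_unfold)
  \<comment> \<open>The pair (x, y) is treated as one point of the product plane. The transform of
    \<open>f\<close> times the conjugate transform of \<open>h\<close> becomes a single integral
    with a phase in the difference of the two components, so one application of
    \<open>Fubini_bounded_kernel\<close> exchanges it with the frequency integral.\<close>
  have *: "(\<integral>p. cis (- (\<xi> \<bullet> (fst p - snd p))) * ?g p \<partial>lborel)
     = (\<integral>x. cis (- (x \<bullet> \<xi>)) * f x \<partial>lborel) * cnj (\<integral>x. cis (- (x \<bullet> \<xi>)) * h x \<partial>lborel)" for \<xi>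
  proof -
    have i1: "integrable lborel (\<lambda>x. cis (- (x \<bullet> \<xi>)) * f x)" by (intro integrable_cis_mult f) simp
    have i2: "integrable lborel (\<lambda>x. cnj (cis (- (x \<bullet> \<xi>)) * h x))"
      by (intro integrable_cnj integrable_cis_mult h) simp
    have "(\<integral>p. cis (- (\<xi> \<bullet> (fst p - snd p))) * ?g p \<partial>lborel)
      = (\<integral>p. (case p of (x, y) \<Rightarrow> (cis (- (x \<bullet> \<xi>)) * f x) * cnj (cis (- (y \<bullet> \<xi>)) * h y)) \<partial>(lborel \<Otimes>\<^sub>M lborel))"
      unfolding lborel_prod
      by (intro Bochner_Integration.integral_cong)
         (auto simp: inner_diff_right inner_commute[of \<xi>] cis_cnj cis_mult algebra_simps)
    also have "\<dots> = (\<integral>x. (\<integral>y. (cis (- (x \<bullet> \<xi>)) * f x) * cnj (cis (- (y \<bullet> \<xi>)) * h y) \<partial>lborel) \<partial>lborel)"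
      by (subst lborel_pair.integral_fst[OF integrable_mult_pair[OF i1 i2], symmetric]) simp
    also have "\<dots> = (\<integral>x. (cis (- (x \<bullet> \<xi>)) * f x) * cnj (\<integral>y. cis (- (y \<bullet> \<xi>)) * h y \<partial>lborel) \<partial>lborel)"
      by (simp del: complex_cnj_mult flip: Bochner_Integration.integral_cnj)
    also have "\<dots> = (\<integral>x. cis (- (x \<bullet> \<xi>)) * f x \<partial>lborel) * cnj (\<integral>x. cis (- (x \<bullet> \<xi>)) * h x \<partial>lborel)"
      by simp
    finally show ?thesis .
  qed
  have "(\<integral>\<xi>. m \<xi> * (\<integral>p. cis (- (\<xi> \<bullet> (fst p - snd p))) * ?g p \<partial>lborel) \<partial>lborel)
     = (\<integral>p. ?g p * (\<integral>\<xi>. cis (- (\<xi> \<bullet> (fst p - snd p))) * m \<xi> \<partial>lborel) \<partial>lborel)"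
    proof (rule Fubini_bounded_kernel[OF m gi])
    have "(\<lambda>q::plane \<times> plane \<times> plane. cis (- (fst q \<bullet> (fst (snd q) - snd (snd q))))) \<in> borel_measurable borel"
      by (intro borel_measurable_continuous_onI continuous_intros)
    then show "(\<lambda>(\<xi>::plane, p). cis (- (\<xi> \<bullet> (fst p - snd p)))) \<in> borel_measurable (borel \<Otimes>\<^sub>M borel)"
      by (simp add: borel_prod case_prod_unfold)
  qed simp
  moreover have "m \<xi> * (fourier_L1 f \<xi> * cnj (fourier_L1 h \<xi>))
     = complex_of_real ((1 / (2 * pi))\<^sup>2) * (m \<xi> * (\<integral>p. cis (- (\<xi> \<bullet> (fst p - snd p))) * ?g p \<partial>lborel))" for \<xi>
    unfolding * fourier_L1_def by (simp add: scaleR_conv_of_real power2_eq_square)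
  ultimately show ?thesis
    by (simp only: lborel_prod scaleR_conv_of_real Bochner_Integration.integral_mult_right_zero)
qed

text \<open>A bounded kernel bounds the bilinear form by the product of L^1 norms, which is the dual
  form of an estimate from L^1 to L^\<infinity>.\<close>

lemma fourier_L1_multiplier_bound:
  assumes f: "integrable lborel f" and h: "integrable lborel h" and m: "integrable lborel m"
    and K: "\<And>z. cmod (\<integral>\<xi>. cis (- (\<xi> \<bullet> z)) * m \<xi> \<partial>lborel) \<le> K"
  shows "cmod (\<integral>\<xi>. m \<xi> * (fourier_L1 f \<xi> * cnj (fourier_L1 h \<xi>)) \<partial>lborel)
     \<le> (1 / (2 * pi))\<^sup>2 * K * (\<integral>x. cmod (f x) \<partial>lborel) * (\<integral>x. cmod (h x) \<partial>lborel)"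
proof -
  have [measurable]: "f \<in> borel_measurable borel" "h \<in> borel_measurable borel" "m \<in> borel_measurable borel"
    using f h m by (auto dest: borel_measurable_integrable)
  let ?k = "\<lambda>z. (\<integral>\<xi>. cis (- (\<xi> \<bullet> z)) * m \<xi> \<partial>lborel)"
  have K0: "K \<ge> 0" using K[of 0] norm_ge_zero order_trans by blast
  have fn: "integrable lborel (\<lambda>x. complex_of_real (cmod (f x)))" "integrable lborel (\<lambda>x. complex_of_real (cmod (h x)))"
    using f h by (auto simp: complex_of_real_integrable_eq)
  have gi: "integrable (lborel \<Otimes>\<^sub>M lborel) (\<lambda>(x, y). cmod (f x) * cmod (h y))"
    using integrable_norm[OF integrable_mult_pair[OF fn]] by (simp add: case_prod_unfold norm_mult)
  have "cmod (\<integral>p. f (fst p) * cnj (h (snd p)) * ?k (fst p - snd p) \<partial>(lborel \<Otimes>\<^sub>M lborel))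
      \<le> (\<integral>p. (case p of (x, y) \<Rightarrow> cmod (f x) * cmod (h y)) * K \<partial>(lborel \<Otimes>\<^sub>M lborel))"
  proof (rule integral_norm_le)
    show "integrable (lborel \<Otimes>\<^sub>M lborel) (\<lambda>p. (case p of (x, y) \<Rightarrow> cmod (f x) * cmod (h y)) * K)"
      using gi by simp
    show "cmod (f (fst p) * cnj (h (snd p)) * ?k (fst p - snd p))
        \<le> (case p of (x, y) \<Rightarrow> cmod (f x) * cmod (h y)) * K" for p
      by (cases p) (auto simp: norm_mult intro!: mult_left_mono K)
  qed
  also have "\<dots> = K * ((\<integral>x. cmod (f x) \<partial>lborel) * (\<integral>x. cmod (h x) \<partial>lborel))"
    by (simp add: lborel_pair.integral_fst[OF gi, symmetric])
  finally have *: "cmod (\<integral>p. f (fst p) * cnj (h (snd p)) * ?k (fst p - snd p) \<partial>(lborel \<Otimes>\<^sub>M lborel))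
     \<le> K * ((\<integral>x. cmod (f x) \<partial>lborel) * (\<integral>x. cmod (h x) \<partial>lborel))" .
  show ?thesis
    unfolding fourier_L1_multiplier[OF f h m]
    using mult_left_mono[OF *, of "(1 / (2 * pi))\<^sup>2"] by (simp add: mult_ac)
qed

text \<open>A non-integrable \<open>f\<close> has Bochner integral 0 by convention, so that case is
  covered too and callers need no integrability proof.\<close>

lemma integral_norm_le_nn_integral:
  fixes f :: "'a \<Rightarrow> 'b::{banach, second_countable_topology}"
  shows "ennreal (norm (\<integral>x. f x \<partial>M)) \<le> (\<integral>\<^sup>+x. ennreal (norm (f x)) \<partial>M)"
  by (cases "integrable M f") (auto intro: integral_norm_bound_ennreal simp: not_integrable_integral_eq)

section \<open>Plancherel's identity on the intersection of L^1 and L^2\<close>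

definition L12 :: "(plane \<Rightarrow> complex) set" where
  "L12 = {f \<in> L2. integrable lborel f}"

lemma L12_L2: "f \<in> L12 \<Longrightarrow> f \<in> L2"
  and L12_integrable: "f \<in> L12 \<Longrightarrow> integrable lborel f"
  by (auto simp: L12_def)

lemma L12_diff: "f \<in> L12 \<Longrightarrow> h \<in> L12 \<Longrightarrow> (\<lambda>x. f x - h x) \<in> L12"
  by (auto simp: L12_def intro: L2_diff)

lemma kernel_gaussian:
  assumes e: "e > 0"
  shows "(\<integral>\<xi>. cis (- (\<xi> \<bullet> z)) * complex_of_real (exp (- e * (norm \<xi>)\<^sup>2)) \<partial>lborel)
     = complex_of_real (pi / e * exp (- (norm (z::plane))\<^sup>2 / (4 * e)))"
  using gaussian_fourier_plane(2)[OF e, of z] by (simp add: mult.commute)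

lemma nn_integral_gaussian_plane:
  assumes c: "c > 0"
  shows "(\<integral>\<^sup>+x. ennreal (exp (- c * (norm (x::plane))\<^sup>2)) \<partial>lborel) = ennreal (pi / c)"
  using gaussian_integral_plane[OF c] by (simp add: nn_integral_eq_integral)

text \<open>A Gaussian weight exp (- e |\<xi>|^2) turns the squared norm of the transform into a
  double integral against a positive kernel of mass 4 pi^2 in each variable. Schur's test applies,
  the factor (1 / (2 pi))^2 cancels the mass, and Fatou's lemma removes the weight. This gives only
  an inequality; equality comes from the approximate identity in \<open>Cc_isometry\<close>.\<close>

lemma fourier_L1_L2:
  assumes f: "f \<in> L12"
  shows "fourier_L1 f \<in> L2" "L2_norm (fourier_L1 f) \<le> L2_norm f"
proof -
  have fL: "f \<in> L2" and fi: "integrable lborel f" using f by (auto simp: L12_def)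
  have [measurable]: "f \<in> borel_measurable borel" using fL by (rule L2_measurable)
  have *: "(\<integral>\<^sup>+\<xi>. ennreal (exp (- e * (norm \<xi>)\<^sup>2) * (cmod (fourier_L1 f \<xi>))\<^sup>2) \<partial>lborel) \<le> ennreal ((L2_norm f)\<^sup>2)"
    if e: "e > 0" for e
  proof -
    let ?m = "\<lambda>\<xi>::plane. complex_of_real (exp (- e * (norm \<xi>)\<^sup>2))"
    let ?k = "\<lambda>z::plane. pi / e * exp (- (norm z)\<^sup>2 / (4 * e))"
    have mi: "integrable lborel ?m"
      using gaussian_integral_plane(1)[OF e] by (simp add: complex_of_real_integrable_eq)
    obtain B where B: "\<And>\<xi>. cmod (fourier_L1 f \<xi>) \<le> B" using fourier_L1_bound by blast
    have ii: "integrable lborel (\<lambda>\<xi>. exp (- e * (norm \<xi>)\<^sup>2) * (cmod (fourier_L1 f \<xi>))\<^sup>2)"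
    proof (rule Bochner_Integration.integrable_bound)
      show "integrable lborel (\<lambda>\<xi>::plane. exp (- e * (norm \<xi>)\<^sup>2) * B\<^sup>2)"
        using gaussian_integral_plane(1)[OF e] by simp
      show "AE \<xi> in lborel. norm (exp (- e * (norm \<xi>)\<^sup>2) * (cmod (fourier_L1 f \<xi>))\<^sup>2) \<le> norm (exp (- e * (norm \<xi>)\<^sup>2) * B\<^sup>2)"
        by (intro AE_I2) (auto simp: B power_mono)
    qed measurable
    \<comment> \<open>The prefactor pi / e cancels the Gaussian mass 4 pi e, so the total mass is
      the same for every e. This makes the bound uniform.\<close>
    have kint: "(\<integral>\<^sup>+z. ennreal (?k z) \<partial>lborel) = ennreal (4 * pi\<^sup>2)"
    proof -
      have "(\<integral>\<^sup>+z. ennreal (?k z) \<partial>lborel) = ennreal (pi / e) * (\<integral>\<^sup>+z. ennreal (exp (- (1 / (4 * e)) * (norm (z::plane))\<^sup>2)) \<partial>lborel)"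
        using e by (subst nn_integral_cmult[symmetric]) (auto simp: ennreal_mult[symmetric])
      also have "\<dots> = ennreal (pi / e) * ennreal (pi / (1 / (4 * e)))"
        using e by (subst nn_integral_gaussian_plane) auto
      also have "\<dots> = ennreal (4 * pi\<^sup>2)"
        using e by (simp add: ennreal_mult[symmetric] power2_eq_square)
      finally show ?thesis .
    qed
    have k1: "(\<integral>\<^sup>+y. ennreal (?k (x - y)) \<partial>lborel) = ennreal (4 * pi\<^sup>2)" for x
      using nn_integral_affine_euclidean[of "\<lambda>z. ennreal (?k z)" "-1" x] kint by simp
    have k2: "(\<integral>\<^sup>+x. ennreal (?k (x - y)) \<partial>lborel) = ennreal (4 * pi\<^sup>2)" for y
      using nn_integral_affine_euclidean[of "\<lambda>z. ennreal (?k z)" "1" "-y"] kint by simp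
    have kk: "(\<integral>\<^sup>+y. ennreal (a * ?k (w y)) \<partial>lborel) = ennreal a * ennreal (4 * pi\<^sup>2)"
      if "(\<integral>\<^sup>+y. ennreal (?k (w y)) \<partial>lborel) = ennreal (4 * pi\<^sup>2)" "a \<ge> 0" "w \<in> borel_measurable borel"
      for a and w :: "plane \<Rightarrow> plane"
    proof -
      have [measurable]: "w \<in> borel_measurable borel" by (rule that)
      have "(\<integral>\<^sup>+y. ennreal (a * ?k (w y)) \<partial>lborel) = (\<integral>\<^sup>+y. ennreal a * ennreal (?k (w y)) \<partial>lborel)"
        by (intro nn_integral_cong ennreal_mult' that(2))
      also have "\<dots> = ennreal a * (\<integral>\<^sup>+y. ennreal (?k (w y)) \<partial>lborel)"
        by (rule nn_integral_cmult) measurable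
      finally show ?thesis using that(1) by simp
    qed
    have fin: "(\<integral>\<^sup>+x. ennreal ((cmod (f x))\<^sup>2) * ennreal (4 * pi\<^sup>2) \<partial>lborel) = ennreal (4 * pi\<^sup>2 * (L2_norm f)\<^sup>2)"
      by (subst nn_integral_multc) (auto simp: L2_norm_nn_integral[OF fL] ennreal_mult' mult.commute)
    have h1: "(\<integral>\<^sup>+p. ennreal ((cmod (f (fst p)))\<^sup>2 * ?k (fst p - snd p)) \<partial>(lborel \<Otimes>\<^sub>M lborel))
       = ennreal (4 * pi\<^sup>2 * (L2_norm f)\<^sup>2)"
    proof -
      have "(\<integral>\<^sup>+p. ennreal ((cmod (f (fst p)))\<^sup>2 * ?k (fst p - snd p)) \<partial>(lborel \<Otimes>\<^sub>M lborel))
        = (\<integral>\<^sup>+x. (\<integral>\<^sup>+y. ennreal ((cmod (f x))\<^sup>2 * ?k (x - y)) \<partial>lborel) \<partial>lborel)"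
        by (subst lborel.nn_integral_fst[symmetric]) auto
      also have "\<dots> = (\<integral>\<^sup>+x. ennreal ((cmod (f x))\<^sup>2) * ennreal (4 * pi\<^sup>2) \<partial>lborel)"
        by (intro nn_integral_cong kk k1) auto
      finally show ?thesis using fin by simp
    qed
    have h2: "(\<integral>\<^sup>+p. ennreal ((cmod (f (snd p)))\<^sup>2 * ?k (fst p - snd p)) \<partial>(lborel \<Otimes>\<^sub>M lborel))
       = ennreal (4 * pi\<^sup>2 * (L2_norm f)\<^sup>2)"
    proof -
      have "(\<integral>\<^sup>+p. ennreal ((cmod (f (snd p)))\<^sup>2 * ?k (fst p - snd p)) \<partial>(lborel \<Otimes>\<^sub>M lborel))
        = (\<integral>\<^sup>+y. (\<integral>\<^sup>+x. ennreal ((cmod (f y))\<^sup>2 * ?k (x - y)) \<partial>lborel) \<partial>lborel)"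
        by (subst lborel_pair.nn_integral_snd[symmetric]) auto
      also have "\<dots> = (\<integral>\<^sup>+y. ennreal ((cmod (f y))\<^sup>2) * ennreal (4 * pi\<^sup>2) \<partial>lborel)"
        by (intro nn_integral_cong kk k2) auto
      finally show ?thesis using fin by simp
    qed
    let ?I = "\<integral>p. f (fst p) * cnj (f (snd p)) * complex_of_real (?k (fst p - snd p)) \<partial>(lborel \<Otimes>\<^sub>M lborel)"
    have "complex_of_real (\<integral>\<xi>. exp (- e * (norm \<xi>)\<^sup>2) * (cmod (fourier_L1 f \<xi>))\<^sup>2 \<partial>lborel)
       = (\<integral>\<xi>. ?m \<xi> * (fourier_L1 f \<xi> * cnj (fourier_L1 f \<xi>)) \<partial>lborel)"
      by (subst integral_complex_of_real[symmetric]) (simp add: complex_norm_square del: of_real_power flip: of_real_power)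
    also have "\<dots> = (1 / (2 * pi))\<^sup>2 *\<^sub>R ?I"
      unfolding fourier_L1_multiplier[OF fi fi mi] kernel_gaussian[OF e] ..
    finally have "cmod (complex_of_real (\<integral>\<xi>. exp (- e * (norm \<xi>)\<^sup>2) * (cmod (fourier_L1 f \<xi>))\<^sup>2 \<partial>lborel))
       = cmod ((1 / (2 * pi))\<^sup>2 *\<^sub>R ?I)" by (rule arg_cong)
    then have eq: "(\<integral>\<xi>. exp (- e * (norm \<xi>)\<^sup>2) * (cmod (fourier_L1 f \<xi>))\<^sup>2 \<partial>lborel) = (1 / (2 * pi))\<^sup>2 * cmod ?I"
      by (simp only: norm_of_real norm_scaleR abs_power2) (simp add: integral_nonneg_AE)
    have "ennreal (cmod ?I) \<le> (\<integral>\<^sup>+p. ennreal (cmod (f (fst p) * cnj (f (snd p)) * complex_of_real (?k (fst p - snd p)))) \<partial>(lborel \<Otimes>\<^sub>M lborel))"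
      by (rule integral_norm_le_nn_integral)
    \<comment> \<open>Symmetric Schur test: |f x f y| is at most half the sum of the squares, and in
      each half the variable that \<open>f\<close> does not contain is integrated out against the
      kernel.\<close>
    also have "\<dots> \<le> (\<integral>\<^sup>+p. ennreal (1/2) * (ennreal ((cmod (f (fst p)))\<^sup>2 * ?k (fst p - snd p))
           + ennreal ((cmod (f (snd p)))\<^sup>2 * ?k (fst p - snd p))) \<partial>(lborel \<Otimes>\<^sub>M lborel))"
    proof (rule nn_integral_mono)
      fix p :: "plane \<times> plane"
      have half: "ennreal (1/2 * (a * k + b * k)) = ennreal (1/2) * (ennreal (a * k) + ennreal (b * k))"
        if "a \<ge> 0" "b \<ge> 0" "k \<ge> 0" for a b k
        unfolding ennreal_plus[OF mult_nonneg_nonneg[OF that(1,3)] mult_nonneg_nonneg[OF that(2,3)], symmetric]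
        by (rule ennreal_mult') simp
      have kp: "?k (fst p - snd p) \<ge> 0" using e by simp
      have "cmod (f (fst p) * cnj (f (snd p)) * complex_of_real (?k (fst p - snd p)))
         = cmod (f (fst p)) * cmod (f (snd p)) * ?k (fst p - snd p)"
        using kp by (simp only: norm_mult complex_mod_cnj norm_of_real abs_of_nonneg)
      also have "\<dots> \<le> (1/2 * ((cmod (f (fst p)))\<^sup>2 + (cmod (f (snd p)))\<^sup>2)) * ?k (fst p - snd p)"
        using sum_squares_bound[of "cmod (f (fst p))" "cmod (f (snd p))"] by (intro mult_right_mono kp) simp
      finally have "ennreal (cmod (f (fst p) * cnj (f (snd p)) * complex_of_real (?k (fst p - snd p))))
        \<le> ennreal (1/2 * ((cmod (f (fst p)))\<^sup>2 * ?k (fst p - snd p) + (cmod (f (snd p)))\<^sup>2 * ?k (fst p - snd p)))"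
        by (intro ennreal_leI) (simp add: algebra_simps)
      also have "\<dots> = ennreal (1/2) * (ennreal ((cmod (f (fst p)))\<^sup>2 * ?k (fst p - snd p))
           + ennreal ((cmod (f (snd p)))\<^sup>2 * ?k (fst p - snd p)))"
        by (rule half) (use kp in auto)
      finally show "ennreal (cmod (f (fst p) * cnj (f (snd p)) * complex_of_real (?k (fst p - snd p)))) \<le> \<dots>" .
    qed
    also have "\<dots> = ennreal (1/2) * (ennreal (4 * pi\<^sup>2 * (L2_norm f)\<^sup>2) + ennreal (4 * pi\<^sup>2 * (L2_norm f)\<^sup>2))"
      by (subst nn_integral_cmult, measurable, subst nn_integral_add, measurable) (simp only: h1 h2)
    also have "\<dots> = ennreal (4 * pi\<^sup>2 * (L2_norm f)\<^sup>2)"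
    proof -
      have "ennreal (1/2) * (ennreal X + ennreal X) = ennreal (1/2 * (X + X))" if "X \<ge> 0" for X
        unfolding ennreal_plus[OF that that, symmetric] by (rule ennreal_mult'[symmetric]) simp
      then show ?thesis by simp
    qed
    finally have "cmod ?I \<le> 4 * pi\<^sup>2 * (L2_norm f)\<^sup>2"
      by (subst (asm) ennreal_le_iff) auto
    then have "(1 / (2 * pi))\<^sup>2 * cmod ?I \<le> (1 / (2 * pi))\<^sup>2 * (4 * pi\<^sup>2 * (L2_norm f)\<^sup>2)"
      by (intro mult_left_mono) auto
    also have "\<dots> = (L2_norm f)\<^sup>2" by (simp add: power_divide power_mult_distrib)
    finally have "(\<integral>\<xi>. exp (- e * (norm \<xi>)\<^sup>2) * (cmod (fourier_L1 f \<xi>))\<^sup>2 \<partial>lborel) \<le> (L2_norm f)\<^sup>2"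
      unfolding eq .
    then show ?thesis
      by (subst nn_integral_eq_integral[OF ii]) (auto intro: ennreal_leI)
  qed
  \<comment> \<open>Fatou's lemma with e = 1 / (n + 1), as the weight tends to 1.\<close>
  have "(\<integral>\<^sup>+\<xi>. ennreal ((cmod (fourier_L1 f \<xi>))\<^sup>2) \<partial>lborel)
     = (\<integral>\<^sup>+\<xi>. liminf (\<lambda>n. ennreal (exp (- (1 / real (Suc n)) * (norm \<xi>)\<^sup>2) * (cmod (fourier_L1 f \<xi>))\<^sup>2)) \<partial>lborel)"
  proof (rule nn_integral_cong)
    fix \<xi> :: plane
    have "(\<lambda>n. exp (- (1 / real (Suc n)) * (norm \<xi>)\<^sup>2) * (cmod (fourier_L1 f \<xi>))\<^sup>2) \<longlonglongrightarrow> exp (- 0 * (norm \<xi>)\<^sup>2) * (cmod (fourier_L1 f \<xi>))\<^sup>2"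
      by (intro tendsto_intros LIMSEQ_Suc lim_1_over_n)
    then have "(\<lambda>n. ennreal (exp (- (1 / real (Suc n)) * (norm \<xi>)\<^sup>2) * (cmod (fourier_L1 f \<xi>))\<^sup>2)) \<longlonglongrightarrow> ennreal ((cmod (fourier_L1 f \<xi>))\<^sup>2)"
      by (intro tendsto_ennrealI) simp
    then show "ennreal ((cmod (fourier_L1 f \<xi>))\<^sup>2) = liminf (\<lambda>n. ennreal (exp (- (1 / real (Suc n)) * (norm \<xi>)\<^sup>2) * (cmod (fourier_L1 f \<xi>))\<^sup>2))"
      by (intro lim_imp_Liminf[symmetric]) auto
  qed
  also have "\<dots> \<le> liminf (\<lambda>n. \<integral>\<^sup>+\<xi>. ennreal (exp (- (1 / real (Suc n)) * (norm \<xi>)\<^sup>2) * (cmod (fourier_L1 f \<xi>))\<^sup>2) \<partial>lborel)"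
    by (rule nn_integral_liminf) measurable
  also have "\<dots> \<le> ennreal ((L2_norm f)\<^sup>2)"
    by (intro Liminf_le always_eventually allI *) auto
  finally have fin: "(\<integral>\<^sup>+\<xi>. ennreal ((cmod (fourier_L1 f \<xi>))\<^sup>2) \<partial>lborel) \<le> ennreal ((L2_norm f)\<^sup>2)" .
  then have "(\<integral>\<^sup>+\<xi>. ennreal ((cmod (fourier_L1 f \<xi>))\<^sup>2) \<partial>lborel) < \<infinity>"
    by (rule le_less_trans) simp
  then show L: "fourier_L1 f \<in> L2"
    unfolding L2_iff_nn_integral by simp
  show "L2_norm (fourier_L1 f) \<le> L2_norm f"
    using fin unfolding L2_norm_nn_integral[OF L] by (auto intro: power2_le_imp_le[OF _ L2_norm_nonneg])
qed

text \<open>Continuous functions of compact support. The bound is recorded because it is the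
  dominating constant in \<open>Cc_isometry\<close>; bound and support radius together give
  membership in \<open>L12\<close>.\<close>

definition Cc :: "(plane \<Rightarrow> complex) set" where
  "Cc = {g. continuous_on UNIV g \<and> (\<exists>B. \<forall>x. cmod (g x) \<le> B) \<and> (\<exists>R. \<forall>x. norm x > R \<longrightarrow> g x = 0)}"

lemma indicator_cball_L12: "(\<lambda>x. c * indicator (cball 0 R) x) \<in> L12"
proof -
  have fin: "emeasure lborel (cball 0 R :: plane set) < \<infinity>"
    by (rule emeasure_bounded_finite) simp
  have i: "integrable lborel (\<lambda>x. indicator (cball 0 R :: plane set) x :: real)"
    by (rule integrable_real_indicator) (use fin in auto)
  then have "integrable lborel (\<lambda>x. complex_of_real (indicator (cball 0 R :: plane set) x))"
    by (simp only: complex_of_real_integrable_eq)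
  then have 1: "integrable lborel (\<lambda>x::plane. c * indicator (cball 0 R) x)"
    by (simp add: of_real_indicator)
  from i have "integrable lborel (\<lambda>x::plane. (cmod c)\<^sup>2 * indicator (cball 0 R) x)" by simp
  also have "(\<lambda>x::plane. (cmod c)\<^sup>2 * indicator (cball 0 R) x) = (\<lambda>x. (cmod (c * indicator (cball 0 R) x))\<^sup>2)"
    by (auto split: split_indicator)
  finally show ?thesis using 1 by (auto simp: L12_def L2_def)
qed

lemma Cc_L12:
  assumes g: "g \<in> Cc"
  shows "g \<in> L12"
proof -
  obtain B R where B: "\<And>x. cmod (g x) \<le> B" and R: "\<And>x. norm x > R \<Longrightarrow> g x = 0"
    and c: "continuous_on UNIV g"
    using g unfolding Cc_def by blast
  have [measurable]: "g \<in> borel_measurable borel"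
    using c by (rule borel_measurable_continuous_onI)
  let ?h = "\<lambda>x::plane. complex_of_real B * indicator (cball 0 R) x"
  have B0: "B \<ge> 0" using B[of 0] norm_ge_zero order_trans by blast
  have le: "cmod (g x) \<le> cmod (?h x)" for x
    using B[of x] R[of x] B0 by (auto split: split_indicator simp: not_le[symmetric])
  have "g \<in> L2"
    by (rule L2_dominated[OF _ L12_L2[OF indicator_cball_L12[of "complex_of_real B" R]], of _ 1]) (use le in auto)
  moreover have "integrable lborel g"
    by (rule Bochner_Integration.integrable_bound[OF L12_integrable[OF indicator_cball_L12[of "complex_of_real B" R]]])
       (use le in auto)
  ultimately show ?thesis by (simp add: L12_def)
qed

text \<open>With the weight exp (- d^2 |\<xi>|^2) the kernel is a Gaussian of width proportional to
  d. Substituting x = y + d u freezes it to a fixed Gaussian in u of mass 4 pi, and continuity gives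
  g (y + d u) -> g y. The same regularised integrals therefore tend to both squared norms.\<close>

lemma Cc_isometry:
  assumes g: "g \<in> Cc"
  shows "L2_norm (fourier_L1 g) = L2_norm g"
proof -
  obtain B where B: "\<And>x. cmod (g x) \<le> B" and c: "continuous_on UNIV g"
    using g unfolding Cc_def by blast
  have B0: "B \<ge> 0" using B[of 0] norm_ge_zero order_trans by blast
  have [measurable]: "g \<in> borel_measurable borel"
    using c by (rule borel_measurable_continuous_onI)
  have gL: "g \<in> L2" and gi: "integrable lborel g" using Cc_L12[OF g] by (auto simp: L12_def)
  have tL: "fourier_L1 g \<in> L2" by (rule fourier_L1_L2[OF Cc_L12[OF g]])
  have dim: "\<bar>r\<bar> ^ DIM(plane) = r\<^sup>2" for r :: real by simp
  define d where "d n = 1 / real (Suc n)" for n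
  have d: "d n > 0" for n by (simp add: d_def)
  have dlim: "d \<longlonglongrightarrow> 0" unfolding d_def by (rule LIMSEQ_Suc[OF lim_1_over_n])
  let ?m = "\<lambda>n \<xi>::plane. complex_of_real (exp (- (d n)\<^sup>2 * (norm \<xi>)\<^sup>2))"
  let ?G = "\<lambda>u::plane. complex_of_real (exp (- (1/4) * (norm u)\<^sup>2))"
  have Gi: "integrable lborel ?G"
    using gaussian_integral_plane(1)[of "1/4"] by (simp add: complex_of_real_integrable_eq)
  have mi: "integrable lborel (?m n)" for n
    using gaussian_integral_plane(1)[of "(d n)\<^sup>2"] d[of n] by (simp add: complex_of_real_integrable_eq)
  \<comment> \<open>The integrand after the substitution, up to a constant. It is dominated for all
    n at once by B |g y| times the Gaussian in u.\<close>
  let ?H = "\<lambda>n (y, u). (cnj (g y) * ?G u) * g (y + d n *\<^sub>R u)"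
  have gci: "integrable lborel (\<lambda>y. cnj (g y))" using gi by simp
  have dom: "integrable (lborel \<Otimes>\<^sub>M lborel) (\<lambda>p. B * cmod (case p of (y, u) \<Rightarrow> cnj (g y) * ?G u))"
    using integrable_norm[OF integrable_mult_pair[OF gci Gi]] by simp
  have Hm: "?H n \<in> borel_measurable (lborel \<Otimes>\<^sub>M lborel)" for n
    by measurable
  have Hle: "cmod (?H n p) \<le> B * cmod (case p of (y, u) \<Rightarrow> cnj (g y) * ?G u)" for n p
    using B B0 by (cases p) (simp add: norm_mult mult.commute[of B] mult_left_mono)
  have Hi: "integrable (lborel \<Otimes>\<^sub>M lborel) (?H n)" for n
    by (rule Bochner_Integration.integrable_bound[OF dom Hm]) (use Hle B0 in \<open>auto intro!: AE_I2 simp: abs_mult\<close>)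
  \<comment> \<open>The Jacobian (d n)^2 cancels the (d n)^(-2) of the kernel and leaves (1 / (2
    pi))^2 pi = 1 / (4 pi).\<close>
  have J: "(\<integral>\<xi>. ?m n \<xi> * (fourier_L1 g \<xi> * cnj (fourier_L1 g \<xi>)) \<partial>lborel)
     = (1 / (4 * pi)) *\<^sub>R (\<integral>p. ?H n p \<partial>(lborel \<Otimes>\<^sub>M lborel))" for n
  proof -
    let ?k = "\<lambda>z::plane. complex_of_real (pi / (d n)\<^sup>2 * exp (- (norm z)\<^sup>2 / (4 * (d n)\<^sup>2)))"
    have ker: "(\<integral>\<xi>. cis (- (\<xi> \<bullet> z)) * ?m n \<xi> \<partial>lborel) = ?k z" for z
      using d[of n] by (intro kernel_gaussian) simp
    have i: "integrable (lborel \<Otimes>\<^sub>M lborel) (\<lambda>(x, y). g x * cnj (g y) * ?k (x - y))"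
    proof (rule Bochner_Integration.integrable_bound)
      show "integrable (lborel \<Otimes>\<^sub>M lborel) (\<lambda>p. pi / (d n)\<^sup>2 * cmod (case p of (x, y) \<Rightarrow> g x * cnj (g y)))"
        using integrable_norm[OF integrable_mult_pair[OF gi gci]] by simp
      show "(\<lambda>(x, y). g x * cnj (g y) * ?k (x - y)) \<in> borel_measurable (lborel \<Otimes>\<^sub>M lborel)"
        by measurable
      have k: "cmod (?k z) \<le> pi / (d n)\<^sup>2" for z
        using d[of n] by (simp only: norm_of_real) (simp add: abs_mult divide_right_mono)
      show "AE p in lborel \<Otimes>\<^sub>M lborel. norm (case p of (x, y) \<Rightarrow> g x * cnj (g y) * ?k (x - y))
         \<le> norm (pi / (d n)\<^sup>2 * cmod (case p of (x, y) \<Rightarrow> g x * cnj (g y)))"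
      proof (rule AE_I2, clarify)
        fix x y
        have "norm (g x * cnj (g y) * ?k (x - y)) \<le> cmod (g x * cnj (g y)) * (pi / (d n)\<^sup>2)"
          unfolding norm_mult[of "g x * cnj (g y)"] by (intro mult_left_mono k) simp
        then show "norm (g x * cnj (g y) * ?k (x - y)) \<le> norm (pi / (d n)\<^sup>2 * cmod (g x * cnj (g y)))"
          by (simp add: mult.commute)
      qed
    qed
    have "(\<integral>p. g (fst p) * cnj (g (snd p)) * ?k (fst p - snd p) \<partial>(lborel \<Otimes>\<^sub>M lborel))
       = (\<integral>y. (\<integral>x. g x * cnj (g y) * ?k (x - y) \<partial>lborel) \<partial>lborel)"
      by (subst lborel_pair.integral_snd[OF i]) (simp add: case_prod_unfold)
    also have "\<dots> = (\<integral>y. (\<integral>u. pi *\<^sub>R ?H n (y, u) \<partial>lborel) \<partial>lborel)"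
    proof (rule Bochner_Integration.integral_cong[OF refl])
      fix y :: plane
      have "(\<integral>x. g x * cnj (g y) * ?k (x - y) \<partial>lborel)
         = \<bar>d n\<bar> ^ DIM(plane) *\<^sub>R (\<integral>u. g (y + d n *\<^sub>R u) * cnj (g y) * ?k (y + d n *\<^sub>R u - y) \<partial>lborel)"
        using d[of n] by (intro integral_affine_euclidean) auto
      also have "\<dots> = (\<integral>u. \<bar>d n\<bar> ^ DIM(plane) *\<^sub>R (g (y + d n *\<^sub>R u) * cnj (g y) * ?k (y + d n *\<^sub>R u - y)) \<partial>lborel)"
        by simp
      also have "\<dots> = (\<integral>u. pi *\<^sub>R ?H n (y, u) \<partial>lborel)"
      proof (rule Bochner_Integration.integral_cong[OF refl])
        fix u :: plane
        have "(d n)\<^sup>2 * (pi / (d n)\<^sup>2 * exp (- (norm (d n *\<^sub>R u))\<^sup>2 / (4 * (d n)\<^sup>2))) = pi * exp (- (1/4) * (norm u)\<^sup>2)"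
          using d[of n] by (simp add: power_mult_distrib)
        then have "complex_of_real ((d n)\<^sup>2) * ?k (d n *\<^sub>R u) = complex_of_real pi * ?G u"
          by (simp only: of_real_mult[symmetric])
        then have "(g (y + d n *\<^sub>R u) * cnj (g y)) * (complex_of_real ((d n)\<^sup>2) * ?k (d n *\<^sub>R u))
           = (g (y + d n *\<^sub>R u) * cnj (g y)) * (complex_of_real pi * ?G u)"
          by (simp only:)
        then show "\<bar>d n\<bar> ^ DIM(plane) *\<^sub>R (g (y + d n *\<^sub>R u) * cnj (g y) * ?k (y + d n *\<^sub>R u - y)) = pi *\<^sub>R ?H n (y, u)"
          by (simp only: dim scaleR_conv_of_real[where 'a=complex] add_diff_cancel_left' prod.case mult_ac)
      qed
      finally show "(\<integral>x. g x * cnj (g y) * ?k (x - y) \<partial>lborel) = (\<integral>u. pi *\<^sub>R ?H n (y, u) \<partial>lborel)" .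
    qed
    also have "\<dots> = pi *\<^sub>R (\<integral>p. ?H n p \<partial>(lborel \<Otimes>\<^sub>M lborel))"
      using lborel_pair.integral_fst[OF Hi[of n]] by simp
    finally show ?thesis
      unfolding fourier_L1_multiplier[OF gi gi mi] ker by (simp add: power2_eq_square field_simps)
  qed
  have "(\<lambda>n. \<integral>\<xi>. ?m n \<xi> * (fourier_L1 g \<xi> * cnj (fourier_L1 g \<xi>)) \<partial>lborel)
     \<longlonglongrightarrow> (\<integral>\<xi>. fourier_L1 g \<xi> * cnj (fourier_L1 g \<xi>) \<partial>lborel)"
  proof (rule integral_dominated_convergence)
    show "integrable lborel (\<lambda>\<xi>. cmod (fourier_L1 g \<xi> * cnj (fourier_L1 g \<xi>)))"
      by (intro integrable_norm L2_inner_integrable tL)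
    show "AE \<xi> in lborel. (\<lambda>n. ?m n \<xi> * (fourier_L1 g \<xi> * cnj (fourier_L1 g \<xi>))) \<longlonglongrightarrow> fourier_L1 g \<xi> * cnj (fourier_L1 g \<xi>)"
    proof (rule AE_I2)
      fix \<xi> :: plane
      have "(\<lambda>n. ?m n \<xi> * (fourier_L1 g \<xi> * cnj (fourier_L1 g \<xi>))) \<longlonglongrightarrow>
         complex_of_real (exp (- 0\<^sup>2 * (norm \<xi>)\<^sup>2)) * (fourier_L1 g \<xi> * cnj (fourier_L1 g \<xi>))"
        by (intro tendsto_intros dlim)
      then show "(\<lambda>n. ?m n \<xi> * (fourier_L1 g \<xi> * cnj (fourier_L1 g \<xi>))) \<longlonglongrightarrow> fourier_L1 g \<xi> * cnj (fourier_L1 g \<xi>)"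
        by simp
    qed
    show "AE \<xi> in lborel. cmod (?m n \<xi> * (fourier_L1 g \<xi> * cnj (fourier_L1 g \<xi>))) \<le> cmod (fourier_L1 g \<xi> * cnj (fourier_L1 g \<xi>))" for n
      by (intro AE_I2) (auto simp: norm_mult intro!: mult_left_le_one_le)
  qed measurable
  then have lim1: "(\<lambda>n. \<integral>\<xi>. ?m n \<xi> * (fourier_L1 g \<xi> * cnj (fourier_L1 g \<xi>)) \<partial>lborel) \<longlonglongrightarrow> complex_of_real ((L2_norm (fourier_L1 g))\<^sup>2)"
    unfolding L2_inner_self[symmetric] L2_inner_def .
  have "(\<lambda>n. \<integral>p. ?H n p \<partial>(lborel \<Otimes>\<^sub>M lborel)) \<longlonglongrightarrow> (\<integral>p. (case p of (y, u) \<Rightarrow> (cnj (g y) * ?G u) * g y) \<partial>(lborel \<Otimes>\<^sub>M lborel))"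
  proof (rule integral_dominated_convergence[OF _ _ dom])
    show "AE p in lborel \<Otimes>\<^sub>M lborel. (\<lambda>n. ?H n p) \<longlonglongrightarrow> (case p of (y, u) \<Rightarrow> (cnj (g y) * ?G u) * g y)"
    proof (rule AE_I2, clarify)
      fix y u :: plane
      have "isCont g (y + 0 *\<^sub>R u)" using c by (simp add: continuous_on_eq_continuous_at)
      then have "(\<lambda>n. g (y + d n *\<^sub>R u)) \<longlonglongrightarrow> g (y + 0 *\<^sub>R u)"
        by (rule isCont_tendsto_compose) (intro tendsto_intros dlim)
      then show "(\<lambda>n. (cnj (g y) * ?G u) * g (y + d n *\<^sub>R u)) \<longlonglongrightarrow> (cnj (g y) * ?G u) * g y"
        by (intro tendsto_intros) simp
    qed
    show "AE p in lborel \<Otimes>\<^sub>M lborel. norm (?H n p) \<le> B * cmod (case p of (y, u) \<Rightarrow> cnj (g y) * ?G u)" for n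
      by (intro AE_I2 Hle)
  qed (use Hm in measurable)
  also have "(\<integral>p. (case p of (y, u) \<Rightarrow> (cnj (g y) * ?G u) * g y) \<partial>(lborel \<Otimes>\<^sub>M lborel))
     = (\<integral>p. (case p of (y, u) \<Rightarrow> (g y * cnj (g y)) * ?G u) \<partial>(lborel \<Otimes>\<^sub>M lborel))"
    by (intro Bochner_Integration.integral_cong) (auto simp: mult_ac)
  also have "\<dots> = (\<integral>y. (\<integral>u. (g y * cnj (g y)) * ?G u \<partial>lborel) \<partial>lborel)"
    by (rule lborel_pair.integral_fst[OF integrable_mult_pair[OF L2_inner_integrable[OF gL gL] Gi], symmetric])
  also have "\<dots> = complex_of_real ((L2_norm g)\<^sup>2) * complex_of_real (4 * pi)"
    unfolding L2_inner_self[symmetric] L2_inner_def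
    using gaussian_integral_plane(2)[of "1/4"] by (simp del: of_real_exp add: mult.commute)
  finally have "(\<lambda>n. (1 / (4 * pi)) *\<^sub>R (\<integral>p. ?H n p \<partial>(lborel \<Otimes>\<^sub>M lborel)))
     \<longlonglongrightarrow> (1 / (4 * pi)) *\<^sub>R (complex_of_real ((L2_norm g)\<^sup>2) * complex_of_real (4 * pi))"
    by (intro tendsto_intros)
  then have lim2: "(\<lambda>n. \<integral>\<xi>. ?m n \<xi> * (fourier_L1 g \<xi> * cnj (fourier_L1 g \<xi>)) \<partial>lborel) \<longlonglongrightarrow> complex_of_real ((L2_norm g)\<^sup>2)"
    unfolding J by (simp add: scaleR_conv_of_real)
  have "(L2_norm (fourier_L1 g))\<^sup>2 = (L2_norm g)\<^sup>2"
    using LIMSEQ_unique[OF lim1 lim2] of_real_eq_iff by blast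
  then show ?thesis by (simp add: power2_eq_iff_nonneg)
qed

text \<open>Truncating \<open>f\<close> in size and space leaves a bounded function of bounded
  support, which is an almost-everywhere limit of continuous functions. Forcing the approximants
  into nearly the same bounds makes dominated convergence applicable.\<close>

lemma Cc_dense:
  assumes f: "f \<in> L2" and e: "e > 0"
  shows "\<exists>g\<in>Cc. L2_norm (\<lambda>x. f x - g x) < e"
proof -
  have fm [measurable]: "f \<in> borel_measurable borel" using f by (rule L2_measurable)
  define F where "F n x = (if norm x \<le> real n \<and> cmod (f x) \<le> real n then f x else 0)" for n x
  have Fm [measurable]: "F n \<in> borel_measurable borel" for n unfolding F_def by measurable
  have "(\<lambda>n. L2_norm (\<lambda>x. F n x - f x)) \<longlonglongrightarrow> 0"
  proof (rule L2_dominated_convergence[OF Fm fm f])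
    show "AE x in lborel. (\<lambda>n. F n x) \<longlonglongrightarrow> f x"
    proof (rule AE_I2, rule tendsto_eventually)
      fix x
      obtain m where m: "max (norm x) (cmod (f x)) \<le> real m"
        using real_arch_simple by blast
      show "\<forall>\<^sub>F n in sequentially. F n x = f x"
        using eventually_ge_at_top[of m]
      proof eventually_elim
        case (elim n)
        then have "real m \<le> real n" by simp
        then show ?case using m by (auto simp: F_def)
      qed
    qed
  qed (auto simp: F_def)
  then have "\<forall>\<^sub>F n in sequentially. L2_norm (\<lambda>x. F n x - f x) < e / 2"
    using e by (intro order_tendstoD(2)) auto
  then have "\<forall>\<^sub>F n in sequentially. L2_norm (\<lambda>x. F n x - f x) < e / 2 \<and> n > 0"
    using eventually_gt_at_top[of 0] by eventually_elim auto
  then obtain n where n: "L2_norm (\<lambda>x. F n x - f x) < e / 2" "n > 0"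
    by (auto simp: eventually_sequentially)
  have FL: "F n \<in> L2"
    by (rule L2_dominated[OF Fm f, of _ 1]) (auto simp: F_def)
  have "F n \<in> borel_measurable lebesgue" using Fm by (simp add: measurable_completion)
  \<comment> \<open>\<open>measurable_on\<close> asserts almost-everywhere approximation by
    continuous functions and so takes the place of a Lusin argument.\<close>
  then have "F n measurable_on UNIV"
    by (intro lebesgue_measurable_imp_measurable_on) auto
  then obtain N G where N: "negligible N" and Gc: "\<And>k. continuous_on UNIV (G k)"
    and Glim: "\<And>x. x \<notin> N \<Longrightarrow> (\<lambda>k. G k x) \<longlonglongrightarrow> F n x"
    unfolding measurable_on_def by auto
  \<comment> \<open>\<open>cutoff\<close> equals 1 on the ball that supports \<open>F n\<close>, and
    \<open>clip\<close> retracts onto the disc of radius n, fixing the values of \<open>F n\<close>.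
    Neither changes the limit, while the approximants become bounded by n and vanish beyond radius n
    + 1.\<close>
  define cutoff where "cutoff x = max 0 (min 1 (real n + 1 - norm x))" for x :: plane
  define clip where "clip z = (real n / max (real n) (cmod z)) *\<^sub>R z" for z :: complex
  define h where "h k x = cutoff x *\<^sub>R clip (G k x)" for k x
  have cutoff: "0 \<le> cutoff x" "cutoff x \<le> 1" "norm x > real n + 1 \<Longrightarrow> cutoff x = 0" for x by (auto simp: cutoff_def)
  have clipn: "cmod (clip z) \<le> real n" for z
  proof -
    have "real n * cmod z \<le> real n * max (real n) (cmod z)" by (intro mult_left_mono) auto
    then show ?thesis using n(2) by (simp add: clip_def divide_le_eq max_def split: if_splits)
  qed
  have clip_cont: "continuous_on UNIV clip"
    unfolding clip_def using n(2) by (intro continuous_intros) auto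
  have hc: "continuous_on UNIV (h k)" for k
    unfolding h_def cutoff_def
    by (intro continuous_intros continuous_on_compose2[OF clip_cont Gc]) auto
  have hle: "cmod (h k x) \<le> real n" for k x
    unfolding h_def using mult_mono[OF cutoff(2)[of x] clipn[of "G k x"]] cutoff(1)[of x] by simp
  have hz: "h k x = 0" if "norm x > real n + 1" for k x
    using cutoff(3)[OF that] by (simp add: h_def)
  have hCc: "h k \<in> Cc" for k unfolding Cc_def using hc hle hz by blast
  have hm: "h k \<in> borel_measurable borel" for k using hc by (rule borel_measurable_continuous_onI)
  have "(\<lambda>k. L2_norm (\<lambda>x. h k x - F n x)) \<longlonglongrightarrow> 0"
  proof (rule L2_dominated_convergence[OF hm Fm L12_L2[OF indicator_cball_L12[of "complex_of_real (real n)" "real n + 1"]]])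
    have "AE x in lebesgue. x \<notin> N"
      using N by (intro AE_not_in) (simp add: negligible_iff_null_sets)
    then have "AE x in lborel. x \<notin> N" by (simp add: AE_completion_iff)
    then show "AE x in lborel. (\<lambda>k. h k x) \<longlonglongrightarrow> F n x"
    proof eventually_elim
      case (elim x)
      have "isCont clip (F n x)" using clip_cont by (simp add: continuous_on_eq_continuous_at)
      then have "(\<lambda>k. clip (G k x)) \<longlonglongrightarrow> clip (F n x)"
        by (rule isCont_tendsto_compose[OF _ Glim[OF elim]])
      then have "(\<lambda>k. h k x) \<longlonglongrightarrow> cutoff x *\<^sub>R clip (F n x)"
        unfolding h_def by (intro tendsto_intros)
      moreover have "cutoff x *\<^sub>R clip (F n x) = F n x"
        using n(2) by (auto simp: cutoff_def clip_def F_def)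
      ultimately show ?case by simp
    qed
    show "cmod (h k x) \<le> cmod (complex_of_real (real n) * indicator (cball 0 (real n + 1)) x)" for k x
      using hle[of k x] hz[of x k] by (auto split: split_indicator simp: not_le[symmetric])
    show "cmod (F n x) \<le> cmod (complex_of_real (real n) * indicator (cball 0 (real n + 1)) x)" for x
      by (auto split: split_indicator simp: F_def)
  qed
  then have "\<forall>\<^sub>F k in sequentially. L2_norm (\<lambda>x. h k x - F n x) < e / 2"
    using e by (intro order_tendstoD(2)) auto
  then obtain k where k: "L2_norm (\<lambda>x. h k x - F n x) < e / 2"
    by (auto simp: eventually_sequentially)
  have "L2_norm (\<lambda>x. f x - h k x) \<le> L2_norm (\<lambda>x. f x - F n x) + L2_norm (\<lambda>x. F n x - h k x)"
    using L2_norm_triangle3[OF f FL L12_L2[OF Cc_L12[OF hCc]]] .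
  also have "\<dots> < e"
    using n(1) k by (simp add: L2_norm_diff_commute[of f] L2_norm_diff_commute[of "F n" "h k"])
  finally show ?thesis using hCc by blast
qed

text \<open>Both norms are 1-Lipschitz in \<open>f\<close> for the L^2 distance, the transformed one
  by the contraction estimate, and they agree on the dense class \<open>Cc\<close>.\<close>

lemma fourier_L1_isometry:
  assumes f: "f \<in> L12"
  shows "L2_norm (fourier_L1 f) = L2_norm f"
proof -
  have "\<bar>L2_norm (fourier_L1 f) - L2_norm f\<bar> \<le> e" if e: "e > 0" for e
  proof -
    obtain g where g: "g \<in> Cc" and d: "L2_norm (\<lambda>x. f x - g x) < e / 2"
      using Cc_dense[OF L12_L2[OF f], of "e/2"] e by auto
    note gL = Cc_L12[OF g]
    have "\<bar>L2_norm (fourier_L1 f) - L2_norm (fourier_L1 g)\<bar> \<le> L2_norm (\<lambda>\<xi>. fourier_L1 f \<xi> - fourier_L1 g \<xi>)"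
      by (intro L2_norm_reverse_triangle fourier_L1_L2 f gL)
    also have "\<dots> = L2_norm (fourier_L1 (\<lambda>x. f x - g x))"
      by (intro arg_cong[where f=L2_norm]) (auto simp: fourier_L1_diff L12_integrable f gL)
    also have "\<dots> \<le> L2_norm (\<lambda>x. f x - g x)"
      by (intro fourier_L1_L2 L12_diff f gL)
    finally have 1: "\<bar>L2_norm (fourier_L1 f) - L2_norm (fourier_L1 g)\<bar> < e / 2" using d by simp
    have "\<bar>L2_norm f - L2_norm g\<bar> \<le> L2_norm (\<lambda>x. f x - g x)"
      by (intro L2_norm_reverse_triangle L12_L2 f gL)
    then show ?thesis using 1 d Cc_isometry[OF g] by linarith
  qed
  then have "\<bar>L2_norm (fourier_L1 f) - L2_norm f\<bar> \<le> 0" by (rule field_le_epsilon) simp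
  then show ?thesis by simp
qed

section \<open>Extension to L^2\<close>

definition truncate :: "real \<Rightarrow> (plane \<Rightarrow> complex) \<Rightarrow> plane \<Rightarrow> complex" where
  "truncate R f x = indicator (cball 0 R) x * f x"

lemma truncate_L12:
  assumes f: "f \<in> L2"
  shows "truncate R f \<in> L12"
proof -
  have "(\<lambda>x. 1 * indicator (cball 0 R) x :: complex) \<in> L2"
    by (rule L12_L2[OF indicator_cball_L12])
  then have "integrable lborel (\<lambda>x. indicator (cball 0 R) x * f x)"
    using L2_mult_integrable[OF _ f] by simp
  then show ?thesis
    using L2_indicator[OF f, of "cball 0 R"] unfolding L12_def truncate_def by simp
qed

lemma truncate_tendsto:
  assumes f: "f \<in> L2"
  shows "((\<lambda>R. L2_norm (\<lambda>x. truncate R f x - f x)) \<longlongrightarrow> 0) at_top"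
proof (rule tendsto_at_topI_sequentially)
  fix X :: "nat \<Rightarrow> real" assume X: "filterlim X at_top sequentially"
  show "(\<lambda>n. L2_norm (\<lambda>x. truncate (X n) f x - f x)) \<longlonglongrightarrow> 0"
  proof (rule L2_dominated_convergence[OF _ L2_measurable[OF f] f])
    show "truncate (X n) f \<in> borel_measurable borel" for n
      by (intro L2_measurable L12_L2 truncate_L12 f)
    show "AE x in lborel. (\<lambda>n. truncate (X n) f x) \<longlonglongrightarrow> f x"
    proof (rule AE_I2, rule tendsto_eventually)
      fix x :: plane
      have "\<forall>\<^sub>F n in sequentially. X n \<ge> norm x"
        using X by (auto simp: filterlim_at_top)
      then show "\<forall>\<^sub>F n in sequentially. truncate (X n) f x = f x"
        by eventually_elim (simp add: truncate_def)
    qed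
  qed (auto simp: truncate_def split: split_indicator)
qed

text \<open>For members of L^2 the extended integral in \<open>has_fourier_def\<close> is the square
  of a finite norm. The reformulation gives access to the triangle inequality.\<close>

lemma has_fourier_iff:
  "has_fourier f F \<longleftrightarrow> f \<in> L2 \<and> F \<in> L2 \<and>
     ((\<lambda>R. L2_norm (\<lambda>\<xi>. fourier_L1 (truncate R f) \<xi> - F \<xi>)) \<longlongrightarrow> 0) at_top"
proof (cases "f \<in> L2 \<and> F \<in> L2")
  case True
  then have f: "f \<in> L2" and F: "F \<in> L2" by auto
  let ?T = "\<lambda>R \<xi>. fourier_L1 (truncate R f) \<xi>"
  let ?N = "\<lambda>R. L2_norm (\<lambda>\<xi>. ?T R \<xi> - F \<xi>)"
  have T: "(1 / (2 * pi)) *\<^sub>R (LINT x:cball 0 R|lborel. cis (- (x \<bullet> \<xi>)) * f x) = ?T R \<xi>" for R \<xi>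
    unfolding fourier_L1_def set_lebesgue_integral_def truncate_def
    by (intro arg_cong[where f="scaleR _"] Bochner_Integration.integral_cong) (auto split: split_indicator)
  have TL: "?T R \<in> L2" for R by (intro fourier_L1_L2 truncate_L12 f)
  have eq: "(\<integral>\<^sup>+\<xi>. ennreal ((cmod (F \<xi> - ?T R \<xi>))\<^sup>2) \<partial>lborel) = ennreal ((?N R)\<^sup>2)" for R
    using L2_norm_nn_integral[OF L2_diff[OF TL F]] by (simp add: norm_minus_commute)
  have "((\<lambda>R. ennreal ((?N R)\<^sup>2)) \<longlongrightarrow> ennreal 0) at_top \<longleftrightarrow> ((\<lambda>R. (?N R)\<^sup>2) \<longlongrightarrow> 0) at_top"
    by (rule tendsto_ennreal_iff) auto
  also have "\<dots> \<longleftrightarrow> (?N \<longlongrightarrow> 0) at_top"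
  proof
    assume "((\<lambda>R. (?N R)\<^sup>2) \<longlongrightarrow> 0) at_top"
    from tendsto_real_sqrt[OF this] show "(?N \<longlongrightarrow> 0) at_top" by simp
  next
    assume "(?N \<longlongrightarrow> 0) at_top"
    from tendsto_power[OF this, of 2] show "((\<lambda>R. (?N R)\<^sup>2) \<longlongrightarrow> 0) at_top" by simp
  qed
  finally show ?thesis
    unfolding has_fourier_def T eq using True by simp
next
  case False
  then show ?thesis by (auto simp: has_fourier_def)
qed

lemma has_fourier_L2: "has_fourier f F \<Longrightarrow> f \<in> L2" "has_fourier f F \<Longrightarrow> F \<in> L2"
  by (auto simp: has_fourier_def)

lemma has_fourier_tendsto:
  "has_fourier f F \<Longrightarrow> ((\<lambda>R. L2_norm (\<lambda>\<xi>. fourier_L1 (truncate R f) \<xi> - F \<xi>)) \<longlongrightarrow> 0) at_top"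
  by (simp add: has_fourier_iff)

lemma fourier_L1_diff_isometry:
  assumes "f \<in> L12" "h \<in> L12"
  shows "L2_norm (\<lambda>\<xi>. fourier_L1 f \<xi> - fourier_L1 h \<xi>) = L2_norm (\<lambda>x. f x - h x)"
proof -
  have "(\<lambda>\<xi>. fourier_L1 f \<xi> - fourier_L1 h \<xi>) = fourier_L1 (\<lambda>x. f x - h x)"
    by (rule ext) (simp add: fourier_L1_diff L12_integrable assms)
  then show ?thesis using fourier_L1_isometry[OF L12_diff[OF assms]] by simp
qed

text \<open>By the isometry the transforms of the truncations inherit the Cauchy property from the
  truncations themselves.\<close>

lemma has_fourier_exists:
  assumes f: "f \<in> L2"
  shows "\<exists>F. has_fourier f F"
proof -
  let ?T = "\<lambda>R. fourier_L1 (truncate R f)"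
  let ?d = "\<lambda>R. L2_norm (\<lambda>x. truncate R f x - f x)"
  have TL: "?T R \<in> L2" for R by (intro fourier_L1_L2 truncate_L12 f)
  note tl = L12_L2[OF truncate_L12[OF f]]
  have dd: "L2_norm (\<lambda>\<xi>. ?T R \<xi> - ?T S \<xi>) \<le> ?d R + ?d S" for R S
    using L2_norm_triangle3[OF tl[of R] f tl[of S]]
    by (simp add: fourier_L1_diff_isometry truncate_L12 f L2_norm_diff_commute[of f])
  have lim: "(\<lambda>n. ?d (real n)) \<longlonglongrightarrow> 0"
    by (rule filterlim_compose[OF truncate_tendsto[OF f] filterlim_real_sequentially])
  have "\<exists>G\<in>L2. (\<lambda>n. L2_norm (\<lambda>\<xi>. ?T (real n) \<xi> - G \<xi>)) \<longlonglongrightarrow> 0"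
  proof (rule L2_complete[OF TL])
    fix e :: real assume "e > 0"
    then have "\<forall>\<^sub>F n in sequentially. ?d (real n) < e / 2"
      using lim by (intro order_tendstoD(2)) auto
    then obtain N where N: "\<And>n. n \<ge> N \<Longrightarrow> ?d (real n) < e / 2"
      by (auto simp: eventually_sequentially)
    have "L2_norm (\<lambda>\<xi>. ?T (real m) \<xi> - ?T (real n) \<xi>) \<le> e" if "m \<ge> N" "n \<ge> N" for m n
      using dd[of "real m" "real n"] N[OF that(1)] N[OF that(2)] by linarith
    then show "\<exists>N. \<forall>m\<ge>N. \<forall>n\<ge>N. L2_norm (\<lambda>\<xi>. ?T (real m) \<xi> - ?T (real n) \<xi>) \<le> e" by blast
  qed
  then obtain G where G: "G \<in> L2" and Glim: "(\<lambda>n. L2_norm (\<lambda>\<xi>. ?T (real n) \<xi> - G \<xi>)) \<longlonglongrightarrow> 0" by blast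
  \<comment> \<open>Completeness supplies a limit along integer radii. An arbitrary sequence of
    radii is compared with it through \<open>dd\<close>, which bounds the distance of two transforms
    by the truncation errors.\<close>
  have "((\<lambda>R. L2_norm (\<lambda>\<xi>. ?T R \<xi> - G \<xi>)) \<longlongrightarrow> 0) at_top"
  proof (rule tendsto_at_topI_sequentially)
    fix X :: "nat \<Rightarrow> real" assume X: "filterlim X at_top sequentially"
    have l2: "(\<lambda>n. (?d (X n) + ?d (real n)) + L2_norm (\<lambda>\<xi>. ?T (real n) \<xi> - G \<xi>)) \<longlonglongrightarrow> (0 + 0) + 0"
      by (intro tendsto_add lim Glim filterlim_compose[OF truncate_tendsto[OF f] X])
    show "(\<lambda>n. L2_norm (\<lambda>\<xi>. ?T (X n) \<xi> - G \<xi>)) \<longlonglongrightarrow> 0"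
    proof (rule Lim_null_comparison[OF always_eventually[OF allI]])
      fix n
      show "norm (L2_norm (\<lambda>\<xi>. ?T (X n) \<xi> - G \<xi>)) \<le> (?d (X n) + ?d (real n)) + L2_norm (\<lambda>\<xi>. ?T (real n) \<xi> - G \<xi>)"
        using L2_norm_triangle3[OF TL[of "X n"] TL[of "real n"] G] dd[of "X n" "real n"] by simp
    qed (use l2 in simp)
  qed
  then show ?thesis using f G by (auto simp: has_fourier_iff)
qed

lemma fourier_L1_cmult: "fourier_L1 (\<lambda>x. c * f x) \<xi> = c * fourier_L1 f \<xi>"
  unfolding fourier_L1_def by (simp add: mult.left_commute[of _ c])

lemma has_fourier_cmult:
  assumes "has_fourier f F"
  shows "has_fourier (\<lambda>x. c * f x) (\<lambda>\<xi>. c * F \<xi>)"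
proof -
  have t: "truncate R (\<lambda>x. c * f x) = (\<lambda>x. c * truncate R f x)" for R
    by (auto simp: truncate_def)
  have "((\<lambda>R. cmod c * L2_norm (\<lambda>\<xi>. fourier_L1 (truncate R f) \<xi> - F \<xi>)) \<longlongrightarrow> cmod c * 0) at_top"
    by (intro tendsto_mult_left has_fourier_tendsto assms)
  then show ?thesis
    unfolding has_fourier_iff t fourier_L1_cmult
    using assms by (auto dest: has_fourier_L2 intro: L2_cmult simp flip: L2_norm_cmult right_diff_distrib)
qed

lemma has_fourier_diff:
  assumes fF: "has_fourier f F" and hH: "has_fourier h H"
  shows "has_fourier (\<lambda>x. f x - h x) (\<lambda>\<xi>. F \<xi> - H \<xi>)"
proof -
  have L: "f \<in> L2" "F \<in> L2" "h \<in> L2" "H \<in> L2" using assms by (auto dest: has_fourier_L2)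
  let ?T = "\<lambda>R f. fourier_L1 (truncate R f)"
  have TL: "?T R f \<in> L2" "?T R h \<in> L2" for R by (intro fourier_L1_L2 truncate_L12 L)+
  have t: "truncate R (\<lambda>x. f x - h x) = (\<lambda>x. truncate R f x - truncate R h x)" for R
    by (auto simp: truncate_def right_diff_distrib)
  have T: "?T R (\<lambda>x. f x - h x) \<xi> = ?T R f \<xi> - ?T R h \<xi>" for R \<xi>
    unfolding t by (intro fourier_L1_diff L12_integrable truncate_L12 L)
  have l: "((\<lambda>R. L2_norm (\<lambda>\<xi>. ?T R f \<xi> - F \<xi>) + L2_norm (\<lambda>\<xi>. ?T R h \<xi> - H \<xi>)) \<longlongrightarrow> 0 + 0) at_top"
    by (intro tendsto_add has_fourier_tendsto assms)
  have "((\<lambda>R. L2_norm (\<lambda>\<xi>. ?T R (\<lambda>x. f x - h x) \<xi> - (F \<xi> - H \<xi>))) \<longlongrightarrow> 0) at_top"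
  proof (rule Lim_null_comparison[OF always_eventually[OF allI]])
    fix R
    have "(\<lambda>\<xi>. ?T R (\<lambda>x. f x - h x) \<xi> - (F \<xi> - H \<xi>)) = (\<lambda>\<xi>. (?T R f \<xi> - F \<xi>) - (?T R h \<xi> - H \<xi>))"
      unfolding T by auto
    then show "norm (L2_norm (\<lambda>\<xi>. ?T R (\<lambda>x. f x - h x) \<xi> - (F \<xi> - H \<xi>)))
       \<le> L2_norm (\<lambda>\<xi>. ?T R f \<xi> - F \<xi>) + L2_norm (\<lambda>\<xi>. ?T R h \<xi> - H \<xi>)"
      using L2_norm_triangle_diff[OF L2_diff[OF TL(1) L(2)] L2_diff[OF TL(2) L(4)]] by simp
  qed (use l in simp)
  then show ?thesis unfolding has_fourier_iff using L by (auto intro: L2_diff)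
qed

lemma has_fourier_add:
  assumes fF: "has_fourier f F" and hH: "has_fourier h H"
  shows "has_fourier (\<lambda>x. f x + h x) (\<lambda>\<xi>. F \<xi> + H \<xi>)"
  using has_fourier_diff[OF fF has_fourier_cmult[OF hH, of "-1"]] by simp

lemma Plancherel:
  assumes "has_fourier f F"
  shows "L2_norm F = L2_norm f"
proof -
  let ?T = "\<lambda>R. fourier_L1 (truncate R f)"
  have f: "f \<in> L2" and F: "F \<in> L2" using assms by (auto dest: has_fourier_L2)
  have TL: "?T R \<in> L2" for R by (intro fourier_L1_L2 truncate_L12 f)
  have "((\<lambda>R. L2_norm (?T R)) \<longlongrightarrow> L2_norm F) at_top"
    by (rule L2_tendsto_norm[OF TL F has_fourier_tendsto[OF assms]])
  moreover have "((\<lambda>R. L2_norm (truncate R f)) \<longlongrightarrow> L2_norm f) at_top"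
    by (rule L2_tendsto_norm[OF L12_L2[OF truncate_L12[OF f]] f truncate_tendsto[OF f]])
  ultimately show ?thesis
    using tendsto_unique[OF trivial_limit_at_top_linorder] by (simp add: fourier_L1_isometry truncate_L12 f)
qed

text \<open>Polarisation: \<open>L2_norm_diff_power2\<close> expresses the real part of the inner
  product through norms, which the transform preserves.\<close>

lemma Plancherel_inner:
  assumes fF: "has_fourier f F" and hH: "has_fourier h H"
  shows "L2_inner F H = L2_inner f h"
proof -
  have re: "Re (L2_inner F H) = Re (L2_inner f h)" if fF: "has_fourier f F" for f F
    using L2_norm_diff_power2[OF has_fourier_L2(1)[OF fF] has_fourier_L2(1)[OF hH]]
      L2_norm_diff_power2[OF has_fourier_L2(2)[OF fF] has_fourier_L2(2)[OF hH]]
    by (simp add: Plancherel[OF fF] Plancherel[OF hH] Plancherel[OF has_fourier_diff[OF fF hH]])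
  \<comment> \<open>Multiplying \<open>f\<close> by \<i> turns the imaginary part into a real part,
    up to sign.\<close>
  have "Im (L2_inner F H) = Im (L2_inner f h)"
    using re[OF has_fourier_cmult[OF fF, of \<i>]] by (simp add: L2_inner_cmult_left)
  with re[OF fF] show ?thesis by (simp add: complex_eq_iff)
qed

lemma has_fourier_L1:
  assumes f: "f \<in> L12"
  shows "has_fourier f (fourier_L1 f)"
  unfolding has_fourier_iff
  using truncate_tendsto[OF L12_L2[OF f]] f
  by (auto simp: fourier_L1_diff_isometry truncate_L12 L12_L2 intro: fourier_L1_L2)

section \<open>Inversion and the free propagator\<close>

text \<open>The formula for \<open>fourier_L1\<close> passes to the limit in one factor at a time:
  with the second factor in \<open>L12\<close> the first is truncated, and then the second is
  truncated in turn. Each limit is the convergence of an inner product.\<close>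

lemma fourier_transfer:
  assumes fF: "has_fourier f F" and hH: "has_fourier h H"
  shows "(\<integral>x. F x * h x \<partial>lborel) = (\<integral>x. f x * H x \<partial>lborel)"
proof -
  have L: "f \<in> L2" "F \<in> L2" "h \<in> L2" "H \<in> L2" using assms by (auto dest: has_fourier_L2)
  have inner: "(\<integral>x. u x * v x \<partial>lborel) = L2_inner u (\<lambda>x. cnj (v x))" for u v
    by (simp add: L2_inner_def)
  have 1: "(\<integral>x. F x * k x \<partial>lborel) = (\<integral>x. f x * fourier_L1 k x \<partial>lborel)" if k: "k \<in> L12" for k
  proof -
    have "((\<lambda>R. \<integral>x. fourier_L1 (truncate R f) x * k x \<partial>lborel) \<longlongrightarrow> (\<integral>x. F x * k x \<partial>lborel)) at_top"
      unfolding inner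
      by (intro L2_tendsto_inner has_fourier_tendsto fF fourier_L1_L2 truncate_L12 L L2_cnj L12_L2 k)
    moreover have "((\<lambda>R. \<integral>x. truncate R f x * fourier_L1 k x \<partial>lborel) \<longlongrightarrow> (\<integral>x. f x * fourier_L1 k x \<partial>lborel)) at_top"
      unfolding inner
      by (intro L2_tendsto_inner truncate_tendsto L12_L2 truncate_L12 L L2_cnj fourier_L1_L2 k)
    ultimately show ?thesis
      using tendsto_unique[OF trivial_limit_at_top_linorder]
      by (simp add: fourier_L1_transfer L12_integrable truncate_L12 L k)
  qed
  have "((\<lambda>R. \<integral>x. truncate R h x * F x \<partial>lborel) \<longlongrightarrow> (\<integral>x. h x * F x \<partial>lborel)) at_top"
    unfolding inner by (intro L2_tendsto_inner truncate_tendsto L12_L2 truncate_L12 L L2_cnj)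
  moreover have "((\<lambda>R. \<integral>x. fourier_L1 (truncate R h) x * f x \<partial>lborel) \<longlongrightarrow> (\<integral>x. H x * f x \<partial>lborel)) at_top"
    unfolding inner by (intro L2_tendsto_inner has_fourier_tendsto hH fourier_L1_L2 truncate_L12 L L2_cnj)
  moreover have "(\<integral>x. truncate R h x * F x \<partial>lborel) = (\<integral>x. fourier_L1 (truncate R h) x * f x \<partial>lborel)" for R
    using 1[OF truncate_L12[OF L(3)]] by (simp add: mult.commute)
  ultimately show ?thesis
    using tendsto_unique[OF trivial_limit_at_top_linorder] by (simp add: mult.commute)
qed

text \<open>Applied to \<open>cnj F\<close> this gives the inverse transform: if \<open>V\<close> is the transform of \<open>cnj F\<close>, then
  \<open>cnj V\<close> has the same norm as its transform \<open>U\<close>, and \<open>\<langle>U, F\<rangle> = \<parallel>F\<parallel>\<^sup>2\<close>.\<close>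

lemma has_fourier_inverse_exists:
  assumes F: "F \<in> L2"
  shows "\<exists>u. has_fourier u F"
proof -
  obtain V where V: "has_fourier (\<lambda>x. cnj (F x)) V" using has_fourier_exists[OF L2_cnj[OF F]] by blast
  have VL: "V \<in> L2" using V by (rule has_fourier_L2)
  obtain U where U: "has_fourier (\<lambda>x. cnj (V x)) U" using has_fourier_exists[OF L2_cnj[OF VL]] by blast
  have UL: "U \<in> L2" using U by (rule has_fourier_L2)
  have nc: "L2_norm (\<lambda>x. cnj (g x)) = L2_norm g" for g by (simp add: L2_norm_def)
  have n: "L2_norm U = L2_norm F" "L2_norm V = L2_norm F"
    using Plancherel[OF U] Plancherel[OF V] by (simp_all add: nc)
  have "L2_inner U F = (\<integral>x. V x * cnj (V x) \<partial>lborel)"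
    using fourier_transfer[OF U V] by (simp add: L2_inner_def mult.commute)
  also have "\<dots> = complex_of_real ((L2_norm F)\<^sup>2)"
    using L2_inner_self[of V] unfolding L2_inner_def n .
  finally have "(L2_norm (\<lambda>x. U x - F x))\<^sup>2 = 0"
    using L2_norm_diff_power2[OF UL F] n by simp
  then have "AE x in lborel. U x = F x" by (intro L2_norm_diff_0_AE UL F) simp
  \<comment> \<open>\<open>U\<close> and \<open>F\<close> agree only almost everywhere. Inside the
    defining limit only norms of differences occur, so \<open>U\<close> may be replaced by
    \<open>F\<close> there.\<close>
  then have "L2_norm (\<lambda>\<xi>. fourier_L1 (truncate R (\<lambda>x. cnj (V x))) \<xi> - U \<xi>)
      = L2_norm (\<lambda>\<xi>. fourier_L1 (truncate R (\<lambda>x. cnj (V x))) \<xi> - F \<xi>)" for R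
    by (intro L2_norm_cong L2_measurable L2_diff fourier_L1_L2 truncate_L12 L2_cnj VL UL F) auto
  then have "has_fourier (\<lambda>x. cnj (V x)) F"
    using U F unfolding has_fourier_iff by simp
  then show ?thesis by blast
qed

text \<open>The difference has transform 0, so its norm vanishes by Plancherel. Independently chosen
  inverse transforms are identified in this way.\<close>

lemma has_fourier_inj:
  assumes "has_fourier u F" "has_fourier u' F"
  shows "AE x in lborel. u x = u' x"
  using Plancherel[OF has_fourier_diff[OF assms]] assms
  by (intro L2_norm_diff_0_AE) (auto dest: has_fourier_L2 simp: L2_norm_def)

lemma has_fourier_fourier: "f \<in> L2 \<Longrightarrow> has_fourier f (fourier f)"
  unfolding fourier_def using someI_ex[OF has_fourier_exists] .

lemma cis_multiplier_L2:
  assumes "F \<in> L2" shows "(\<lambda>\<xi>::plane. cis (t * (norm \<xi>)\<^sup>2) * F \<xi>) \<in> L2"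
  by (rule L2_mult_bounded[OF assms, where C=1]) auto

text \<open>Surjectivity of the transform on L^2 supplies the witness for the choice in
  \<open>free_propagator\<close>.\<close>

lemma has_fourier_free_propagator:
  "f \<in> L2 \<Longrightarrow> has_fourier (free_propagator t f) (\<lambda>\<xi>. cis (- t * (norm \<xi>)\<^sup>2) * fourier f \<xi>)"
  unfolding free_propagator_def
  using someI_ex[OF has_fourier_inverse_exists[OF cis_multiplier_L2[OF has_fourier_L2(2)[OF has_fourier_fourier]]]] .

text \<open>The square of the modulus is a double integral; translating one variable by the other turns it
  into real Gaussian integrals, so that no analytic continuation is needed.\<close>

lemma complex_gaussian_kernel_bound:
  fixes z :: plane
  assumes a: "a > 0"
  shows "cmod (\<integral>\<xi>. cis (- (\<xi> \<bullet> z)) * (complex_of_real (exp (- a * (norm \<xi>)\<^sup>2)) * cis (- b * (norm \<xi>)\<^sup>2)) \<partial>lborel)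
     \<le> pi / sqrt (a\<^sup>2 + b\<^sup>2)"
proof -
  define M where "M \<xi> = cis (- (\<xi> \<bullet> z)) * (complex_of_real (exp (- a * (norm \<xi>)\<^sup>2)) * cis (- b * (norm \<xi>)\<^sup>2))" for \<xi> :: plane
  have [measurable]: "M \<in> borel_measurable borel" unfolding M_def by measurable
  have Mn: "cmod (M \<xi>) = exp (- a * (norm \<xi>)\<^sup>2)" for \<xi> by (simp add: M_def norm_mult)
  have Mi: "integrable lborel M"
    by (rule Bochner_Integration.integrable_bound[OF gaussian_integral_plane(1)[OF a]]) (auto simp: Mn)
  have sh: "(\<integral>x. F (c + x) \<partial>lborel) = (\<integral>x. F x \<partial>lborel)"
    if "F \<in> borel_measurable borel" for c :: plane and F :: "plane \<Rightarrow> 'c::{banach, second_countable_topology}"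
    using integral_affine_euclidean[OF that, of 1 c] by simp
  \<comment> \<open>The squared modulus of the integral of \<open>M\<close> is the double integral
    of \<open>H\<close>, where p is the difference of the two frequencies. For fixed p the integral
    over \<eta> can be computed.\<close>
  define H where "H \<eta> p = cnj (M \<eta>) * M (\<eta> + p)" for \<eta> p
  have Hn: "cmod (H \<eta> p) = exp (- a * (norm \<eta>)\<^sup>2) * exp (- a * (norm (\<eta> + p))\<^sup>2)" for \<eta> p
    by (simp add: H_def norm_mult Mn)
  have gi: "integrable lborel (\<lambda>p. exp (- a * (norm (\<eta> + p))\<^sup>2))" for \<eta> :: plane
  proof -
    have "integrable (distr lborel borel ((+) \<eta>)) (\<lambda>p::plane. exp (- a * (norm p)\<^sup>2))"
      unfolding lborel_distr_plus by (rule gaussian_integral_plane(1)[OF a])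
    then show ?thesis by (subst (asm) integrable_distr_eq) auto
  qed
  have Hi: "integrable (lborel \<Otimes>\<^sub>M lborel) (case_prod H)"
  proof (rule lborel_pair.Fubini_integrable)
    show "case_prod H \<in> borel_measurable (lborel \<Otimes>\<^sub>M lborel)" unfolding H_def by measurable
    have "(\<integral>p. norm (case (\<eta>, p) of (x, y) \<Rightarrow> H x y) \<partial>lborel) = exp (- a * (norm \<eta>)\<^sup>2) * (pi / a)" for \<eta>
      using sh[of "\<lambda>p. exp (- a * (norm p)\<^sup>2)" \<eta>] gaussian_integral_plane(2)[OF a] by (simp add: Hn)
    then show "integrable lborel (\<lambda>\<eta>. \<integral>p. norm (case (\<eta>, p) of (x, y) \<Rightarrow> H x y) \<partial>lborel)"
      using gaussian_integral_plane(1)[OF a] by simp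
    have "integrable lborel (\<lambda>p. H \<eta> p)" for \<eta>
    proof (rule Bochner_Integration.integrable_bound)
      show "integrable lborel (\<lambda>p. exp (- a * (norm \<eta>)\<^sup>2) * exp (- a * (norm (\<eta> + p))\<^sup>2))"
        using gi by simp
      show "H \<eta> \<in> borel_measurable lborel" unfolding H_def by measurable
    qed (simp add: Hn)
    then show "AE \<eta> in lborel. integrable lborel (\<lambda>p. case (\<eta>, p) of (x, y) \<Rightarrow> H x y)" by simp
  qed
  \<comment> \<open>\<open>e\<close> collects two decays in p: a / 2 from the moduli, and b^2 / (2
    a) from the Gaussian transform evaluated at 2 b p. Hence 2 a e = a^2 + b^2, the quantity in the
    claim.\<close>
  define e where "e = a / 2 + b\<^sup>2 / (2 * a)"
  have e: "e > 0" using a by (simp add: e_def add_pos_nonneg)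
  have inner: "cmod (\<integral>\<eta>. H \<eta> p \<partial>lborel) \<le> pi / (2 * a) * exp (- e * (norm p)\<^sup>2)" for p
  proof -
    have Hm: "(\<lambda>\<eta>. H \<eta> p) \<in> borel_measurable borel" unfolding H_def by measurable
    \<comment> \<open>Centring at - p / 2 makes the two quadratics symmetric in \<zeta>: their sum
      has no mixed term and their difference is linear in \<zeta>. The quadratic phase thereby
      becomes a Fourier phase against a real Gaussian.\<close>
    have expand: "H (- (1/2) *\<^sub>R p + \<zeta>) p = (cis (- (p \<bullet> z)) * complex_of_real (exp (- (a / 2) * (norm p)\<^sup>2)))
        * (complex_of_real (exp (- (2 * a) * (norm \<zeta>)\<^sup>2)) * cis (- (\<zeta> \<bullet> ((2 * b) *\<^sub>R p))))" for \<zeta>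
    proof -
      let ?x = "- (1/2) *\<^sub>R p + \<zeta>"
      have n1: "(norm ?x)\<^sup>2 = (norm \<zeta>)\<^sup>2 - \<zeta> \<bullet> p + (norm p)\<^sup>2 / 4"
        unfolding power2_norm_eq_inner by (simp add: inner_add_left inner_add_right inner_diff_left inner_diff_right inner_commute[of p \<zeta>] field_simps)
      have n2: "(norm (?x + p))\<^sup>2 = (norm \<zeta>)\<^sup>2 + \<zeta> \<bullet> p + (norm p)\<^sup>2 / 4"
        unfolding power2_norm_eq_inner
        by (simp add: inner_add_left inner_add_right inner_diff_left inner_diff_right inner_commute[of p \<zeta>] field_simps)
      have "H ?x p = complex_of_real (exp (- a * (norm ?x)\<^sup>2) * exp (- a * (norm (?x + p))\<^sup>2))
         * (cnj (cis (- (?x \<bullet> z))) * cis (- ((?x + p) \<bullet> z)) * (cnj (cis (- b * (norm ?x)\<^sup>2)) * cis (- b * (norm (?x + p))\<^sup>2)))"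
        by (simp add: H_def M_def mult_ac)
      also have "exp (- a * (norm ?x)\<^sup>2) * exp (- a * (norm (?x + p))\<^sup>2)
         = exp (- (a / 2) * (norm p)\<^sup>2) * exp (- (2 * a) * (norm \<zeta>)\<^sup>2)"
        unfolding exp_add[symmetric] n1 n2 by (simp add: field_simps)
      also have "cnj (cis (- (?x \<bullet> z))) * cis (- ((?x + p) \<bullet> z)) = cis (- (p \<bullet> z))"
        by (simp add: cis_cnj cis_mult inner_add_left)
      also have "cnj (cis (- b * (norm ?x)\<^sup>2)) * cis (- b * (norm (?x + p))\<^sup>2) = cis (- (\<zeta> \<bullet> ((2 * b) *\<^sub>R p)))"
        unfolding cis_cnj cis_mult n1 n2 by (simp add: algebra_simps)
      finally show ?thesis by (simp add: mult_ac)
    qed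
    have "(\<integral>\<eta>. H \<eta> p \<partial>lborel) = (\<integral>\<zeta>. H (- (1/2) *\<^sub>R p + \<zeta>) p \<partial>lborel)"
      by (rule sh[OF Hm, symmetric])
    also have "\<dots> = (cis (- (p \<bullet> z)) * complex_of_real (exp (- (a / 2) * (norm p)\<^sup>2)))
        * complex_of_real (pi / (2 * a) * exp (- (norm ((2 * b) *\<^sub>R p))\<^sup>2 / (4 * (2 * a))))"
      unfolding expand using a by (simp only: Bochner_Integration.integral_mult_right_zero) (subst gaussian_fourier_plane(2), auto)
    finally have "cmod (\<integral>\<eta>. H \<eta> p \<partial>lborel) = exp (- (a / 2) * (norm p)\<^sup>2) * (pi / (2 * a) * exp (- (norm ((2 * b) *\<^sub>R p))\<^sup>2 / (4 * (2 * a))))"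
      using a by (simp only: norm_mult norm_cis norm_of_real) (simp add: abs_mult)
    also have "\<dots> = pi / (2 * a) * (exp (- (a / 2) * (norm p)\<^sup>2) * exp (- (norm ((2 * b) *\<^sub>R p))\<^sup>2 / (4 * (2 * a))))"
      by simp
    also have "\<dots> = pi / (2 * a) * exp (- e * (norm p)\<^sup>2)"
      using a unfolding exp_add[symmetric] e_def by (simp add: power_mult_distrib field_simps power2_eq_square)
    finally show ?thesis by simp
  qed
  have "(\<integral>\<xi>. M \<xi> \<partial>lborel) * cnj (\<integral>\<xi>. M \<xi> \<partial>lborel) = (\<integral>\<eta>. cnj (M \<eta>) * (\<integral>\<xi>. M \<xi> \<partial>lborel) \<partial>lborel)"
    using Mi by (simp add: mult.commute)
  also have "\<dots> = (\<integral>\<eta>. (\<integral>p. H \<eta> p \<partial>lborel) \<partial>lborel)"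
    unfolding H_def by (simp add: sh)
  also have "\<dots> = (\<integral>p. (\<integral>\<eta>. H \<eta> p \<partial>lborel) \<partial>lborel)"
    by (rule lborel_pair.Fubini_integral[OF Hi, symmetric])
  finally have "cmod ((\<integral>\<xi>. M \<xi> \<partial>lborel) * cnj (\<integral>\<xi>. M \<xi> \<partial>lborel)) = cmod (\<integral>p. (\<integral>\<eta>. H \<eta> p \<partial>lborel) \<partial>lborel)"
    by simp
  also have "\<dots> \<le> (\<integral>p. pi / (2 * a) * exp (- e * (norm (p::plane))\<^sup>2) \<partial>lborel)"
    by (rule integral_norm_le) (use gaussian_integral_plane(1)[OF e] inner in auto)
  also have "\<dots> = pi / (2 * a) * (pi / e)"
    using gaussian_integral_plane(2)[OF e] by simp
  also have "\<dots> = (pi / sqrt (a\<^sup>2 + b\<^sup>2))\<^sup>2"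
    using a by (simp add: e_def power_divide field_simps power2_eq_square)
  finally have "(cmod (\<integral>\<xi>. M \<xi> \<partial>lborel))\<^sup>2 \<le> (pi / sqrt (a\<^sup>2 + b\<^sup>2))\<^sup>2"
    by (simp add: norm_mult power2_eq_square)
  then have "cmod (\<integral>\<xi>. M \<xi> \<partial>lborel) \<le> pi / sqrt (a\<^sup>2 + b\<^sup>2)"
    by (rule power2_le_imp_le) simp
  then show ?thesis by (simp add: M_def)
qed

text \<open>The oscillating multiplier is not integrable, so it is damped by exp (- d |\<xi>|^2).
  The kernel bound pi / |t| does not depend on d, and (1 / (2 pi))^2 pi / |t| = 1 / (4 pi |t|). In
  the paired form only inner products have to converge as d tends to 0.\<close>

lemma dispersive_weak:
  assumes f: "f \<in> L12" and h: "h \<in> L12" and t: "t \<noteq> 0"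
    and u: "has_fourier u (\<lambda>\<xi>. cis (- t * (norm \<xi>)\<^sup>2) * fourier_L1 f \<xi>)"
  shows "cmod (L2_inner u h) \<le> 1 / (4 * pi * \<bar>t\<bar>) * (\<integral>x. cmod (f x) \<partial>lborel) * (\<integral>x. cmod (h x) \<partial>lborel)"
proof -
  let ?P = "\<lambda>\<xi>. fourier_L1 f \<xi> * cnj (fourier_L1 h \<xi>)"
  define d where "d n = 1 / real (Suc n)" for n
  have d: "d n > 0" for n by (simp add: d_def)
  have dlim: "d \<longlonglongrightarrow> 0" unfolding d_def by (rule LIMSEQ_Suc[OF lim_1_over_n])
  let ?m = "\<lambda>n \<xi>::plane. complex_of_real (exp (- d n * (norm \<xi>)\<^sup>2)) * cis (- t * (norm \<xi>)\<^sup>2)"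
  have mi: "integrable lborel (?m n)" for n
    by (rule Bochner_Integration.integrable_bound[OF gaussian_integral_plane(1)[OF d]]) (auto simp: norm_mult)
  have Pi: "integrable lborel ?P" by (intro L2_inner_integrable fourier_L1_L2 f h)
  have [measurable]: "?P \<in> borel_measurable borel"
    using borel_measurable_integrable[OF Pi] by simp
  have "(\<lambda>n. \<integral>\<xi>. ?m n \<xi> * ?P \<xi> \<partial>lborel) \<longlonglongrightarrow> (\<integral>\<xi>. cis (- t * (norm \<xi>)\<^sup>2) * ?P \<xi> \<partial>lborel)"
  proof (rule integral_dominated_convergence[OF _ _ integrable_norm[OF Pi]])
    show "AE \<xi> in lborel. (\<lambda>n. ?m n \<xi> * ?P \<xi>) \<longlonglongrightarrow> cis (- t * (norm \<xi>)\<^sup>2) * ?P \<xi>"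
    proof (rule AE_I2)
      fix \<xi> :: plane
      have "(\<lambda>n. ?m n \<xi> * ?P \<xi>) \<longlonglongrightarrow> (complex_of_real (exp (- 0 * (norm \<xi>)\<^sup>2)) * cis (- t * (norm \<xi>)\<^sup>2)) * ?P \<xi>"
        by (intro tendsto_intros dlim)
      then show "(\<lambda>n. ?m n \<xi> * ?P \<xi>) \<longlonglongrightarrow> cis (- t * (norm \<xi>)\<^sup>2) * ?P \<xi>" by simp
    qed
    show "AE \<xi> in lborel. norm (?m n \<xi> * ?P \<xi>) \<le> norm (?P \<xi>)" for n
      using d[of n] by (intro AE_I2) (auto simp: norm_mult intro!: mult_left_le_one_le)
  qed measurable
  moreover have "(\<integral>\<xi>. cis (- t * (norm \<xi>)\<^sup>2) * ?P \<xi> \<partial>lborel) = L2_inner u h"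
    using Plancherel_inner[OF u has_fourier_L1[OF h]] by (simp add: L2_inner_def mult.assoc)
  ultimately have lim: "(\<lambda>n. cmod (\<integral>\<xi>. ?m n \<xi> * ?P \<xi> \<partial>lborel)) \<longlonglongrightarrow> cmod (L2_inner u h)"
    by (simp add: tendsto_norm)
  have "cmod (\<integral>\<xi>. ?m n \<xi> * ?P \<xi> \<partial>lborel) \<le> (1 / (2 * pi))\<^sup>2 * (pi / \<bar>t\<bar>) * (\<integral>x. cmod (f x) \<partial>lborel) * (\<integral>x. cmod (h x) \<partial>lborel)" for n
  proof (rule fourier_L1_multiplier_bound[OF L12_integrable[OF f] L12_integrable[OF h] mi])
    fix z :: plane
    have "sqrt (t\<^sup>2) \<le> sqrt ((d n)\<^sup>2 + t\<^sup>2)" by simp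
    then have "pi / sqrt ((d n)\<^sup>2 + t\<^sup>2) \<le> pi / \<bar>t\<bar>"
      using t by (intro divide_left_mono mult_pos_pos) (auto intro: add_nonneg_pos)
    then show "cmod (\<integral>\<xi>. cis (- (\<xi> \<bullet> z)) * ?m n \<xi> \<partial>lborel) \<le> pi / \<bar>t\<bar>"
      using complex_gaussian_kernel_bound[OF d[of n], of z t] by linarith
  qed
  then have "cmod (L2_inner u h) \<le> (1 / (2 * pi))\<^sup>2 * (pi / \<bar>t\<bar>) * (\<integral>x. cmod (f x) \<partial>lborel) * (\<integral>x. cmod (h x) \<partial>lborel)"
    by (intro LIMSEQ_le_const2[OF lim]) blast
  also have "(1 / (2 * pi))\<^sup>2 * (pi / \<bar>t\<bar>) = 1 / (4 * pi * \<bar>t\<bar>)"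
    by (simp add: power2_eq_square)
  finally show ?thesis .
qed

section \<open>Dispersive estimate and Sobolev embedding\<close>

text \<open>If |u| > A held on a set of positive measure, testing against the phase of
  \<open>u\<close> on that set would violate the bound. Restriction to balls puts the test function
  into \<open>L12\<close>.\<close>

lemma AE_bounded_by_duality:
  assumes u: "u \<in> L2" and A: "A \<ge> 0"
    and bound: "\<And>h. h \<in> L12 \<Longrightarrow> cmod (L2_inner u h) \<le> A * (\<integral>x. cmod (h x) \<partial>lborel)"
  shows "AE x in lborel. cmod (u x) \<le> A"
proof -
  have [measurable]: "u \<in> borel_measurable borel" using u by (rule L2_measurable)
  have "AE x in lborel. \<not> (norm x \<le> real n \<and> cmod (u x) > A)" for n
  proof -
    define S where "S = {x. norm x \<le> real n \<and> cmod (u x) > A}"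
    have [measurable]: "S \<in> sets borel" unfolding S_def by measurable
    define h where "h x = indicator S x * (u x / complex_of_real (cmod (u x)))" for x
    have [measurable]: "h \<in> borel_measurable borel" unfolding h_def by measurable
    have hn: "cmod (h x) = indicator S x" for x
      using A by (auto simp: h_def S_def norm_mult norm_divide split: split_indicator)
    let ?k = "\<lambda>x::plane. 1 * indicator (cball 0 (real n)) x :: complex"
    have k: "?k \<in> L12" by (rule indicator_cball_L12)
    have le: "cmod (h x) \<le> 1 * cmod (?k x)" for x
      unfolding hn by (auto simp: S_def split: split_indicator)
    have "h \<in> L2" by (rule L2_dominated[OF _ L12_L2[OF k] le]) measurable
    moreover have "integrable lborel h"
      by (rule Bochner_Integration.integrable_bound[OF L12_integrable[OF k]]) (use le in auto)
    ultimately have hL: "h \<in> L12" by (simp add: L12_def)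
    have Si: "integrable lborel (\<lambda>x. indicator S x :: real)"
      using integrable_norm[OF L12_integrable[OF hL]] by (simp add: hn)
    have uh: "u x * cnj (h x) = complex_of_real (cmod (u x) * indicator S x)" for x
    proof (cases "x \<in> S")
      case True
      then have "cmod (u x) \<noteq> 0" using A by (auto simp: S_def)
      then show ?thesis using True
        by (simp add: h_def complex_norm_square[symmetric] power2_eq_square)
    qed (simp add: h_def)
    have i1: "integrable lborel (\<lambda>x. cmod (u x) * indicator S x)"
      using L2_inner_integrable[OF u L12_L2[OF hL]] unfolding uh by (simp only: complex_of_real_integrable_eq)
    have "L2_inner u h = complex_of_real (\<integral>x. cmod (u x) * indicator S x \<partial>lborel)"
      unfolding L2_inner_def uh by (rule integral_complex_of_real)
    then have "\<bar>\<integral>x. cmod (u x) * indicator S x \<partial>lborel\<bar> \<le> A * (\<integral>x. indicator S x \<partial>lborel)"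
      using bound[OF hL] by (simp add: hn)
    then have "(\<integral>x. cmod (u x) * indicator S x - A * indicator S x \<partial>lborel) \<le> 0"
      using i1 Si by simp
    moreover have i2: "integrable lborel (\<lambda>x. cmod (u x) * indicator S x - A * indicator S x)"
      using i1 Si by simp
    moreover have nn: "AE x in lborel. 0 \<le> cmod (u x) * indicator S x - A * indicator S x"
      by (intro AE_I2) (auto simp: S_def split: split_indicator)
    ultimately have "(\<integral>x. cmod (u x) * indicator S x - A * indicator S x \<partial>lborel) = 0"
      using integral_nonneg_AE[OF nn] by linarith
    then have "AE x in lborel. cmod (u x) * indicator S x - A * indicator S x = 0"
      using integral_nonneg_eq_0_iff_AE[OF i2 nn] by simp
    then show ?thesis by eventually_elim (auto simp: S_def split: split_indicator_asm)
  qed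
  then have "AE x in lborel. \<forall>n. \<not> (norm x \<le> real n \<and> cmod (u x) > A)"
    unfolding AE_all_countable by blast
  then show ?thesis
  proof eventually_elim
    case (elim x)
    obtain n where "norm x \<le> real n" using real_arch_simple by blast
    with elim show ?case by auto
  qed
qed

section \<open>Interpolation through level sets\<close>

lemma nn_integral_power_FTC:
  assumes "c \<ge> 0"
  shows "(\<integral>\<^sup>+l. ennreal (real (Suc m) * l ^ m) * indicator {0<..<c} l \<partial>lborel) = ennreal (c ^ Suc m)"
proof -
  have "(\<integral>\<^sup>+l. ennreal (real (Suc m) * l ^ m) * indicator {0<..<c} l \<partial>lborel)
    = (\<integral>\<^sup>+l. ennreal (real (Suc m) * l ^ m) * indicator {0..c} l \<partial>lborel)"
    by (rule nn_integral_cong_AE)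
       (use AE_lborel_singleton[of c] AE_lborel_singleton[of "0::real"] in \<open>eventually_elim, auto split: split_indicator\<close>)
  also have "\<dots> = ennreal (c ^ Suc m - 0 ^ Suc m)"
  proof (rule nn_integral_FTC_Icc)
    show "((\<lambda>l. l ^ Suc m) has_real_derivative real (Suc m) * l ^ m) (at l within A)" for l :: real and A
      using DERIV_pow[of "Suc m" l] by (auto intro: has_field_derivative_at_within)
  qed (use assms in auto)
  finally show ?thesis by simp
qed

text \<open>The real interpolation argument: the level set \<open>{\<bar>u\<bar> > l}\<close> only sees the part \<open>b\<close> of a
  decomposition \<open>u = a + b\<close> adapted to \<open>l\<close>.\<close>

lemma layer_cake_decomposition:
  assumes [measurable]: "u \<in> borel_measurable borel" "\<beta> \<in> borel_measurable borel"
    and dec: "\<And>l. l > 0 \<Longrightarrow> \<exists>a b. b \<in> borel_measurable borel \<and> (AE x in lborel. u x = a x + b x) \<and>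
        (AE x in lborel. cmod (a x) \<le> l / 2) \<and> (\<integral>\<^sup>+x. ennreal ((cmod (b x))\<^sup>2) \<partial>lborel) \<le> \<beta> l"
  shows "(\<integral>\<^sup>+x. ennreal (cmod (u x) ^ (m + 3)) \<partial>(lborel :: plane measure))
     \<le> ennreal (4 * (real m + 3)) * (\<integral>\<^sup>+l. ennreal (l ^ m) * \<beta> l * indicator {0<..} l \<partial>lborel)"
proof -
  \<comment> \<open>Chebyshev's inequality for \<open>b\<close>: up to a null set |u| > l forces |b|
    >= l / 2, because |a| <= l / 2. Hence the factor 4 / l^2.\<close>
  have em: "emeasure lborel {x. cmod (u x) > l} \<le> ennreal (4 / l\<^sup>2) * \<beta> l" if l: "l > 0" for l
  proof -
    obtain a b where [measurable]: "b \<in> borel_measurable borel" and ab: "AE x in lborel. u x = a x + b x"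
      and a: "AE x in lborel. cmod (a x) \<le> l / 2" and b: "(\<integral>\<^sup>+x. ennreal ((cmod (b x))\<^sup>2) \<partial>lborel) \<le> \<beta> l"
      using dec[OF l] by blast
    have "emeasure lborel {x. cmod (u x) > l} = (\<integral>\<^sup>+x. indicator {x. cmod (u x) > l} x \<partial>lborel)"
      by (rule nn_integral_indicator[symmetric]) measurable
    also have "\<dots> \<le> (\<integral>\<^sup>+x. ennreal (4 / l\<^sup>2) * ennreal ((cmod (b x))\<^sup>2) \<partial>lborel)"
    proof (rule nn_integral_mono_AE)
      show "AE x in lborel. indicator {x. cmod (u x) > l} x \<le> ennreal (4 / l\<^sup>2) * ennreal ((cmod (b x))\<^sup>2)"
        using ab a
      proof eventually_elim
        case (elim x)
        show ?case
        proof (cases "cmod (u x) > l")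
          case True
          have "cmod (b x) \<ge> l / 2"
            using True elim norm_triangle_ineq[of "a x" "b x"] by simp
          then have "(l / 2)\<^sup>2 \<le> (cmod (b x))\<^sup>2" using l by (intro power_mono) auto
          then have "1 \<le> 4 / l\<^sup>2 * (cmod (b x))\<^sup>2" using l by (simp add: field_simps power2_eq_square)
          then have "ennreal 1 \<le> ennreal (4 / l\<^sup>2 * (cmod (b x))\<^sup>2)" by (rule ennreal_leI)
          also have "\<dots> = ennreal (4 / l\<^sup>2) * ennreal ((cmod (b x))\<^sup>2)" by (rule ennreal_mult) auto
          finally show ?thesis using True by simp
        qed simp
      qed
    qed
    also have "\<dots> = ennreal (4 / l\<^sup>2) * (\<integral>\<^sup>+x. ennreal ((cmod (b x))\<^sup>2) \<partial>lborel)"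
      by (rule nn_integral_cmult) measurable
    also have "\<dots> \<le> ennreal (4 / l\<^sup>2) * \<beta> l" by (intro mult_left_mono b) simp
    finally show ?thesis .
  qed
  \<comment> \<open>Weight of the layer-cake formula for the power m + 3. Chebyshev costs l^2 and
    leaves l^m, so m = 1 gives L^4 and m = 3 gives L^6.\<close>
  let ?w = "\<lambda>l. ennreal (real (Suc (m + 2)) * l ^ (m + 2))"
  have "(\<integral>\<^sup>+x. ennreal (cmod (u x) ^ (m + 3)) \<partial>(lborel :: plane measure))
     = (\<integral>\<^sup>+x. (\<integral>\<^sup>+l. ?w l * indicator {0<..<cmod (u x)} l \<partial>lborel) \<partial>lborel)"
    by (subst nn_integral_power_FTC) (auto simp: numeral_3_eq_3)
  also have "\<dots> = (\<integral>\<^sup>+l. (\<integral>\<^sup>+x. ?w l * indicator {0<..<cmod (u x)} l \<partial>lborel) \<partial>lborel)"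
  proof (rule lborel_pair.Fubini')
    have "(\<lambda>p. ?w (fst p) * (if 0 < fst p \<and> fst p < cmod (u (snd p)) then 1 else 0)) \<in> borel_measurable (lborel \<Otimes>\<^sub>M lborel)"
      by measurable
    then show "(\<lambda>(l, x). ?w l * indicator {0<..<cmod (u x)} l) \<in> borel_measurable (lborel \<Otimes>\<^sub>M lborel)"
      by (rule measurable_cong[THEN iffD1, rotated]) (auto split: split_indicator)
  qed
  also have "\<dots> \<le> (\<integral>\<^sup>+l. ennreal (4 * (real m + 3)) * (ennreal (l ^ m) * \<beta> l * indicator {0<..} l) \<partial>lborel)"
  proof (rule nn_integral_mono)
    fix l :: real
    show "(\<integral>\<^sup>+x. ?w l * indicator {0<..<cmod (u x)} l \<partial>lborel) \<le> ennreal (4 * (real m + 3)) * (ennreal (l ^ m) * \<beta> l * indicator {0<..} l)"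
    proof (cases "l > 0")
      case True
      have "(\<integral>\<^sup>+x. ?w l * indicator {0<..<cmod (u x)} l \<partial>lborel) = (\<integral>\<^sup>+x. ?w l * indicator {x. cmod (u x) > l} x \<partial>lborel)"
        using True by (intro nn_integral_cong) (auto split: split_indicator)
      also have "\<dots> = ?w l * emeasure lborel {x. cmod (u x) > l}"
        by (rule nn_integral_cmult_indicator) measurable
      also have "\<dots> \<le> ?w l * (ennreal (4 / l\<^sup>2) * \<beta> l)"
        by (intro mult_left_mono em True) simp
      also have "\<dots> = (?w l * ennreal (4 / l\<^sup>2)) * \<beta> l" by (simp add: mult.assoc)
      also have "?w l * ennreal (4 / l\<^sup>2) = ennreal (4 * (real m + 3)) * ennreal (l ^ m)"
      proof -
        have r: "(real (Suc (m + 2)) * l ^ (m + 2)) * (4 / l\<^sup>2) = (4 * (real m + 3)) * l ^ m"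
          using True by (simp add: power_add power2_eq_square)
        have "?w l * ennreal (4 / l\<^sup>2) = ennreal ((real (Suc (m + 2)) * l ^ (m + 2)) * (4 / l\<^sup>2))"
          using True by (intro ennreal_mult[symmetric]) auto
        then show ?thesis
          unfolding r using True by (subst (asm) ennreal_mult) auto
      qed
      finally show ?thesis using True by (simp add: mult.assoc)
    next
      case False
      then have "(\<integral>\<^sup>+x. ?w l * indicator {0<..<cmod (u x)} l \<partial>lborel) = (\<integral>\<^sup>+x. 0 \<partial>(lborel :: plane measure))"
        by (intro nn_integral_cong) (auto split: split_indicator)
      then show ?thesis by simp
    qed
  qed
  also have "\<dots> = ennreal (4 * (real m + 3)) * (\<integral>\<^sup>+l. ennreal (l ^ m) * \<beta> l * indicator {0<..} l \<partial>lborel)"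
    by (rule nn_integral_cmult) measurable
  finally show ?thesis .
qed

text \<open>Companion of the layer-cake estimate, which sums the masses \<open>\<beta> l\<close>
  over all levels. After exchanging the integrals the admissible levels at a given x lie in (0, c
  x], so they contribute at most (c x)^(m+1) / (m + 1).\<close>

lemma nn_integral_layers:
  assumes f [measurable]: "f \<in> borel_measurable (lborel :: plane measure)" and c: "\<And>x. c x \<ge> 0" and [measurable]: "c \<in> borel_measurable (lborel :: plane measure)"
    and P: "\<And>l x. l > 0 \<Longrightarrow> f x \<noteq> 0 \<Longrightarrow> P l x \<Longrightarrow> l \<le> c x"
    and [measurable]: "Measurable.pred (lborel \<Otimes>\<^sub>M lborel) (\<lambda>(l, x). P l x)"
  shows "(\<integral>\<^sup>+l. ennreal (l ^ m) * (\<integral>\<^sup>+x. f x * (if P l x then 1 else 0) \<partial>lborel) * indicator {0<..} l \<partial>lborel)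
     \<le> ennreal (1 / (real m + 1)) * (\<integral>\<^sup>+x. f x * ennreal (c x ^ Suc m) \<partial>lborel)"
proof -
  have "(\<integral>\<^sup>+l. ennreal (l ^ m) * (\<integral>\<^sup>+x. f x * (if P l x then 1 else 0) \<partial>lborel) * indicator {0<..} l \<partial>lborel)
    = (\<integral>\<^sup>+l. (\<integral>\<^sup>+x. f x * (ennreal (l ^ m) * (if P l x then 1 else 0) * indicator {0<..} l) \<partial>lborel) \<partial>lborel)"
  proof (rule nn_integral_cong)
    fix l :: real
    have "ennreal (l ^ m) * (\<integral>\<^sup>+x. f x * (if P l x then 1 else 0) \<partial>lborel) * indicator {0<..} l
      = (\<integral>\<^sup>+x. (ennreal (l ^ m) * indicator {0<..} l) * (f x * (if P l x then 1 else 0)) \<partial>lborel)"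
      by (subst nn_integral_cmult) (auto simp: mult_ac)
    then show "ennreal (l ^ m) * (\<integral>\<^sup>+x. f x * (if P l x then 1 else 0) \<partial>lborel) * indicator {0<..} l
      = (\<integral>\<^sup>+x. f x * (ennreal (l ^ m) * (if P l x then 1 else 0) * indicator {0<..} l) \<partial>lborel)"
      by (simp add: mult_ac)
  qed
  also have "\<dots> = (\<integral>\<^sup>+x. (\<integral>\<^sup>+l. f x * (ennreal (l ^ m) * (if P l x then 1 else 0) * indicator {0<..} l) \<partial>lborel) \<partial>lborel)"
    by (rule lborel_pair.Fubini'[symmetric]) measurable
  also have "\<dots> \<le> (\<integral>\<^sup>+x. f x * (ennreal (1 / (real m + 1)) * ennreal (c x ^ Suc m)) \<partial>lborel)"
  proof (rule nn_integral_mono)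
    fix x :: plane
    show "(\<integral>\<^sup>+l. f x * (ennreal (l ^ m) * (if P l x then 1 else 0) * indicator {0<..} l) \<partial>lborel)
       \<le> f x * (ennreal (1 / (real m + 1)) * ennreal (c x ^ Suc m))"
    proof (cases "f x = 0")
      case False
      have "(\<integral>\<^sup>+l. ennreal (l ^ m) * (if P l x then 1 else 0) * indicator {0<..} l \<partial>lborel)
        \<le> (\<integral>\<^sup>+l. ennreal (1 / (real m + 1)) * (ennreal (real (Suc m) * l ^ m) * indicator {0<..<c x} l) \<partial>lborel)"
      proof (rule nn_integral_mono_AE)
        show "AE l in lborel. ennreal (l ^ m) * (if P l x then 1 else 0) * indicator {0<..} l
           \<le> ennreal (1 / (real m + 1)) * (ennreal (real (Suc m) * l ^ m) * indicator {0<..<c x} l)"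
          using AE_lborel_singleton[of "c x"]
        proof eventually_elim
          case (elim l)
          show ?case
          proof (cases "l > 0 \<and> P l x")
            case True
            then have "l < c x" using P[of l x] False elim by auto
            then show ?thesis using True by (simp add: ennreal_mult[symmetric] mult.assoc[symmetric] add.commute)
          qed auto
        qed
      qed
      also have "\<dots> = ennreal (1 / (real m + 1)) * ennreal (c x ^ Suc m)"
        by (subst nn_integral_cmult, measurable, subst nn_integral_power_FTC[OF c]) simp
      finally show ?thesis
        by (subst nn_integral_cmult) (auto intro: mult_left_mono)
    qed simp
  qed
  also have "\<dots> = ennreal (1 / (real m + 1)) * (\<integral>\<^sup>+x. f x * ennreal (c x ^ Suc m) \<partial>lborel)"
    by (subst nn_integral_cmult[symmetric]) (auto simp: mult_ac)
  finally show ?thesis .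
qed

lemma ennreal_mult4:
  assumes "p \<ge> 0" "q \<ge> 0" "r \<ge> 0" "s \<ge> 0"
  shows "ennreal p * (ennreal q * (ennreal r * ennreal s)) = ennreal (p * (q * (r * s)))"
  using assms by (simp add: ennreal_mult)

text \<open>Interpolation of Marcinkiewicz type between decay from L^1 to L^\<infinity> and
  conservation of the L^2 norm. At level l the large values of \<open>f\<close> go through the decay
  estimate and the small ones through Plancherel.\<close>

theorem dispersive_L4:
  assumes fF: "has_fourier f F" and t: "t \<noteq> 0"
    and u: "has_fourier u (\<lambda>\<xi>. cis (- t * (norm \<xi>)\<^sup>2) * F \<xi>)"
    and S: "(\<integral>\<^sup>+x. ennreal (cmod (f x) powr (4/3)) \<partial>lborel) \<le> ennreal S" "S > 0"
  shows "(\<integral>\<^sup>+x. ennreal (cmod (u x) ^ 4) \<partial>lborel) \<le> ennreal (32 * (1 / (4 * pi * \<bar>t\<bar>))\<^sup>2 * S ^ 3)"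
proof -
  define A where "A = 1 / (4 * pi * \<bar>t\<bar>)"
  have A: "A > 0" using t by (simp add: A_def)
  \<comment> \<open>Chosen so that the large part has L^1 norm at most (l / c) S = l / (2 A). The
    decay factor \<open>A\<close> then makes its evolution at most l / 2.\<close>
  define c where "c = 2 * A * S"
  have c: "c > 0" using A S by (simp add: c_def)
  have fL: "f \<in> L2" and FL: "F \<in> L2" using fF by (auto dest: has_fourier_L2)
  have [measurable]: "f \<in> borel_measurable borel" "u \<in> borel_measurable borel"
    using fL u by (auto dest!: L2_measurable has_fourier_L2(1))
  let ?P = "\<lambda>l x. cmod (f x) * l ^ 3 \<le> c ^ 3"
  define \<beta> where "\<beta> l = (\<integral>\<^sup>+x. ennreal ((cmod (f x))\<^sup>2) * (if ?P l x then 1 else 0) \<partial>lborel)" for l :: real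
  have [measurable]: "\<beta> \<in> borel_measurable borel" unfolding \<beta>_def by measurable
  have "(\<integral>\<^sup>+x. ennreal (cmod (u x) ^ (1 + 3)) \<partial>lborel)
     \<le> ennreal (4 * (real 1 + 3)) * (\<integral>\<^sup>+l. ennreal (l ^ 1) * \<beta> l * indicator {0<..} l \<partial>lborel)"
  proof (rule layer_cake_decomposition)
    fix l :: real assume l: "l > 0"
    define G where "G = {x. \<not> ?P l x}"
    have [measurable]: "G \<in> sets borel" unfolding G_def by measurable
    define f1 where "f1 x = indicator G x * f x" for x
    have f1L: "f1 \<in> L2" unfolding f1_def by (rule L2_indicator[OF fL]) measurable
    have [measurable]: "f1 \<in> borel_measurable borel" using f1L by (rule L2_measurable)
    \<comment> \<open>On \<open>G\<close> the modulus of \<open>f\<close> exceeds (c / l)^3, so c /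
      l may be replaced by |f|^(1/3), giving |f| <= (l / c) |f|^(4/3).\<close>
    have le1: "cmod (f1 x) \<le> l / c * (cmod (f x) powr (4/3))" for x
    proof (cases "x \<in> G")
      case True
      then have *: "(c / l) ^ 3 < cmod (f x)" using l by (simp add: G_def field_simps)
      have "c / l = ((c / l) ^ 3) powr (1/3)"
        using c l by (simp add: powr_powr flip: powr_numeral)
      also have "\<dots> \<le> cmod (f x) powr (1/3)" using * c l by (intro powr_mono2) auto
      finally have "c / l * cmod (f x) \<le> cmod (f x) powr (1/3) * cmod (f x)" by (intro mult_right_mono) auto
      also have "\<dots> = cmod (f x) powr (4/3)"
        using powr_add[of "cmod (f x)" "1/3" 1] by simp
      finally have "l / c * (c / l * cmod (f x)) \<le> l / c * (cmod (f x) powr (4/3))"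
        using l c by (intro mult_left_mono) auto
      then show ?thesis using True l c by (simp add: f1_def)
    qed (use l c in \<open>simp add: f1_def\<close>)
    have "(\<integral>\<^sup>+x. ennreal (cmod (f1 x)) \<partial>lborel) \<le> (\<integral>\<^sup>+x. ennreal (l / c) * ennreal (cmod (f x) powr (4/3)) \<partial>lborel)"
      using l c le1 by (intro nn_integral_mono) (subst ennreal_mult[symmetric], auto intro: ennreal_leI)
    also have "\<dots> = ennreal (l / c) * (\<integral>\<^sup>+x. ennreal (cmod (f x) powr (4/3)) \<partial>lborel)"
      by (rule nn_integral_cmult) measurable
    also have "\<dots> \<le> ennreal (l / c) * ennreal S" by (intro mult_left_mono S) simp
    also have "\<dots> = ennreal (l / (2 * A))"
      using l c A S by (simp add: ennreal_mult[symmetric] c_def)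
    finally have f1b: "(\<integral>\<^sup>+x. ennreal (cmod (f1 x)) \<partial>lborel) \<le> ennreal (l / (2 * A))" .
    then have f1i: "integrable lborel f1"
      by (intro integrableI_bounded) (auto simp: le_less_trans)
    then have f1: "f1 \<in> L12" using f1L by (simp add: L12_def)
    have f1n: "(\<integral>x. cmod (f1 x) \<partial>lborel) \<le> l / (2 * A)"
      using f1b nn_integral_eq_integral[OF integrable_norm[OF f1i]] l A by simp
    define f2 where "f2 x = f x - f1 x" for x
    have f2F: "has_fourier f2 (\<lambda>\<xi>. F \<xi> - fourier_L1 f1 \<xi>)"
      unfolding f2_def by (intro has_fourier_diff fF has_fourier_L1 f1)
    have f2L: "f2 \<in> L2" by (rule has_fourier_L2[OF f2F])
    obtain a where a: "has_fourier a (\<lambda>\<xi>. cis (- t * (norm \<xi>)\<^sup>2) * fourier_L1 f1 \<xi>)"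
      using has_fourier_inverse_exists[OF cis_multiplier_L2[OF fourier_L1_L2(1)[OF f1]]] by blast
    obtain b where b: "has_fourier b (\<lambda>\<xi>. cis (- t * (norm \<xi>)\<^sup>2) * (F \<xi> - fourier_L1 f1 \<xi>))"
      using has_fourier_inverse_exists[OF cis_multiplier_L2[OF has_fourier_L2(2)[OF f2F]]] by blast
    have "has_fourier (\<lambda>x. a x + b x) (\<lambda>\<xi>. cis (- t * (norm \<xi>)\<^sup>2) * F \<xi>)"
      using has_fourier_add[OF a b] by (simp add: algebra_simps)
    then have ab: "AE x in lborel. u x = a x + b x"
      by (rule has_fourier_inj[OF u])
    have an: "AE x in lborel. cmod (a x) \<le> l / 2"
    proof (rule AE_bounded_by_duality)
      fix h assume h: "h \<in> L12"
      have "cmod (L2_inner a h) \<le> A * (\<integral>x. cmod (f1 x) \<partial>lborel) * (\<integral>x. cmod (h x) \<partial>lborel)"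
        unfolding A_def by (rule dispersive_weak[OF f1 h t a])
      also have "\<dots> \<le> A * (l / (2 * A)) * (\<integral>x. cmod (h x) \<partial>lborel)"
        using A by (intro mult_right_mono mult_left_mono f1n) auto
      finally show "cmod (L2_inner a h) \<le> l / 2 * (\<integral>x. cmod (h x) \<partial>lborel)" using A by simp
    qed (use l has_fourier_L2(1)[OF a] in auto)
    have "L2_norm b = L2_norm (\<lambda>\<xi>. cis (- t * (norm \<xi>)\<^sup>2) * (F \<xi> - fourier_L1 f1 \<xi>))"
      by (rule Plancherel[OF b, symmetric])
    also have "\<dots> = L2_norm f2"
      unfolding Plancherel[OF f2F, symmetric] by (simp add: L2_norm_def norm_mult)
    finally have "(\<integral>\<^sup>+x. ennreal ((cmod (b x))\<^sup>2) \<partial>lborel) = (\<integral>\<^sup>+x. ennreal ((cmod (f2 x))\<^sup>2) \<partial>lborel)"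
      using has_fourier_L2(1)[OF b] by (simp add: L2_norm_nn_integral f2L)
    also have "\<dots> = \<beta> l"
      unfolding \<beta>_def by (intro nn_integral_cong) (auto simp: f2_def f1_def G_def split: split_indicator)
    finally have bn: "(\<integral>\<^sup>+x. ennreal ((cmod (b x))\<^sup>2) \<partial>lborel) \<le> \<beta> l" by simp
    show "\<exists>a b. b \<in> borel_measurable borel \<and> (AE x in lborel. u x = a x + b x) \<and>
        (AE x in lborel. cmod (a x) \<le> l / 2) \<and> (\<integral>\<^sup>+x. ennreal ((cmod (b x))\<^sup>2) \<partial>lborel) \<le> \<beta> l"
      using ab an bn L2_measurable[OF has_fourier_L2(1)[OF b]] by blast
  qed measurable
  \<comment> \<open>For the small part |f| l^3 <= c^3 reads l <= c |f|^(-1/3). The resulting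
    integrand |f|^2 |f|^(-2/3) is again the power 4/3.\<close>
  also have "(\<integral>\<^sup>+l. ennreal (l ^ 1) * \<beta> l * indicator {0<..} l \<partial>lborel)
     \<le> ennreal (1 / (real 1 + 1)) * (\<integral>\<^sup>+x. ennreal ((cmod (f x))\<^sup>2) * ennreal ((c * cmod (f x) powr (-1/3)) ^ Suc 1) \<partial>lborel)"
    unfolding \<beta>_def
  proof (rule nn_integral_layers)
    fix l x assume l: "l > 0" and fx: "ennreal ((cmod (f x))\<^sup>2) \<noteq> 0" and P: "?P l x"
    have fx: "cmod (f x) > 0" using fx by (cases "f x = 0") auto
    have "(cmod (f x) powr (1/3) * l) ^ 3 \<le> c ^ 3"
      using P fx by (simp add: power_mult_distrib powr_power)
    then have "cmod (f x) powr (1/3) * l \<le> c" using c l power_mono_iff[of "cmod (f x) powr (1/3) * l" c 3] by simp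
    then have "cmod (f x) powr (-1/3) * (cmod (f x) powr (1/3) * l) \<le> cmod (f x) powr (-1/3) * c"
      by (intro mult_left_mono) auto
    also have "cmod (f x) powr (-1/3) * (cmod (f x) powr (1/3) * l) = l"
      using fx by (simp add: mult.assoc[symmetric] powr_add[symmetric])
    finally show "l \<le> c * cmod (f x) powr (-1/3)" by (simp add: mult.commute)
  qed (use c in \<open>auto\<close>)
  also have "(\<integral>\<^sup>+x. ennreal ((cmod (f x))\<^sup>2) * ennreal ((c * cmod (f x) powr (-1/3)) ^ Suc 1) \<partial>lborel)
     = (\<integral>\<^sup>+x. ennreal (c\<^sup>2) * ennreal (cmod (f x) powr (4/3)) \<partial>lborel)"
  proof (rule nn_integral_cong)
    fix x
    have "(cmod (f x))\<^sup>2 * (c * cmod (f x) powr (-1/3)) ^ Suc 1 = c\<^sup>2 * cmod (f x) powr (4/3)"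
    proof (cases "f x = 0")
      case False
      then have p: "cmod (f x) > 0" by simp
      have "(cmod (f x))\<^sup>2 * (c * cmod (f x) powr (-1/3)) ^ Suc 1
         = c\<^sup>2 * (cmod (f x) powr 2 * (cmod (f x) powr (-1/3) * cmod (f x) powr (-1/3)))"
        using powr_numeral[of "cmod (f x)" "num.Bit0 num.One"] p by (simp add: power2_eq_square)
      also have "\<dots> = c\<^sup>2 * cmod (f x) powr (4/3)"
        unfolding powr_add[symmetric] by simp
      finally show ?thesis .
    qed simp
    then show "ennreal ((cmod (f x))\<^sup>2) * ennreal ((c * cmod (f x) powr (-1/3)) ^ Suc 1) = ennreal (c\<^sup>2) * ennreal (cmod (f x) powr (4/3))"
      using c by (simp add: ennreal_mult[symmetric] del: power_Suc)
  qed
  also have "\<dots> = ennreal (c\<^sup>2) * (\<integral>\<^sup>+x. ennreal (cmod (f x) powr (4/3)) \<partial>lborel)"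
    by (rule nn_integral_cmult) measurable
  also have "\<dots> \<le> ennreal (c\<^sup>2) * ennreal S" by (intro mult_left_mono S) simp
  finally have "(\<integral>\<^sup>+x. ennreal (cmod (u x) ^ (1 + 3)) \<partial>lborel) \<le> ennreal (4 * (real 1 + 3)) * (ennreal (1 / (real 1 + 1)) * (ennreal (c\<^sup>2) * ennreal S))"
    by (simp add: mult_left_mono)
  also have "\<dots> = ennreal (4 * (real 1 + 3) * (1 / (real 1 + 1) * (c\<^sup>2 * S)))"
    by (rule ennreal_mult4) (use S in auto)
  also have "4 * (real 1 + 3) * (1 / (real 1 + 1) * (c\<^sup>2 * S)) = 32 * A\<^sup>2 * S ^ 3"
    by (simp add: c_def power2_eq_square power3_eq_cube)
  finally show ?thesis by (simp add: A_def numeral_eq_Suc)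
qed

lemma nn_integral_powr_from_0:
  fixes a c :: real
  assumes a: "a > -1" and c: "c \<ge> 0"
  shows "(\<integral>\<^sup>+x. ennreal (x powr a) * indicator {0..c} x \<partial>lborel) = ennreal (c powr (a + 1) / (a + 1))"
proof -
  have "integral\<^sup>N lborel (\<lambda>x. ennreal (indicator {0..c} x * x powr a)) = ennreal (c powr (a + 1) / (a + 1))"
    by (rule nn_integral_has_integral_lebesgue[OF _ has_integral_powr_from_0[OF a c]]) simp
  then show ?thesis
    by (simp add: ennreal_mult ennreal_indicator mult.commute)
qed

lemma ennreal_power2_le_imp_le:
  assumes "x ^ 2 \<le> ennreal y ^ 2" "y \<ge> 0"
  shows "x \<le> ennreal y"
proof (cases x)
  case (real a)
  then have "a\<^sup>2 \<le> y\<^sup>2" using assms by (simp add: ennreal_power)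
  then have "a \<le> y" using assms(2) by (rule power2_le_imp_le)
  then show ?thesis using real by (simp add: ennreal_leI)
next
  case top
  then show ?thesis using assms by (simp add: ennreal_power power2_eq_square[of "top :: ennreal"] top_unique)
qed

text \<open>Frequencies are split at |\<xi>| = r^3 with r proportional to the level l. The low ones
  have an integrable transform and hence a bounded inverse; the high ones are measured in L^2.
  Summing over the levels produces |\<xi>|^(4/3), which the Sobolev weight dominates, and no
  logarithm appears.\<close>

theorem sobolev_L6:
  assumes f: "f \<in> sobolev (2/3)"
    and N: "(\<integral>\<xi>. (1 + (norm \<xi>)\<^sup>2) powr (2/3) * (cmod (fourier f \<xi>))\<^sup>2 \<partial>lborel) \<le> N" "N > 0"
  shows "(\<integral>\<^sup>+x. ennreal (cmod (f x) ^ 6) \<partial>lborel) \<le> ennreal (96 * (3 * N / (4 * pi))\<^sup>2 * N)"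
proof -
  have fL: "f \<in> L2" and int: "integrable lborel (\<lambda>\<xi>. (1 + (norm \<xi>)\<^sup>2) powr (2/3) * (cmod (fourier f \<xi>))\<^sup>2)"
    using f by (auto simp: sobolev_def)
  define F where "F = fourier f"
  have fF: "has_fourier f F" unfolding F_def by (rule has_fourier_fourier[OF fL])
  have FL: "F \<in> L2" using fF by (rule has_fourier_L2)
  have [measurable]: "f \<in> borel_measurable borel" "F \<in> borel_measurable borel"
    using fL FL by (auto dest!: L2_measurable)
  let ?w = "\<lambda>\<xi>::plane. 1 + (norm \<xi>)\<^sup>2"
  have Nn: "(\<integral>\<^sup>+\<xi>. ennreal (?w \<xi> powr (2/3) * (cmod (F \<xi>))\<^sup>2) \<partial>lborel) \<le> ennreal N"
    using N by (subst nn_integral_eq_integral) (use int in \<open>auto simp: F_def intro: ennreal_leI\<close>)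
  \<comment> \<open>The constant of \<open>low\<close> divided by the 2 pi of the transform:
    frequencies up to r^3 give an amplitude of at most c r, which is l / 2 for r = l / (2
    c).\<close>
  define c where "c = sqrt (3 * pi * N) / (2 * pi)"
  have c: "c > 0" using N by (simp add: c_def)
  \<comment> \<open>Cauchy-Schwarz against the Sobolev weight. In polar coordinates the dual weight
    is at most s^(-1/3), whose integral up to r^3 is (3/2) r^2; this is why the cut is written as a
    cube.\<close>
  have low: "(\<integral>\<^sup>+\<xi>. ennreal (cmod (F \<xi>)) * indicator {\<xi>. norm \<xi> \<le> r ^ 3} \<xi> \<partial>lborel) \<le> ennreal (sqrt (3 * pi * N) * r)"
    if r: "r > 0" for r
  proof -
    let ?I = "indicator {\<xi>::plane. norm \<xi> \<le> r ^ 3} :: plane \<Rightarrow> ennreal"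
    have eq: "(\<integral>\<^sup>+\<xi>. ennreal (cmod (F \<xi>)) * ?I \<xi> \<partial>lborel)
       = (\<integral>\<^sup>+\<xi>. ennreal (?w \<xi> powr (1/3) * cmod (F \<xi>)) * (ennreal (?w \<xi> powr (-1/3)) * ?I \<xi>) \<partial>lborel)"
    proof (rule nn_integral_cong)
      fix \<xi> :: plane
      have w: "?w \<xi> > 0" by (simp add: add_pos_nonneg)
      have "cmod (F \<xi>) = (?w \<xi> powr (1/3) * cmod (F \<xi>)) * ?w \<xi> powr (-1/3)"
      proof -
        have "?w \<xi> powr (1/3) * ?w \<xi> powr (-1/3) = 1" using w by (simp add: powr_add[symmetric])
        then show ?thesis by (metis mult.assoc mult.commute mult_1)
      qed
      then have "ennreal (cmod (F \<xi>)) = ennreal (?w \<xi> powr (1/3) * cmod (F \<xi>)) * ennreal (?w \<xi> powr (-1/3))"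
        by (subst ennreal_mult[symmetric]) auto
      then show "ennreal (cmod (F \<xi>)) * ?I \<xi> = ennreal (?w \<xi> powr (1/3) * cmod (F \<xi>)) * (ennreal (?w \<xi> powr (-1/3)) * ?I \<xi>)"
        by (simp add: mult.assoc)
    qed
    have "(\<integral>\<^sup>+\<xi>. ennreal (cmod (F \<xi>)) * ?I \<xi> \<partial>lborel)\<^sup>2 \<le> (\<integral>\<^sup>+\<xi>. ennreal (?w \<xi> powr (1/3) * cmod (F \<xi>)) ^ 2 \<partial>lborel) * (\<integral>\<^sup>+\<xi>. (ennreal (?w \<xi> powr (-1/3)) * ?I \<xi>) ^ 2 \<partial>lborel)"
      unfolding eq by (rule Cauchy_Schwarz_nn_integral) measurable
    also have "\<dots> \<le> ennreal N * ennreal (3 * pi * r\<^sup>2)"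
    proof (rule mult_mono)
      have "(\<integral>\<^sup>+\<xi>. ennreal (?w \<xi> powr (1/3) * cmod (F \<xi>)) ^ 2 \<partial>lborel) = (\<integral>\<^sup>+\<xi>. ennreal (?w \<xi> powr (2/3) * (cmod (F \<xi>))\<^sup>2) \<partial>lborel)"
      proof (rule nn_integral_cong)
        fix \<xi> :: plane
        have w: "?w \<xi> > 0" by (simp add: add_pos_nonneg)
        have "(?w \<xi> powr (1/3) * cmod (F \<xi>))\<^sup>2 = ?w \<xi> powr (2/3) * (cmod (F \<xi>))\<^sup>2"
          using w by (simp add: power_mult_distrib powr_power)
        then show "ennreal (?w \<xi> powr (1/3) * cmod (F \<xi>)) ^ 2 = ennreal (?w \<xi> powr (2/3) * (cmod (F \<xi>))\<^sup>2)"
          by (simp add: ennreal_power)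
      qed
      then show "(\<integral>\<^sup>+\<xi>. ennreal (?w \<xi> powr (1/3) * cmod (F \<xi>)) ^ 2 \<partial>lborel) \<le> ennreal N" using Nn by simp
      let ?q = "\<lambda>s::real. (ennreal ((1 + s\<^sup>2) powr (-1/3)) * indicator {s. s \<le> r ^ 3} s) ^ 2"
      have "(\<integral>\<^sup>+\<xi>. (ennreal (?w \<xi> powr (-1/3)) * ?I \<xi>) ^ 2 \<partial>lborel) = (\<integral>\<^sup>+\<xi>. ?q (norm (\<xi>::plane)) \<partial>lborel)"
        by (intro nn_integral_cong) (auto split: split_indicator)
      also have "\<dots> = ennreal (2 * pi) * (\<integral>\<^sup>+s. ennreal s * ?q s * indicator {0..} s \<partial>lborel)"
        by (rule nn_integral_radial_plane) measurable
      also have "\<dots> \<le> ennreal (2 * pi) * (\<integral>\<^sup>+s. ennreal (s powr (-1/3)) * indicator {0..r^3} s \<partial>lborel)"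
      proof (intro mult_left_mono nn_integral_mono)
        fix s :: real
        show "ennreal s * ?q s * indicator {0..} s \<le> ennreal (s powr (-1/3)) * indicator {0..r^3} s"
        proof (cases "s > 0 \<and> s \<le> r ^ 3")
          case True
          have w: "1 + s\<^sup>2 > 0" by (simp add: add_pos_nonneg)
          have "(1 + s\<^sup>2) powr (-2/3) \<le> (s\<^sup>2) powr (-2/3)"
            using True by (intro powr_mono2') auto
          also have "(s\<^sup>2) powr (-2/3) = s powr (-4/3)"
            using True by (simp add: powr_powr flip: powr_numeral)
          finally have "s * (1 + s\<^sup>2) powr (-2/3) \<le> s powr 1 * s powr (-4/3)"
            using True by (simp add: mult_left_mono)
          also have "\<dots> = s powr (-1/3)" unfolding powr_add[symmetric] by simp
          finally have le: "s * (1 + s\<^sup>2) powr (-2/3) \<le> s powr (-1/3)" .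
          have "ennreal s * ?q s * indicator {0..} s = ennreal s * ennreal (((1 + s\<^sup>2) powr (-1/3))\<^sup>2)"
            using True by (simp add: ennreal_power)
          also have "((1 + s\<^sup>2) powr (-1/3))\<^sup>2 = (1 + s\<^sup>2) powr (-2/3)"
            using w by (simp add: powr_power)
          also have "ennreal s * ennreal ((1 + s\<^sup>2) powr (-2/3)) = ennreal (s * (1 + s\<^sup>2) powr (-2/3))"
            using True by (simp add: ennreal_mult)
          finally show ?thesis using le True by (simp add: ennreal_leI)
        next
          case False
          then have "s \<le> 0 \<or> s > r ^ 3" by auto
          then show ?thesis by (auto simp: ennreal_neg split: split_indicator)
        qed
      qed simp
      also have "\<dots> = ennreal (2 * pi) * ennreal ((r ^ 3) powr (-1/3 + 1) / (-1/3 + 1))"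
        using r by (subst nn_integral_powr_from_0) auto
      also have "(r ^ 3) powr (-1/3 + 1) = r\<^sup>2"
        using r by (simp add: powr_powr flip: powr_numeral)
      also have "ennreal (2 * pi) * ennreal (r\<^sup>2 / (-1/3 + 1)) = ennreal (3 * pi * r\<^sup>2)"
        by (simp add: ennreal_mult[symmetric] field_simps)
      finally show "(\<integral>\<^sup>+\<xi>. (ennreal (?w \<xi> powr (-1/3)) * ?I \<xi>) ^ 2 \<partial>lborel) \<le> ennreal (3 * pi * r\<^sup>2)" .
    qed auto
    also have "\<dots> = ennreal (sqrt (3 * pi * N) * r) ^ 2"
      using N r by (simp add: ennreal_mult[symmetric] ennreal_power power_mult_distrib mult_ac)
    finally show ?thesis
      by (rule ennreal_power2_le_imp_le) (use N r in simp)
  qed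
  let ?P = "\<lambda>l \<xi>::plane. (l / (2 * c)) ^ 3 < norm \<xi>"
  define \<beta> where "\<beta> l = (\<integral>\<^sup>+\<xi>. ennreal ((cmod (F \<xi>))\<^sup>2) * (if ?P l \<xi> then 1 else 0) \<partial>lborel)" for l :: real
  have [measurable]: "\<beta> \<in> borel_measurable borel" unfolding \<beta>_def by measurable
  have "(\<integral>\<^sup>+x. ennreal (cmod (f x) ^ (3 + 3)) \<partial>lborel)
     \<le> ennreal (4 * (real 3 + 3)) * (\<integral>\<^sup>+l. ennreal (l ^ 3) * \<beta> l * indicator {0<..} l \<partial>lborel)"
  proof (rule layer_cake_decomposition)
    fix l :: real assume l: "l > 0"
    define r where "r = l / (2 * c)"
    have r: "r > 0" using l c by (simp add: r_def)
    define G where "G = {\<xi>::plane. norm \<xi> \<le> r ^ 3}"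
    have [measurable]: "G \<in> sets borel" unfolding G_def by measurable
    define F1 where "F1 \<xi> = indicator G \<xi> * F \<xi>" for \<xi>
    define F2 where "F2 \<xi> = F \<xi> - F1 \<xi>" for \<xi>
    have F1L: "F1 \<in> L2" unfolding F1_def by (rule L2_indicator[OF FL]) measurable
    have F2L: "F2 \<in> L2" unfolding F2_def by (rule L2_diff[OF FL F1L])
    have [measurable]: "F1 \<in> borel_measurable borel" using F1L by (rule L2_measurable)
    have "(\<integral>\<^sup>+\<xi>. ennreal (cmod (F1 \<xi>)) \<partial>lborel) = (\<integral>\<^sup>+\<xi>. ennreal (cmod (F \<xi>)) * indicator {\<xi>. norm \<xi> \<le> r ^ 3} \<xi> \<partial>lborel)"
      by (intro nn_integral_cong) (auto simp: F1_def G_def split: split_indicator)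
    then have F1b: "(\<integral>\<^sup>+\<xi>. ennreal (cmod (F1 \<xi>)) \<partial>lborel) \<le> ennreal (sqrt (3 * pi * N) * r)"
      using low[OF r] by simp
    then have F1i: "integrable lborel F1"
      by (intro integrableI_bounded) (auto simp: le_less_trans)
    have F1n: "(\<integral>\<xi>. cmod (F1 \<xi>) \<partial>lborel) \<le> sqrt (3 * pi * N) * r"
      using F1b nn_integral_eq_integral[OF integrable_norm[OF F1i]] r N by simp
    obtain a where a: "has_fourier a F1" using has_fourier_inverse_exists[OF F1L] by blast
    obtain b where b: "has_fourier b F2" using has_fourier_inverse_exists[OF F2L] by blast
    have "has_fourier (\<lambda>x. a x + b x) F"
      using has_fourier_add[OF a b] by (simp add: F2_def)
    then have ab: "AE x in lborel. f x = a x + b x" by (rule has_fourier_inj[OF fF])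
    have an: "AE x in lborel. cmod (a x) \<le> l / 2"
    proof (rule AE_bounded_by_duality)
      fix h assume h: "h \<in> L12"
      define K where "K = 1 / (2 * pi) * (\<integral>x. cmod (h x) \<partial>lborel)"
      have Kb: "cmod (fourier_L1 h \<xi>) \<le> K" for \<xi>
        unfolding K_def by (rule fourier_L1_bound)
      have "cmod (L2_inner a h) = cmod (\<integral>\<xi>. F1 \<xi> * cnj (fourier_L1 h \<xi>) \<partial>lborel)"
        using Plancherel_inner[OF a has_fourier_L1[OF h]] by (simp add: L2_inner_def)
      also have "\<dots> \<le> (\<integral>\<xi>. cmod (F1 \<xi>) * K \<partial>lborel)"
        using F1i by (intro integral_norm_le) (auto simp: norm_mult intro!: mult_left_mono Kb)
      also have "\<dots> = (\<integral>\<xi>. cmod (F1 \<xi>) \<partial>lborel) * K" by simp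
      also have "\<dots> \<le> sqrt (3 * pi * N) * r * K"
        by (intro mult_right_mono F1n) (simp add: K_def)
      also have "\<dots> = l / 2 * (\<integral>x. cmod (h x) \<partial>lborel)"
        using N by (simp add: K_def r_def c_def)
      finally show "cmod (L2_inner a h) \<le> l / 2 * (\<integral>x. cmod (h x) \<partial>lborel)" .
    qed (use l has_fourier_L2(1)[OF a] in auto)
    have "(\<integral>\<^sup>+x. ennreal ((cmod (b x))\<^sup>2) \<partial>lborel) = (\<integral>\<^sup>+\<xi>. ennreal ((cmod (F2 \<xi>))\<^sup>2) \<partial>lborel)"
      using Plancherel[OF b] has_fourier_L2(1)[OF b] by (simp add: L2_norm_nn_integral F2L)
    also have "\<dots> = \<beta> l"
      unfolding \<beta>_def by (intro nn_integral_cong) (auto simp: F2_def F1_def G_def r_def not_less split: split_indicator)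
    finally have bn: "(\<integral>\<^sup>+x. ennreal ((cmod (b x))\<^sup>2) \<partial>lborel) \<le> \<beta> l" by simp
    show "\<exists>a b. b \<in> borel_measurable borel \<and> (AE x in lborel. f x = a x + b x) \<and>
        (AE x in lborel. cmod (a x) \<le> l / 2) \<and> (\<integral>\<^sup>+x. ennreal ((cmod (b x))\<^sup>2) \<partial>lborel) \<le> \<beta> l"
      using ab an bn L2_measurable[OF has_fourier_L2(1)[OF b]] by blast
  qed measurable
  \<comment> \<open>A frequency counts as high only while l < 2 c |\<xi>|^(1/3), so integrating l^3
    gives a quarter of the fourth power of that threshold.\<close>
  also have "(\<integral>\<^sup>+l. ennreal (l ^ 3) * \<beta> l * indicator {0<..} l \<partial>lborel)
     \<le> ennreal (1 / (real 3 + 1)) * (\<integral>\<^sup>+\<xi>. ennreal ((cmod (F \<xi>))\<^sup>2) * ennreal ((2 * c * norm \<xi> powr (1/3)) ^ Suc 3) \<partial>lborel)"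
    unfolding \<beta>_def
  proof (rule nn_integral_layers)
    fix l and \<xi> :: plane assume l: "l > 0" and P: "?P l \<xi>"
    have "l / (2 * c) = ((l / (2 * c)) ^ 3) powr (1/3)"
      using c l by (simp add: powr_powr flip: powr_numeral)
    also have "\<dots> \<le> norm \<xi> powr (1/3)" using P c l by (intro powr_mono2) auto
    finally show "l \<le> 2 * c * norm \<xi> powr (1/3)" using c by (simp add: field_simps)
  qed (use c in auto)
  also have "(\<integral>\<^sup>+\<xi>. ennreal ((cmod (F \<xi>))\<^sup>2) * ennreal ((2 * c * norm \<xi> powr (1/3)) ^ Suc 3) \<partial>lborel)
     \<le> (\<integral>\<^sup>+\<xi>. ennreal (16 * c ^ 4) * ennreal (?w \<xi> powr (2/3) * (cmod (F \<xi>))\<^sup>2) \<partial>lborel)"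
  proof (rule nn_integral_mono)
    fix \<xi> :: plane
    have "(norm \<xi> powr (1/3)) ^ Suc 3 = norm \<xi> powr (4/3)"
      by (cases "\<xi> = 0") (simp_all add: powr_power)
    also have "\<dots> = ((norm \<xi>)\<^sup>2) powr (2/3)"
      by (cases "\<xi> = 0") (simp_all add: powr_powr flip: powr_numeral)
    also have "\<dots> \<le> ?w \<xi> powr (2/3)" by (intro powr_mono2) auto
    finally have "(16 * c ^ 4) * (norm \<xi> powr (1/3)) ^ Suc 3 \<le> (16 * c ^ 4) * ?w \<xi> powr (2/3)"
      by (rule mult_left_mono) simp
    moreover have "(2 * c * y) ^ Suc 3 = (16 * c ^ 4) * y ^ Suc 3" for y :: real
      by (simp add: numeral_eq_Suc)
    ultimately have "(2 * c * norm \<xi> powr (1/3)) ^ Suc 3 \<le> (16 * c ^ 4) * ?w \<xi> powr (2/3)"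
      by (simp only:)
    then have "(cmod (F \<xi>))\<^sup>2 * (2 * c * norm \<xi> powr (1/3)) ^ Suc 3 \<le> (cmod (F \<xi>))\<^sup>2 * ((16 * c ^ 4) * ?w \<xi> powr (2/3))"
      by (intro mult_left_mono) auto
    then have "ennreal ((cmod (F \<xi>))\<^sup>2 * (2 * c * norm \<xi> powr (1/3)) ^ Suc 3) \<le> ennreal ((16 * c ^ 4) * (?w \<xi> powr (2/3) * (cmod (F \<xi>))\<^sup>2))"
      by (intro ennreal_leI) (simp add: mult_ac)
    then show "ennreal ((cmod (F \<xi>))\<^sup>2) * ennreal ((2 * c * norm \<xi> powr (1/3)) ^ Suc 3)
       \<le> ennreal (16 * c ^ 4) * ennreal (?w \<xi> powr (2/3) * (cmod (F \<xi>))\<^sup>2)"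
      using c by (simp add: ennreal_mult del: power_Suc)
  qed
  also have "\<dots> = ennreal (16 * c ^ 4) * (\<integral>\<^sup>+\<xi>. ennreal (?w \<xi> powr (2/3) * (cmod (F \<xi>))\<^sup>2) \<partial>lborel)"
    by (rule nn_integral_cmult) measurable
  also have "\<dots> \<le> ennreal (16 * c ^ 4) * ennreal N" by (intro mult_left_mono Nn) simp
  finally have "(\<integral>\<^sup>+x. ennreal (cmod (f x) ^ (3 + 3)) \<partial>lborel) \<le> ennreal (4 * (real 3 + 3)) * (ennreal (1 / (real 3 + 1)) * (ennreal (16 * c ^ 4) * ennreal N))"
    by (simp add: mult_left_mono)
  also have "\<dots> = ennreal (4 * (real 3 + 3) * (1 / (real 3 + 1) * (16 * c ^ 4 * N)))"
    by (rule ennreal_mult4) (use c N in auto)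
  also have "4 * (real 3 + 3) * (1 / (real 3 + 1) * (16 * c ^ 4 * N)) = 96 * (c\<^sup>2)\<^sup>2 * N"
    by (simp add: power_mult[symmetric])
  also have "c\<^sup>2 = 3 * N / (4 * pi)"
    using N by (simp add: c_def power_divide power_mult_distrib power2_eq_square)
  finally show ?thesis by simp
qed

section \<open>The nonlinearity in radial variables\<close>

text \<open>The measure r dr on the half-line, extended by mass 0 to negative radii so that profiles
  remain functions on \<open>real\<close>. The angular factor 2 pi is kept outside.\<close>

definition radial_measure :: "real measure" where
  "radial_measure = density lborel (\<lambda>r. ennreal (max 0 r))"

lemma sets_radial_measure [measurable_cong, simp]: "sets radial_measure = sets borel"
  by (simp add: radial_measure_def)

lemma nn_integral_radial_measure:
  assumes [measurable]: "F \<in> borel_measurable borel"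
  shows "(\<integral>\<^sup>+s. F s \<partial>radial_measure) = (\<integral>\<^sup>+s. ennreal (max 0 s) * F s \<partial>lborel)"
  unfolding radial_measure_def by (rule nn_integral_density) auto

lemma AE_radial_measure_pos: "AE s in radial_measure. s > 0"
  unfolding radial_measure_def by (subst AE_density) auto

lemma nn_integral_norm_plane:
  assumes [measurable]: "F \<in> borel_measurable borel"
  shows "(\<integral>\<^sup>+x. F (norm (x::plane)) \<partial>lborel) = ennreal (2 * pi) * (\<integral>\<^sup>+s. F s \<partial>radial_measure)"
proof -
  have "(\<integral>\<^sup>+s. F s \<partial>radial_measure) = (\<integral>\<^sup>+s. ennreal s * F s * indicator {0..} s \<partial>lborel)"
    unfolding nn_integral_radial_measure[OF assms]
    by (intro nn_integral_cong) (auto split: split_indicator simp: max_def)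
  then show ?thesis by (simp add: nn_integral_radial_plane)
qed

lemma A_theta_radial_measure:
  assumes [measurable]: "f \<in> borel_measurable borel"
  shows "A_theta f r = - (1/2) * (\<integral>s. indicator {..r} s * (cmod (f s))\<^sup>2 \<partial>radial_measure)"
proof -
  have "(\<integral>s. indicator {..r} s * (cmod (f s))\<^sup>2 \<partial>radial_measure)
    = (\<integral>s. max 0 s *\<^sub>R (indicator {..r} s * (cmod (f s))\<^sup>2) \<partial>lborel)"
    unfolding radial_measure_def by (rule integral_density) auto
  also have "\<dots> = (LBINT s:{0..r}. (cmod (f s))\<^sup>2 * s)"
    unfolding set_lebesgue_integral_def
    by (intro Bochner_Integration.integral_cong) (auto split: split_indicator)
  finally show ?thesis by (simp add: A_theta_def)
qed

lemma A_theta_measurable [measurable]: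
  assumes [measurable]: "f \<in> borel_measurable borel"
  shows "A_theta f \<in> borel_measurable borel"
proof -
  have "(\<lambda>r. \<integral>s. (if 0 \<le> s \<and> s \<le> r then (cmod (f s))\<^sup>2 * s else 0) \<partial>lborel) \<in> borel_measurable borel"
    by (rule lborel.borel_measurable_lebesgue_integral) measurable
  moreover have "(LBINT s:{0..r}. (cmod (f s))\<^sup>2 * s) = (\<integral>s. (if 0 \<le> s \<and> s \<le> r then (cmod (f s))\<^sup>2 * s else 0) \<partial>lborel)" for r
    unfolding set_lebesgue_integral_def by (intro Bochner_Integration.integral_cong) auto
  ultimately have "(\<lambda>r. LBINT s:{0..r}. (cmod (f s))\<^sup>2 * s) \<in> borel_measurable borel" by simp
  then show ?thesis unfolding A_theta_def by measurable
qed

lemma A_zero_measurable [measurable]: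
  assumes [measurable]: "f \<in> borel_measurable borel"
  shows "A_zero f \<in> borel_measurable borel"
proof -
  have "(\<lambda>r. \<integral>s. (if r \<le> s then A_theta f s * (cmod (f s))\<^sup>2 / s else 0) \<partial>lborel) \<in> borel_measurable borel"
    by (rule lborel.borel_measurable_lebesgue_integral) measurable
  moreover have "(LBINT s:{r..}. A_theta f s * (cmod (f s))\<^sup>2 / s) = (\<integral>s. (if r \<le> s then A_theta f s * (cmod (f s))\<^sup>2 / s else 0) \<partial>lborel)" for r
    unfolding set_lebesgue_integral_def by (intro Bochner_Integration.integral_cong) auto
  ultimately have "(\<lambda>r. LBINT s:{r..}. A_theta f s * (cmod (f s))\<^sup>2 / s) \<in> borel_measurable borel" by simp
  then show ?thesis unfolding A_zero_def by measurable
qed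

lemma css_nonlinearity_measurable [measurable]:
  assumes [measurable]: "f \<in> borel_measurable borel"
  shows "css_nonlinearity g f \<in> borel_measurable borel"
  unfolding css_nonlinearity_def by measurable

lemma A_zero_radial_measure:
  assumes [measurable]: "f \<in> borel_measurable borel" and r: "r \<ge> 0"
  shows "A_zero f r = - (\<integral>s. indicator {r..} s * (A_theta f s * (cmod (f s))\<^sup>2 / s\<^sup>2) \<partial>radial_measure)"
proof -
  have "(\<integral>s. indicator {r..} s * (A_theta f s * (cmod (f s))\<^sup>2 / s\<^sup>2) \<partial>radial_measure)
    = (\<integral>s. max 0 s *\<^sub>R (indicator {r..} s * (A_theta f s * (cmod (f s))\<^sup>2 / s\<^sup>2)) \<partial>lborel)"
    unfolding radial_measure_def by (rule integral_density) auto
  also have "\<dots> = (LBINT s:{r..}. A_theta f s * (cmod (f s))\<^sup>2 / s)"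
    unfolding set_lebesgue_integral_def
    using r by (intro Bochner_Integration.integral_cong) (auto split: split_indicator simp: power2_eq_square)
  finally show ?thesis by (simp add: A_zero_def)
qed

section \<open>A calculus of bounds for radial integrals\<close>

text \<open>Measurability and nonnegativity travel with the bound, so sums, multiples and pointwise
  majorants of integrands act directly on the numbers.\<close>

definition int_le :: "(real \<Rightarrow> real) \<Rightarrow> real \<Rightarrow> bool" where
  "int_le F b \<longleftrightarrow> F \<in> borel_measurable borel \<and> (\<forall>s. F s \<ge> 0) \<and> b \<ge> 0 \<and>
     (\<integral>\<^sup>+s. ennreal (F s) \<partial>radial_measure) \<le> ennreal b"

lemma int_le_add:
  assumes F: "int_le F a" and G: "int_le G b"
  shows "int_le (\<lambda>s. F s + G s) (a + b)"
proof -
  have [measurable]: "F \<in> borel_measurable borel" "G \<in> borel_measurable borel" using F G by (auto simp: int_le_def)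
  have "(\<integral>\<^sup>+s. ennreal (F s + G s) \<partial>radial_measure) = (\<integral>\<^sup>+s. ennreal (F s) \<partial>radial_measure) + (\<integral>\<^sup>+s. ennreal (G s) \<partial>radial_measure)"
    using F G by (subst nn_integral_add[symmetric]) (auto simp: int_le_def)
  also have "\<dots> \<le> ennreal a + ennreal b" using F G by (intro add_mono) (auto simp: int_le_def)
  finally show ?thesis using F G by (auto simp: int_le_def)
qed

lemma int_le_cmult:
  assumes F: "int_le F a" and c: "c \<ge> 0"
  shows "int_le (\<lambda>s. c * F s) (c * a)"
proof -
  have [measurable]: "F \<in> borel_measurable borel" using F by (auto simp: int_le_def)
  have "(\<integral>\<^sup>+s. ennreal (c * F s) \<partial>radial_measure) = (\<integral>\<^sup>+s. ennreal c * ennreal (F s) \<partial>radial_measure)"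
    using F c by (intro nn_integral_cong ennreal_mult) (auto simp: int_le_def)
  also have "\<dots> = ennreal c * (\<integral>\<^sup>+s. ennreal (F s) \<partial>radial_measure)"
    by (rule nn_integral_cmult) measurable
  also have "\<dots> \<le> ennreal c * ennreal a" using F by (intro mult_left_mono) (auto simp: int_le_def)
  finally show ?thesis using F c by (auto simp: int_le_def ennreal_mult)
qed

lemma int_le_weaken: "int_le F a \<Longrightarrow> a \<le> b \<Longrightarrow> int_le F b"
  by (auto simp: int_le_def intro: order_trans[OF _ ennreal_leI])

lemma int_le_mono:
  assumes F: "int_le F b" and H: "H \<in> borel_measurable borel" "\<And>s. H s \<ge> 0"
    and le: "\<And>s. s > 0 \<Longrightarrow> H s \<le> F s"
  shows "int_le H b"
proof -
  have "(\<integral>\<^sup>+s. ennreal (H s) \<partial>radial_measure) \<le> (\<integral>\<^sup>+s. ennreal (F s) \<partial>radial_measure)"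
    by (rule nn_integral_mono_AE) (use AE_radial_measure_pos in \<open>eventually_elim, auto intro: ennreal_leI le\<close>)
  then show ?thesis using F H by (auto simp: int_le_def)
qed

lemma int_le_integrable:
  fixes H :: "real \<Rightarrow> real"
  assumes F: "int_le F b" and H [measurable]: "H \<in> borel_measurable borel" and le: "\<And>s. s > 0 \<Longrightarrow> \<bar>H s\<bar> \<le> F s"
  shows "integrable radial_measure H" "\<bar>\<integral>s. H s \<partial>radial_measure\<bar> \<le> b"
proof -
  have "int_le (\<lambda>s. \<bar>H s\<bar>) b" by (rule int_le_mono[OF F]) (use le in auto)
  then have le: "(\<integral>\<^sup>+s. ennreal \<bar>H s\<bar> \<partial>radial_measure) \<le> ennreal b" and b: "b \<ge> 0" by (auto simp: int_le_def)
  then show "integrable radial_measure H" by (intro integrableI_bounded) (auto simp: le_less_trans)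
  show "\<bar>\<integral>s. H s \<partial>radial_measure\<bar> \<le> b"
    using order_trans[OF integral_norm_le_nn_integral[of radial_measure H, unfolded real_norm_def] le] b by simp
qed

lemma int_le_indicator_atMost:
  assumes r: "r \<ge> 0"
  shows "int_le (indicator {..r}) (r\<^sup>2 / 2)"
proof -
  have "(\<integral>\<^sup>+s. ennreal (indicator {..r} s) \<partial>radial_measure) = (\<integral>\<^sup>+s. ennreal s * indicator {0..r} s \<partial>lborel)"
    by (subst nn_integral_radial_measure) (auto intro!: nn_integral_cong simp: max_def ennreal_neg split: split_indicator)
  also have "\<dots> = ennreal (r\<^sup>2 / 2 - 0\<^sup>2 / 2)"
    by (rule nn_integral_FTC_Icc) (use r in \<open>auto intro!: derivative_eq_intros\<close>)
  finally show ?thesis by (simp add: int_le_def)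
qed

text \<open>The density of the measure adds one to the exponent, so integrability at the origin
  reaches down to a > -2.\<close>

lemma int_le_powr_near_0:
  assumes a: "a > -2"
  shows "int_le (\<lambda>s. s powr a * indicator {..1} s) (1 / (a + 2))"
proof -
  have "(\<integral>\<^sup>+s. ennreal (s powr a * indicator {..1} s) \<partial>radial_measure) = (\<integral>\<^sup>+s. ennreal (s powr (a + 1)) * indicator {0..1} s \<partial>lborel)"
  proof (subst nn_integral_radial_measure, measurable, rule nn_integral_cong)
    fix s :: real
    show "ennreal (max 0 s) * ennreal (s powr a * indicator {..1} s) = ennreal (s powr (a + 1)) * indicator {0..1} s"
    proof (cases "s > 0 \<and> s \<le> 1")
      case True
      then show ?thesis by (simp add: ennreal_mult[symmetric] powr_add mult.commute)
    next
      case False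
      then have "s \<le> 0 \<or> s > 1" by auto
      then show ?thesis by (auto simp: max_def ennreal_neg split: split_indicator)
    qed
  qed
  also have "\<dots> = ennreal (1 / (a + 2))"
    using nn_integral_powr_from_0[of "a + 1" 1] a by (simp add: add.assoc)
  finally show ?thesis using a by (simp add: int_le_def)
qed

lemma int_le_powr_tail:
  assumes b: "b > 2" and r: "r > 0"
  shows "int_le (\<lambda>s. s powr (- b) * indicator {r..} s) (r powr (2 - b) / (b - 2))"
proof -
  have h: "((\<lambda>s. s powr (1 - b)) has_integral (r powr (2 - b) / (b - 2))) {r..}"
  proof -
    have "- (r powr (1 - b + 1)) / (1 - b + 1) = r powr (2 - b) / (b - 2)"
      using b by (simp add: divide_simps) (simp add: algebra_simps)
    then show ?thesis using has_integral_powr_to_inf[of "1 - b" r] b r by simp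
  qed
  have "(\<integral>\<^sup>+s. ennreal (s powr (- b) * indicator {r..} s) \<partial>radial_measure) = (\<integral>\<^sup>+s. ennreal (indicator {r..} s * s powr (1 - b)) \<partial>lborel)"
  proof (subst nn_integral_radial_measure, measurable, rule nn_integral_cong)
    fix s :: real
    show "ennreal (max 0 s) * ennreal (s powr (- b) * indicator {r..} s) = ennreal (indicator {r..} s * s powr (1 - b))"
    proof (cases "s \<ge> r")
      case True
      then have "s * s powr (- b) = s powr (1 - b)" using r powr_add[of s 1 "- b"] by simp
      then show ?thesis using True r by (simp add: ennreal_mult[symmetric])
    qed simp
  qed
  also have "\<dots> = ennreal (r powr (2 - b) / (b - 2))"
    by (rule nn_integral_has_integral_lebesgue[OF _ h]) simp
  finally show ?thesis using b by (simp add: int_le_def)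
qed

section \<open>Pointwise Young inequalities\<close>

lemma mult_le_squares: "a * b \<le> a\<^sup>2 + b\<^sup>2" for a b :: real
proof -
  have "2 * (a * b) \<le> a\<^sup>2 + b\<^sup>2" using sum_squares_bound[of a b] by simp
  moreover have "0 \<le> a\<^sup>2 + b\<^sup>2" by simp
  ultimately show ?thesis by linarith
qed

lemma mult_square_le_cubes:
  fixes a z :: real
  assumes "a \<ge> 0" "z \<ge> 0"
  shows "a * z\<^sup>2 \<le> a ^ 3 + z ^ 3"
proof (cases "a \<le> z")
  case True
  then have "a * z\<^sup>2 \<le> z * z\<^sup>2" by (intro mult_right_mono) auto
  then show ?thesis using assms zero_le_power[of a 3] unfolding power3_eq_cube power2_eq_square by linarith
next
  case False
  then have "a * z\<^sup>2 \<le> a * a\<^sup>2" using assms by (intro mult_left_mono power_mono) auto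
  then show ?thesis using assms zero_le_power[of z 3] unfolding power3_eq_cube power2_eq_square by linarith
qed

lemma powr_realpow_mult: "s > 0 \<Longrightarrow> (s powr a) ^ n = s powr (a * real n)" for s :: real
  by (simp add: powr_powr flip: powr_realpow)

text \<open>Young's inequality with exponents 3 and 3/2. The power s^(-3/2) is integrable at the
  origin for s ds, and y^6 is a quantity the Sobolev embedding controls.\<close>

lemma square_over_le:
  fixes y s :: real
  assumes s: "s > 0"
  shows "y\<^sup>2 / s \<le> y ^ 6 + s powr (-3/2)"
proof -
  have z: "(s powr (-1/2))\<^sup>2 = 1 / s" "(s powr (-1/2)) ^ 3 = s powr (-3/2)"
    using powr_realpow_mult[OF s, of "-1/2" 2] powr_realpow_mult[OF s, of "-1/2" 3] powr_minus_divide[of s 1] s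
    by simp_all
  have "y\<^sup>2 * (s powr (-1/2))\<^sup>2 \<le> (y\<^sup>2) ^ 3 + (s powr (-1/2)) ^ 3"
    by (rule mult_square_le_cubes) auto
  then show ?thesis unfolding z by (simp add: power_mult[symmetric])
qed

text \<open>Writing 1 / s as s^(-3/8) s^(-5/8) leaves \<open>x\<close> with the power 4 and
  \<open>y\<close> with the power 6. Both remaining exponents, -3/2 and -15/8, exceed -2.\<close>

lemma mult_over_le:
  fixes x y s :: real
  assumes s: "s > 0"
  shows "x * y / s \<le> x ^ 4 + y ^ 6 + s powr (-3/2) + s powr (-15/8)"
proof -
  have 1: "s powr (-3/8) * s powr (-5/8) = 1 / s"
    using s by (simp add: powr_add[symmetric] powr_minus_divide)
  have 2: "(s powr (-3/8))\<^sup>2 = s powr (-3/4)" "(s powr (-3/4))\<^sup>2 = s powr (-3/2)" "(s powr (-5/8)) ^ 3 = s powr (-15/8)"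
    using powr_realpow_mult[OF s, of "-3/8" 2] powr_realpow_mult[OF s, of "-3/4" 2] powr_realpow_mult[OF s, of "-5/8" 3]
    by simp_all
  have "x * y / s = (x * s powr (-3/8)) * (y * s powr (-5/8))"
    using 1 by (simp add: mult_ac flip: mult.assoc)
  also have "\<dots> \<le> (x * s powr (-3/8))\<^sup>2 + (y * s powr (-5/8))\<^sup>2" by (rule mult_le_squares)
  also have "(x * s powr (-3/8))\<^sup>2 = x\<^sup>2 * s powr (-3/4)" by (simp only: power_mult_distrib 2)
  also have "\<dots> \<le> (x\<^sup>2)\<^sup>2 + (s powr (-3/4))\<^sup>2" by (rule mult_le_squares)
  also have "(y * s powr (-5/8))\<^sup>2 = y\<^sup>2 * (s powr (-5/8))\<^sup>2" by (simp add: power_mult_distrib)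
  also have "\<dots> \<le> (y\<^sup>2) ^ 3 + (s powr (-5/8)) ^ 3" by (rule mult_square_le_cubes) auto
  finally show ?thesis unfolding 2 by (simp add: power_mult[symmetric])
qed

section \<open>The potentials of a single profile\<close>

text \<open>The majorant \<open>y\<close> is kept apart from |f| so that the two members of a pair
  can share one, the sum of their moduli.\<close>

locale profile =
  fixes f :: "real \<Rightarrow> complex" and y :: "real \<Rightarrow> real" and L :: real
  assumes f_measurable [measurable]: "f \<in> borel_measurable borel"
    and f_le: "\<And>s. cmod (f s) \<le> y s"
    and L: "L \<ge> 1"
    and y2: "int_le (\<lambda>s. (y s)\<^sup>2) L"
    and y4: "int_le (\<lambda>s. (y s) ^ 4) L"
    and y6: "int_le (\<lambda>s. (y s) ^ 6) L"
begin

lemma f_square_le: "(cmod (f s))\<^sup>2 \<le> (y s)\<^sup>2"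
  by (intro power_mono f_le) simp

lemma y_nonneg: "y s \<ge> 0"
  using f_le[of s] norm_ge_zero[of "f s"] by linarith

lemma A_theta_integrable: "integrable radial_measure (\<lambda>s. indicator {..r} s * (cmod (f s))\<^sup>2)"
  by (rule int_le_integrable(1)[OF y2]) (use f_square_le in \<open>auto split: split_indicator\<close>)

lemma A_theta_bound: "\<bar>A_theta f r\<bar> \<le> L"
proof -
  have "\<bar>\<integral>s. indicator {..r} s * (cmod (f s))\<^sup>2 \<partial>radial_measure\<bar> \<le> L"
    by (rule int_le_integrable(2)[OF y2]) (use f_square_le in \<open>auto split: split_indicator\<close>)
  then show ?thesis unfolding A_theta_radial_measure[OF f_measurable] abs_mult using L by linarith
qed

text \<open>Cauchy-Schwarz on the disc of radius r, of radial measure r^2 / 2, with \<open>y\<close>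
  in L^4. The weights r / 2 and 1 / (2 r) of its pointwise form come from (r y^2 - 1)^2 >= 0. The
  linear vanishing at the origin is what the weights 1 / s^2 require.\<close>

lemma A_theta_bound_linear:
  assumes r: "r > 0"
  shows "\<bar>A_theta f r\<bar> \<le> L * r"
proof -
  have i: "int_le (\<lambda>s. r / 2 * (y s) ^ 4 + 1 / (2 * r) * indicator {..r} s) (r / 2 * L + 1 / (2 * r) * (r\<^sup>2 / 2))"
    using r by (intro int_le_add int_le_cmult y4 int_le_indicator_atMost) auto
  have "\<bar>\<integral>s. indicator {..r} s * (cmod (f s))\<^sup>2 \<partial>radial_measure\<bar> \<le> r / 2 * L + 1 / (2 * r) * (r\<^sup>2 / 2)"
  proof (rule int_le_integrable(2)[OF i])
    fix s
    have "0 \<le> (r * (y s)\<^sup>2 - 1)\<^sup>2" by simp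
    then have "2 * r * (y s)\<^sup>2 \<le> r\<^sup>2 * (y s) ^ 4 + 1" by (simp add: power2_diff power_mult_distrib power_mult[symmetric])
    then have "(y s)\<^sup>2 \<le> r / 2 * (y s) ^ 4 + 1 / (2 * r)" using r by (simp add: field_simps power2_eq_square)
    then show "\<bar>indicator {..r} s * (cmod (f s))\<^sup>2\<bar> \<le> r / 2 * (y s) ^ 4 + 1 / (2 * r) * indicator {..r} s"
      using f_square_le[of s] r by (auto split: split_indicator)
  qed measurable
  also have "\<dots> = r * L / 2 + r / 4" using r by (simp add: power2_eq_square)
  finally have "\<bar>A_theta f r\<bar> \<le> (r * L / 2 + r / 4) / 2"
    unfolding A_theta_radial_measure[OF f_measurable] by (simp add: abs_mult)
  also have "\<dots> \<le> L * r" using L r mult_right_mono[of 1 L r] by (simp add: field_simps)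
  finally show ?thesis .
qed

lemma A_zero_integrable:
  assumes r: "r > 0"
  shows "integrable radial_measure (\<lambda>s. indicator {r..} s * (A_theta f s * (cmod (f s))\<^sup>2 / s\<^sup>2))"
    and "\<bar>A_zero f r\<bar> \<le> L\<^sup>2 / r\<^sup>2"
proof -
  have i: "int_le (\<lambda>s. L / r\<^sup>2 * (y s)\<^sup>2) (L / r\<^sup>2 * L)"
    using L by (intro int_le_cmult y2) auto
  have le: "\<bar>indicator {r..} s * (A_theta f s * (cmod (f s))\<^sup>2 / s\<^sup>2)\<bar> \<le> L / r\<^sup>2 * (y s)\<^sup>2" for s
  proof (cases "s \<ge> r")
    case True
    have "\<bar>A_theta f s\<bar> * (cmod (f s))\<^sup>2 / s\<^sup>2 \<le> L * (y s)\<^sup>2 / r\<^sup>2"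
      using True r L by (intro frac_le mult_mono A_theta_bound f_square_le power_mono) auto
    then show ?thesis using True by (simp add: abs_mult)
  qed (use L in simp)
  note int = int_le_integrable[OF i _ le]
  show "integrable radial_measure (\<lambda>s. indicator {r..} s * (A_theta f s * (cmod (f s))\<^sup>2 / s\<^sup>2))"
    by (rule int(1)) measurable
  have "\<bar>\<integral>s. indicator {r..} s * (A_theta f s * (cmod (f s))\<^sup>2 / s\<^sup>2) \<partial>radial_measure\<bar> \<le> L / r\<^sup>2 * L"
    by (rule int(2)) measurable
  then show "\<bar>A_zero f r\<bar> \<le> L\<^sup>2 / r\<^sup>2"
    using r by (subst A_zero_radial_measure) (auto simp: power2_eq_square)
qed

text \<open>Beyond radius 1 the constant bound of \<open>A_theta\<close> suffices. For s <= 1 the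
  linear bound cancels one power of s, and \<open>square_over_le\<close> handles the remaining y^2 /
  s.\<close>

lemma A_zero_bound:
  assumes r: "r > 0"
  shows "\<bar>A_zero f r\<bar> \<le> 4 * L\<^sup>2"
proof -
  have i: "int_le (\<lambda>s. L * ((y s)\<^sup>2 + (y s) ^ 6 + s powr (-3/2) * indicator {..1} s)) (L * (L + L + 1 / (-3/2 + 2)))"
    using L by (intro int_le_cmult int_le_add y2 y6 int_le_powr_near_0) auto
  have "\<bar>\<integral>s. indicator {r..} s * (A_theta f s * (cmod (f s))\<^sup>2 / s\<^sup>2) \<partial>radial_measure\<bar> \<le> L * (L + L + 1 / (-3/2 + 2))"
  proof (rule int_le_integrable(2)[OF i])
    fix s :: real assume s: "s > 0"
    have y6': "0 \<le> (y s) ^ 6" using y_nonneg by simp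
    have "\<bar>A_theta f s\<bar> * (cmod (f s))\<^sup>2 / s\<^sup>2 \<le> L * ((y s)\<^sup>2 + (y s) ^ 6 + s powr (-3/2) * indicator {..1} s)"
    proof (cases "s \<le> 1")
      case True
      have "\<bar>A_theta f s\<bar> * (cmod (f s))\<^sup>2 / s\<^sup>2 \<le> (L * s) * (y s)\<^sup>2 / s\<^sup>2"
        using L s by (intro divide_right_mono mult_mono A_theta_bound_linear f_square_le) auto
      also have "\<dots> = L * ((y s)\<^sup>2 / s)" using s by (simp add: power2_eq_square)
      also have "\<dots> \<le> L * ((y s)\<^sup>2 + (y s) ^ 6 + s powr (-3/2) * indicator {..1} s)"
      proof (intro mult_left_mono)
        have "(y s)\<^sup>2 \<ge> 0" "indicator {..1} s = (1::real)" using True by auto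
        then show "(y s)\<^sup>2 / s \<le> (y s)\<^sup>2 + (y s) ^ 6 + s powr (-3/2) * indicator {..1} s"
          using square_over_le[OF s, of "y s"] by (simp only: mult_1_right)
      qed (use L in simp)
      finally show ?thesis .
    next
      case False
      have "\<bar>A_theta f s\<bar> * (cmod (f s))\<^sup>2 / s\<^sup>2 \<le> L * (y s)\<^sup>2 / 1"
        using False L by (intro frac_le mult_mono A_theta_bound f_square_le) (auto simp: power2_eq_square mult_ge1_I)
      also have "\<dots> \<le> L * ((y s)\<^sup>2 + (y s) ^ 6 + s powr (-3/2) * indicator {..1} s)"
        using L y6' by (auto intro!: mult_left_mono)
      finally show ?thesis .
    qed
    then show "\<bar>indicator {r..} s * (A_theta f s * (cmod (f s))\<^sup>2 / s\<^sup>2)\<bar> \<le> L * ((y s)\<^sup>2 + (y s) ^ 6 + s powr (-3/2) * indicator {..1} s)"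
      using L y6' by (auto simp: abs_mult split: split_indicator)
  qed measurable
  also have "\<dots> \<le> 4 * L\<^sup>2"
    using L mult_left_mono[of 1 L L] by (simp add: power2_eq_square algebra_simps)
  finally show ?thesis
    using r by (subst A_zero_radial_measure) auto
qed

end

text \<open>Common envelope of the potentials and of their differences. The rate -3/2 is dictated by
  the differences, as single profiles give r^(-2). Its square is integrable for r dr, which is how
  it enters the L^(4/3) estimate.\<close>

definition decay :: "real \<Rightarrow> real" where
  "decay r = (if r \<le> 1 then 1 else r powr (-3/2))"

lemma decay_measurable [measurable]: "decay \<in> borel_measurable borel"
  unfolding decay_def by measurable

lemma decay_bounds: "decay r \<ge> 0" "decay r \<le> 1"
  using powr_mono[of "-3/2" 0 r] by (auto simp: decay_def)

lemma int_le_decay: "int_le (\<lambda>s. (decay s)\<^sup>2) (3/2)"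
proof -
  have "int_le (\<lambda>s. indicator {..1} s + s powr (- 3) * indicator {1..} s) (1\<^sup>2 / 2 + 1 powr (2 - 3) / (3 - 2))"
    by (intro int_le_add int_le_indicator_atMost int_le_powr_tail) auto
  then have "int_le (\<lambda>s. (decay s)\<^sup>2) (1\<^sup>2 / 2 + 1 powr (2 - 3) / (3 - 2))"
  proof (rule int_le_mono)
    fix s :: real assume s: "s > 0"
    show "(decay s)\<^sup>2 \<le> indicator {..1} s + s powr (- 3) * indicator {1..} s"
      using powr_realpow_mult[OF s, of "-3/2" 2] by (auto simp: decay_def)
  qed auto
  then show ?thesis by simp
qed

context profile
begin

lemma inverse_square_le_decay: "r > 0 \<Longrightarrow> r \<ge> 1 \<Longrightarrow> 1 / r\<^sup>2 \<le> decay r"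
  using powr_mono[of "-2" "-3/2" r] by (auto simp: decay_def powr_minus_divide)

lemma A_zero_decay: "r > 0 \<Longrightarrow> \<bar>A_zero f r\<bar> \<le> 4 * L\<^sup>2 * decay r"
proof (cases "r \<le> 1")
  case False
  assume r: "r > 0"
  have "\<bar>A_zero f r\<bar> \<le> L\<^sup>2 * (1 / r\<^sup>2)" using A_zero_integrable(2)[OF r] by simp
  also have "\<dots> \<le> L\<^sup>2 * decay r" using False r by (intro mult_left_mono inverse_square_le_decay) auto
  also have "\<dots> \<le> 4 * L\<^sup>2 * decay r" by (simp add: decay_bounds mult_right_mono)
  finally show ?thesis .
qed (use A_zero_bound in \<open>auto simp: decay_def\<close>)

lemma A_theta_decay:
  assumes r: "r > 0"
  shows "(A_theta f r)\<^sup>2 / r\<^sup>2 \<le> L\<^sup>2 * decay r"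
proof (cases "r \<le> 1")
  case True
  have "(A_theta f r)\<^sup>2 \<le> (L * r)\<^sup>2"
    using A_theta_bound_linear[OF r] L r by (intro abs_le_square_iff[THEN iffD1]) auto
  then show ?thesis using True r by (simp add: decay_def power_mult_distrib divide_le_eq)
next
  case False
  have "(A_theta f r)\<^sup>2 \<le> L\<^sup>2"
    using A_theta_bound[of r] L by (intro abs_le_square_iff[THEN iffD1]) auto
  then have "(A_theta f r)\<^sup>2 / r\<^sup>2 \<le> L\<^sup>2 * (1 / r\<^sup>2)" by (simp add: divide_right_mono)
  also have "\<dots> \<le> L\<^sup>2 * decay r" using False r by (intro mult_left_mono inverse_square_le_decay) auto
  finally show ?thesis .
qed

text \<open>The potentials are bounded by 4 L^2 and L^2, whence 5 L^2 in front of \<open>y\<close>;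
  the cubic term is the one that calls for y^6.\<close>

lemma css_nonlinearity_square:
  "int_le (\<lambda>r. (cmod (css_nonlinearity g f r))\<^sup>2) (2 * (5 * L\<^sup>2)\<^sup>2 * L + 2 * g\<^sup>2 * L)"
proof (rule int_le_mono)
  show "int_le (\<lambda>s. 2 * (5 * L\<^sup>2)\<^sup>2 * (y s)\<^sup>2 + 2 * g\<^sup>2 * (y s) ^ 6) (2 * (5 * L\<^sup>2)\<^sup>2 * L + 2 * g\<^sup>2 * L)"
    by (intro int_le_add int_le_cmult y2 y6) auto
  fix r :: real assume r: "r > 0"
  have "cmod (css_nonlinearity g f r) \<le> cmod (of_real (A_zero f r) * f r + of_real ((A_theta f r)\<^sup>2 / r\<^sup>2) * f r)
      + cmod (of_real (g * (cmod (f r))\<^sup>2) * f r)"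
    unfolding css_nonlinearity_def by (rule norm_triangle_ineq4)
  also have "\<dots> \<le> (cmod (of_real (A_zero f r) * f r) + cmod (of_real ((A_theta f r)\<^sup>2 / r\<^sup>2) * f r))
      + cmod (of_real (g * (cmod (f r))\<^sup>2) * f r)"
    by (intro add_right_mono norm_triangle_ineq)
  also have "\<dots> = \<bar>A_zero f r\<bar> * cmod (f r) + (A_theta f r)\<^sup>2 / r\<^sup>2 * cmod (f r) + \<bar>g\<bar> * ((cmod (f r))\<^sup>2 * cmod (f r))"
    by (simp only: norm_mult norm_of_real) (simp add: abs_mult)
  also have "\<dots> \<le> (4 * L\<^sup>2 * 1) * y r + (L\<^sup>2 * 1) * y r + \<bar>g\<bar> * ((y r)\<^sup>2 * y r)"
  proof (intro add_mono mult_mono f_le f_square_le order_refl)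
    show "\<bar>A_zero f r\<bar> \<le> 4 * L\<^sup>2 * 1" using A_zero_bound[OF r] by simp
    have "L\<^sup>2 * decay r \<le> L\<^sup>2 * 1" by (intro mult_left_mono decay_bounds) auto
    then show "(A_theta f r)\<^sup>2 / r\<^sup>2 \<le> L\<^sup>2 * 1" using A_theta_decay[OF r] by linarith
  qed (auto simp: y_nonneg)
  also have "\<dots> = 5 * L\<^sup>2 * y r + \<bar>g\<bar> * y r ^ 3" by (simp add: power2_eq_square power3_eq_cube)
  finally have "(cmod (css_nonlinearity g f r))\<^sup>2 \<le> (5 * L\<^sup>2 * y r + \<bar>g\<bar> * y r ^ 3)\<^sup>2"
    by (intro power_mono) auto
  also have "\<dots> \<le> 2 * (5 * L\<^sup>2 * y r)\<^sup>2 + 2 * (\<bar>g\<bar> * y r ^ 3)\<^sup>2"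
    using sum_squares_bound[of "5 * L\<^sup>2 * y r" "\<bar>g\<bar> * y r ^ 3"] by (simp add: power2_sum)
  also have "\<dots> = 2 * (5 * L\<^sup>2)\<^sup>2 * (y r)\<^sup>2 + 2 * g\<^sup>2 * (y r) ^ 6"
    by (simp add: power_mult_distrib power_mult[symmetric])
  finally show "(cmod (css_nonlinearity g f r))\<^sup>2 \<le> 2 * (5 * L\<^sup>2)\<^sup>2 * (y r)\<^sup>2 + 2 * g\<^sup>2 * (y r) ^ 6" .
qed auto

end

text \<open>The function \<open>x\<close> is the difference divided by the bound \<open>B\<close> of its \<open>L\<^sup>4\<close> norm.  After this
  normalisation Hoelder's inequality can be replaced by pointwise Young inequalities.\<close>

locale profile_pair =
  fixes f h :: "real \<Rightarrow> complex" and x y :: "real \<Rightarrow> real" and B L :: real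
  assumes fh_measurable [measurable]: "f \<in> borel_measurable borel" "h \<in> borel_measurable borel"
    and sum_le: "\<And>s. cmod (f s) + cmod (h s) \<le> y s"
    and diff_le: "\<And>s. cmod (f s - h s) \<le> B * x s"
    and B: "B > 0" and L: "L \<ge> 1"
    and x_nonneg: "\<And>s. x s \<ge> 0"
    and x4: "int_le (\<lambda>s. (x s) ^ 4) 1"
    and y2: "int_le (\<lambda>s. (y s)\<^sup>2) L"
    and y4: "int_le (\<lambda>s. (y s) ^ 4) L"
    and y6: "int_le (\<lambda>s. (y s) ^ 6) L"
begin

sublocale f: profile f y L
proof
  show "cmod (f s) \<le> y s" for s
    using sum_le[of s] norm_ge_zero[of "h s"] by linarith
qed (auto intro: L y2 y4 y6)

sublocale h: profile h y L
proof
  show "cmod (h s) \<le> y s" for s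
    using sum_le[of s] norm_ge_zero[of "f s"] by linarith
qed (auto intro: L y2 y4 y6)

section \<open>Differences of the potentials of two profiles\<close>

lemma square_diff_le: "\<bar>(cmod (f s))\<^sup>2 - (cmod (h s))\<^sup>2\<bar> \<le> B * (x s * y s)"
proof -
  have "(cmod (f s))\<^sup>2 - (cmod (h s))\<^sup>2 = (cmod (f s) - cmod (h s)) * (cmod (f s) + cmod (h s))"
    by (simp add: power2_eq_square algebra_simps)
  then have "\<bar>(cmod (f s))\<^sup>2 - (cmod (h s))\<^sup>2\<bar> = \<bar>cmod (f s) - cmod (h s)\<bar> * (cmod (f s) + cmod (h s))"
    by (simp add: abs_mult)
  also have "\<dots> \<le> (B * x s) * y s"
  proof (intro mult_mono sum_le)
    show "\<bar>cmod (f s) - cmod (h s)\<bar> \<le> B * x s"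
      using norm_triangle_ineq3[of "f s" "h s"] diff_le[of s] by linarith
  qed (use B x_nonneg in auto)
  finally show ?thesis by (simp add: mult.assoc)
qed

lemma A_theta_diff_eq:
  "A_theta f r - A_theta h r = - (1/2) * (\<integral>s. indicator {..r} s * ((cmod (f s))\<^sup>2 - (cmod (h s))\<^sup>2) \<partial>radial_measure)"
  using f.A_theta_integrable[of r] h.A_theta_integrable[of r]
  by (simp add: A_theta_radial_measure right_diff_distrib)

text \<open>Reduces a difference of two \<open>A_theta\<close> to a pointwise majorant of x y on (0,
  r]. The linear and the square-root bound differ only in the choice of \<open>F\<close>.\<close>

lemma A_theta_diff_bound:
  assumes i: "int_le F b" and le: "\<And>s. s > 0 \<Longrightarrow> s \<le> r \<Longrightarrow> x s * y s \<le> F s"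
  shows "\<bar>A_theta f r - A_theta h r\<bar> \<le> B * b"
proof -
  have F: "F s \<ge> 0" for s using i by (auto simp: int_le_def)
  have b: "b \<ge> 0" using i by (auto simp: int_le_def)
  have "\<bar>\<integral>s. indicator {..r} s * ((cmod (f s))\<^sup>2 - (cmod (h s))\<^sup>2) \<partial>radial_measure\<bar> \<le> B * b"
  proof (rule int_le_integrable(2)[OF int_le_cmult[OF i]])
    fix s :: real assume s: "s > 0"
    show "\<bar>indicator {..r} s * ((cmod (f s))\<^sup>2 - (cmod (h s))\<^sup>2)\<bar> \<le> B * F s"
    proof (cases "s \<le> r")
      case True
      have "B * (x s * y s) \<le> B * F s" using B le[OF s True] by (intro mult_left_mono) auto
      then show ?thesis using True square_diff_le[of s] by simp
    qed (use B F in simp)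
  qed (use B in auto)
  moreover have "0 \<le> B * b" using B b by simp
  ultimately show ?thesis unfolding A_theta_diff_eq by (simp add: abs_mult)
qed

text \<open>Hoelder on the disc with \<open>x\<close> and \<open>y\<close> both in L^4. What remains
  is the square root of the measure of the disc, of order r.\<close>

lemma A_theta_diff_linear:
  assumes r: "r > 0"
  shows "\<bar>A_theta f r - A_theta h r\<bar> \<le> B * L * r"
proof -
  have "\<bar>A_theta f r - A_theta h r\<bar> \<le> B * (r / 4 * 1 + r / 4 * L + 1 / (2 * r) * (r\<^sup>2 / 2))"
  proof (rule A_theta_diff_bound)
    show "int_le (\<lambda>s. r / 4 * (x s) ^ 4 + r / 4 * (y s) ^ 4 + 1 / (2 * r) * indicator {..r} s) (r / 4 * 1 + r / 4 * L + 1 / (2 * r) * (r\<^sup>2 / 2))"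
      using r by (intro int_le_add int_le_cmult x4 y4 int_le_indicator_atMost) auto
    fix s assume s: "s \<le> r"
    have "0 \<le> (r * (x s * y s) - 1)\<^sup>2" by simp
    then have 1: "2 * r * (x s * y s) \<le> r\<^sup>2 * ((x s)\<^sup>2 * (y s)\<^sup>2) + 1" by (simp add: power2_diff power_mult_distrib)
    have "2 * ((x s)\<^sup>2 * (y s)\<^sup>2) \<le> (x s) ^ 4 + (y s) ^ 4"
      using sum_squares_bound[of "(x s)\<^sup>2" "(y s)\<^sup>2"] by (simp add: power_mult[symmetric])
    then have "r\<^sup>2 * (2 * ((x s)\<^sup>2 * (y s)\<^sup>2)) \<le> r\<^sup>2 * ((x s) ^ 4 + (y s) ^ 4)" by (intro mult_left_mono) auto
    then have "4 * r * (x s * y s) \<le> r\<^sup>2 * ((x s) ^ 4 + (y s) ^ 4) + 2" using 1 by linarith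
    then have "x s * y s \<le> r / 4 * (x s) ^ 4 + r / 4 * (y s) ^ 4 + 1 / (2 * r)"
      using r by (simp add: field_simps power2_eq_square)
    then show "x s * y s \<le> r / 4 * (x s) ^ 4 + r / 4 * (y s) ^ 4 + 1 / (2 * r) * indicator {..r} s" using s by simp
  qed
  also have "r / 4 * 1 + r / 4 * L + 1 / (2 * r) * (r\<^sup>2 / 2) = r * (2 + L) / 4"
    using r by (simp add: power2_eq_square field_simps)
  also have "B * (r * (2 + L) / 4) \<le> B * (L * r)"
    using B L r by (intro mult_left_mono) (auto simp: field_simps)
  finally show ?thesis by (simp add: mult.assoc)
qed

text \<open>Here \<open>x\<close> is taken in L^4 and \<open>y\<close> in L^2, leaving the fourth
  root of the measure of the disc, of order sqrt r. For large radii this improves on the linear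
  bound, and the tail of the \<open>A_zero\<close> difference relies on it.\<close>

lemma A_theta_diff_sqrt:
  assumes r: "r > 0"
  shows "\<bar>A_theta f r - A_theta h r\<bar> \<le> 2 * B * L * sqrt r"
proof -
  define q where "q = sqrt r"
  have q: "q > 0" "r = q\<^sup>2" using r by (auto simp: q_def)
  have "\<bar>A_theta f r - A_theta h r\<bar> \<le> B * (q / 2 * L + q / 4 * 1 + 1 / (4 * q ^ 3) * (r\<^sup>2 / 2))"
  proof (rule A_theta_diff_bound)
    \<comment> \<open>The powers of q = sqrt r are chosen so that each of the three terms integrates
      to a multiple of q.\<close>
    show "int_le (\<lambda>s. q / 2 * (y s)\<^sup>2 + q / 4 * (x s) ^ 4 + 1 / (4 * q ^ 3) * indicator {..r} s) (q / 2 * L + q / 4 * 1 + 1 / (4 * q ^ 3) * (r\<^sup>2 / 2))"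
      using r q by (intro int_le_add int_le_cmult x4 y2 int_le_indicator_atMost) auto
    fix s assume s: "s \<le> r"
    have "0 \<le> (q * y s - x s)\<^sup>2" by simp
    then have 1: "2 * q * (x s * y s) \<le> q\<^sup>2 * (y s)\<^sup>2 + (x s)\<^sup>2" by (simp add: power2_diff power_mult_distrib mult_ac)
    have "0 \<le> (q\<^sup>2 * (x s)\<^sup>2 - 1)\<^sup>2" by simp
    then have 2: "2 * (q\<^sup>2 * (x s)\<^sup>2) \<le> q ^ 4 * (x s) ^ 4 + 1"
      by (simp add: power2_diff power_mult_distrib power_mult[symmetric])
    have "q\<^sup>2 * (2 * q * (x s * y s)) \<le> q\<^sup>2 * (q\<^sup>2 * (y s)\<^sup>2 + (x s)\<^sup>2)" using 1 by (intro mult_left_mono) auto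
    then have "4 * q ^ 3 * (x s * y s) \<le> 2 * q ^ 4 * (y s)\<^sup>2 + q ^ 4 * (x s) ^ 4 + 1"
      using 2 by (simp add: power2_eq_square power3_eq_cube power4_eq_xxxx algebra_simps)
    then have "x s * y s \<le> q / 2 * (y s)\<^sup>2 + q / 4 * (x s) ^ 4 + 1 / (4 * q ^ 3)"
      using q(1) by (simp add: field_simps power3_eq_cube power4_eq_xxxx)
    then show "x s * y s \<le> q / 2 * (y s)\<^sup>2 + q / 4 * (x s) ^ 4 + 1 / (4 * q ^ 3) * indicator {..r} s" using s by simp
  qed
  also have "q / 2 * L + q / 4 * 1 + 1 / (4 * q ^ 3) * (r\<^sup>2 / 2) = q * (4 * L + 3) / 8"
    using q(1) unfolding q(2) by (simp add: power2_eq_square power3_eq_cube field_simps)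
  also have "B * (q * (4 * L + 3) / 8) \<le> B * (2 * L * q)"
    using B L q(1) by (intro mult_left_mono) (auto simp: field_simps)
  finally show ?thesis by (simp add: q_def mult_ac)
qed

definition "A_zero_diff_integrand s = (A_theta f s * (cmod (f s))\<^sup>2 / s\<^sup>2) - (A_theta h s * (cmod (h s))\<^sup>2 / s\<^sup>2)"

lemma A_zero_diff_integrand_measurable [measurable]: "A_zero_diff_integrand \<in> borel_measurable borel"
  unfolding A_zero_diff_integrand_def by measurable

text \<open>Product rule for differences: one summand carries the difference of the
  \<open>A_theta\<close>, the other the difference of the densities.\<close>

lemma A_zero_diff_integrand_le:
  assumes s: "s > 0"
  shows "\<bar>A_zero_diff_integrand s\<bar> \<le> (\<bar>A_theta f s - A_theta h s\<bar> * (y s)\<^sup>2 + \<bar>A_theta h s\<bar> * (B * (x s * y s))) / s\<^sup>2"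
proof -
  have "A_zero_diff_integrand s = ((A_theta f s - A_theta h s) * (cmod (f s))\<^sup>2 + A_theta h s * ((cmod (f s))\<^sup>2 - (cmod (h s))\<^sup>2)) / s\<^sup>2"
    by (simp add: A_zero_diff_integrand_def algebra_simps add_divide_distrib diff_divide_distrib)
  then have "\<bar>A_zero_diff_integrand s\<bar> = \<bar>(A_theta f s - A_theta h s) * (cmod (f s))\<^sup>2 + A_theta h s * ((cmod (f s))\<^sup>2 - (cmod (h s))\<^sup>2)\<bar> / s\<^sup>2"
    by simp
  also have "\<dots> \<le> (\<bar>A_theta f s - A_theta h s\<bar> * (y s)\<^sup>2 + \<bar>A_theta h s\<bar> * (B * (x s * y s))) / s\<^sup>2"
  proof (intro divide_right_mono order_trans[OF abs_triangle_ineq] add_mono)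
    show "\<bar>(A_theta f s - A_theta h s) * (cmod (f s))\<^sup>2\<bar> \<le> \<bar>A_theta f s - A_theta h s\<bar> * (y s)\<^sup>2"
      by (simp add: abs_mult f.f_square_le mult_left_mono)
    show "\<bar>A_theta h s * ((cmod (f s))\<^sup>2 - (cmod (h s))\<^sup>2)\<bar> \<le> \<bar>A_theta h s\<bar> * (B * (x s * y s))"
      by (simp add: abs_mult square_diff_le mult_left_mono)
  qed simp
  finally show ?thesis .
qed

lemma A_zero_diff_bound:
  assumes r: "r > 0" and i: "int_le F b" and le: "\<And>s. s \<ge> r \<Longrightarrow> \<bar>A_zero_diff_integrand s\<bar> \<le> B * L * F s"
  shows "\<bar>A_zero f r - A_zero h r\<bar> \<le> B * L * b"
proof -
  have F: "F s \<ge> 0" for s using i by (auto simp: int_le_def)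
  have "A_zero f r - A_zero h r = - (\<integral>s. indicator {r..} s * A_zero_diff_integrand s \<partial>radial_measure)"
    using f.A_zero_integrable(1)[OF r] h.A_zero_integrable(1)[OF r] r
    by (simp add: A_zero_radial_measure A_zero_diff_integrand_def right_diff_distrib)
  moreover have "\<bar>\<integral>s. indicator {r..} s * A_zero_diff_integrand s \<partial>radial_measure\<bar> \<le> (B * L) * b"
  proof (rule int_le_integrable(2)[OF int_le_cmult[OF i]])
    show "\<bar>indicator {r..} s * A_zero_diff_integrand s\<bar> \<le> B * L * F s" for s
      using le[of s] F[of s] B L by (auto split: split_indicator)
  qed (use B L in auto)
  ultimately show ?thesis by simp
qed

text \<open>For s <= 1 both \<open>A_theta\<close> factors are of order s, leaving y^2 / s and x y /
  s. For s > 1 the growth sqrt s is absorbed by s^2, and x / s^2 is split off by Young, which costs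
  s^(-8).\<close>

lemma A_zero_diff_uniform:
  assumes r: "r > 0"
  shows "\<bar>A_zero f r - A_zero h r\<bar> \<le> 20 * B * L\<^sup>2"
proof -
  let ?F = "\<lambda>s. 3 * (y s)\<^sup>2 + 2 * (y s) ^ 6 + 1 * (x s) ^ 4 + 2 * (s powr (-3/2) * indicator {..1} s) + s powr (-15/8) * indicator {..1} s
     + s powr (- 8) * indicator {1..} s"
  have "\<bar>A_zero f r - A_zero h r\<bar> \<le> B * L * (3 * L + 2 * L + 1 * 1 + 2 * (1 / (-3/2 + 2)) + 1 / (-15/8 + 2) + 1 powr (2 - 8) / (8 - 2))"
  proof (rule A_zero_diff_bound[OF r])
    show "int_le ?F (3 * L + 2 * L + 1 * 1 + 2 * (1 / (-3/2 + 2)) + 1 / (-15/8 + 2) + 1 powr (2 - 8) / (8 - 2))"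
      by (intro int_le_add int_le_cmult y2 y6 x4 int_le_powr_near_0 int_le_powr_tail) auto
    fix s assume "s \<ge> r"
    then have s: "s > 0" using r by simp
    have nn: "0 \<le> (y s) ^ 6" "0 \<le> (x s) ^ 4" "0 \<le> (y s)\<^sup>2" "0 \<le> x s * y s" using f.y_nonneg x_nonneg by auto
    show "\<bar>A_zero_diff_integrand s\<bar> \<le> B * L * ?F s"
    proof (cases "s \<le> 1")
      case True
      have "\<bar>A_zero_diff_integrand s\<bar> \<le> ((B * L * s) * (y s)\<^sup>2 + (L * s) * (B * (x s * y s))) / s\<^sup>2"
        by (rule order_trans[OF A_zero_diff_integrand_le[OF s]], intro divide_right_mono add_mono mult_right_mono
             A_theta_diff_linear h.A_theta_bound_linear s) (use B nn in auto)
      also have "\<dots> = B * L * ((y s)\<^sup>2 / s + x s * y s / s)"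
        using s by (simp add: power2_eq_square field_simps)
      also have "\<dots> \<le> B * L * ?F s"
      proof (intro mult_left_mono)
        have "indicator {..1} s = (1::real)" using True by simp
        moreover have "0 \<le> s powr (- 8) * indicator {1..} s" by simp
        ultimately show "(y s)\<^sup>2 / s + x s * y s / s \<le> ?F s"
          using square_over_le[OF s, of "y s"] mult_over_le[OF s, of "x s" "y s"] nn(2,3) by (simp only: mult_1 mult_1_right)
      qed (use B L in auto)
      finally show ?thesis .
    next
      case False
      have s2: "sqrt s \<le> s\<^sup>2"
      proof -
        have "sqrt s \<le> s * 1" using False s by (intro real_le_lsqrt) (auto simp: power2_eq_square)
        also have "\<dots> \<le> s * s" using False s by (intro mult_left_mono) auto
        finally show ?thesis by (simp add: power2_eq_square)
      qed
      have "\<bar>A_zero_diff_integrand s\<bar> \<le> ((2 * B * L * sqrt s) * (y s)\<^sup>2 + L * (B * (x s * y s))) / s\<^sup>2"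
        by (rule order_trans[OF A_zero_diff_integrand_le[OF s]], intro divide_right_mono add_mono mult_right_mono
             A_theta_diff_sqrt h.A_theta_bound s) (use B nn in auto)
      also have "\<dots> = B * L * (2 * (sqrt s / s\<^sup>2) * (y s)\<^sup>2 + (x s / s\<^sup>2) * y s)"
        using s by (simp add: field_simps)
      also have "\<dots> \<le> B * L * ?F s"
      proof (intro mult_left_mono)
        have "2 * (sqrt s / s\<^sup>2) * (y s)\<^sup>2 \<le> 2 * 1 * (y s)\<^sup>2"
          using s s2 by (intro mult_right_mono mult_left_mono) auto
        moreover have "(x s / s\<^sup>2) * y s \<le> (x s / s\<^sup>2)\<^sup>2 + (y s)\<^sup>2" by (rule mult_le_squares)
        moreover have "(x s / s\<^sup>2)\<^sup>2 \<le> (x s) ^ 4 + s powr (- 8)"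
        proof -
          have "(x s / s\<^sup>2)\<^sup>2 = (x s)\<^sup>2 * (1 / s ^ 4)" by (simp add: power_divide power_mult[symmetric])
          also have "\<dots> \<le> ((x s)\<^sup>2)\<^sup>2 + (1 / s ^ 4)\<^sup>2" by (rule mult_le_squares)
          also have "\<dots> = (x s) ^ 4 + s powr (- 8)"
            using s by (simp add: power_mult[symmetric] power_divide powr_minus_divide)
          finally show ?thesis .
        qed
        moreover have "indicator {1..} s = (1::real)" "indicator {..1} s = (0::real)" using False by auto
        ultimately show "2 * (sqrt s / s\<^sup>2) * (y s)\<^sup>2 + (x s / s\<^sup>2) * y s \<le> ?F s"
          using nn(1,3) by (simp only: mult_1 mult_1_right mult_zero_right)
      qed (use B L in auto)
      finally show ?thesis .
    qed
  qed
  \<comment> \<open>The bracket equals 5 L + 13 + 1/6, which is at most 20 L because L >= 1.\<close>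
  also have "\<dots> \<le> B * L * (20 * L)"
    using B L by (intro mult_left_mono) auto
  finally show ?thesis by (simp add: power2_eq_square mult_ac)
qed

text \<open>The square-root bound divided by s^2 gives s^(-3/2), at most r^(-3/2) for s >= r; it
  multiplies y^2, which is integrable. The term with x y / s^2 is brought to the same rate by
  weighted Young inequalities.\<close>

lemma A_zero_diff_tail:
  assumes r: "r \<ge> 1"
  shows "\<bar>A_zero f r - A_zero h r\<bar> \<le> 4 * B * L\<^sup>2 * r powr (-3/2)"
proof -
  define q where "q = r powr (-3/2)"
  have r0: "r > 0" using r by simp
  have q: "q > 0" using r0 by (simp add: q_def)
  \<comment> \<open>The weights are powers of q for which every term integrates to a multiple of q;
    the last one uses r^(-6) = q^4.\<close>
  let ?F = "\<lambda>s. 3 * q * (y s)\<^sup>2 + q / 4 * (x s) ^ 4 + 1 / (4 * q ^ 3) * (s powr (- 8) * indicator {r..} s)"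
  have qq: "r powr (2 - 8) = q ^ 4"
    using powr_realpow_mult[OF r0, of "-3/2" 4] by (simp add: q_def)
  have "\<bar>A_zero f r - A_zero h r\<bar> \<le> B * L * (3 * q * L + q / 4 * 1 + 1 / (4 * q ^ 3) * (r powr (2 - 8) / (8 - 2)))"
  proof (rule A_zero_diff_bound[OF r0])
    show "int_le ?F (3 * q * L + q / 4 * 1 + 1 / (4 * q ^ 3) * (r powr (2 - 8) / (8 - 2)))"
      using q r0 by (intro int_le_add int_le_cmult y2 x4 int_le_powr_tail) auto
    fix s assume sr: "s \<ge> r"
    have s: "s > 0" using r0 sr by simp
    have nn: "0 \<le> (y s)\<^sup>2" "0 \<le> x s * y s" using f.y_nonneg x_nonneg by auto
    have sq: "sqrt s / s\<^sup>2 \<le> q"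
    proof -
      have "sqrt s / s\<^sup>2 = s powr (1/2) * s powr (-2)"
        using s by (simp add: powr_half_sqrt powr_minus_divide)
      also have "\<dots> = s powr (-3/2)" unfolding powr_add[symmetric] by simp
      also have "\<dots> \<le> q" unfolding q_def using sr r0 by (intro powr_mono2') auto
      finally show ?thesis .
    qed
    have "\<bar>A_zero_diff_integrand s\<bar> \<le> ((2 * B * L * sqrt s) * (y s)\<^sup>2 + L * (B * (x s * y s))) / s\<^sup>2"
      by (rule order_trans[OF A_zero_diff_integrand_le[OF s]], intro divide_right_mono add_mono mult_right_mono
           A_theta_diff_sqrt h.A_theta_bound s) (use B nn in auto)
    also have "\<dots> = B * L * (2 * (sqrt s / s\<^sup>2) * (y s)\<^sup>2 + (x s / s\<^sup>2) * y s)"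
      using s by (simp add: field_simps)
    also have "\<dots> \<le> B * L * ?F s"
    proof (intro mult_left_mono)
      define v where "v = x s / s\<^sup>2"
      have 1: "2 * (sqrt s / s\<^sup>2) * (y s)\<^sup>2 \<le> 2 * q * (y s)\<^sup>2"
        using sq by (intro mult_right_mono mult_left_mono) auto
      have "0 \<le> (q * y s - v)\<^sup>2" by simp
      then have 2: "2 * q * (v * y s) \<le> q\<^sup>2 * (y s)\<^sup>2 + v\<^sup>2" by (simp add: power2_diff power_mult_distrib mult_ac)
      have "0 \<le> (q\<^sup>2 * (x s)\<^sup>2 - 1 / s ^ 4)\<^sup>2" by simp
      then have "2 * (q\<^sup>2 * ((x s)\<^sup>2 * (1 / s ^ 4))) \<le> (q\<^sup>2 * (x s)\<^sup>2)\<^sup>2 + (1 / s ^ 4)\<^sup>2" unfolding power2_diff by linarith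
      moreover have "(x s)\<^sup>2 * (1 / s ^ 4) = v\<^sup>2" by (simp add: v_def power_divide power_mult[symmetric])
      moreover have "(q\<^sup>2 * (x s)\<^sup>2)\<^sup>2 = q ^ 4 * (x s) ^ 4" by (simp add: power_mult_distrib power_mult[symmetric])
      moreover have "(1 / s ^ 4)\<^sup>2 = s powr (- 8)"
        using s by (simp add: power_mult[symmetric] power_divide powr_minus_divide)
      ultimately have 3: "2 * (q\<^sup>2 * v\<^sup>2) \<le> q ^ 4 * (x s) ^ 4 + s powr (- 8)" by (simp only:)
      have "q\<^sup>2 * (2 * q * (v * y s)) \<le> q\<^sup>2 * (q\<^sup>2 * (y s)\<^sup>2 + v\<^sup>2)" using 2 by (intro mult_left_mono) auto
      then have "4 * q ^ 3 * (v * y s) \<le> 2 * q ^ 4 * (y s)\<^sup>2 + q ^ 4 * (x s) ^ 4 + s powr (- 8)"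
        using 3 by (simp add: power2_eq_square power3_eq_cube power4_eq_xxxx algebra_simps)
      then have "v * y s \<le> q / 2 * (y s)\<^sup>2 + q / 4 * (x s) ^ 4 + 1 / (4 * q ^ 3) * s powr (- 8)"
        using q by (simp add: field_simps power3_eq_cube power4_eq_xxxx)
      moreover have "q / 2 * (y s)\<^sup>2 \<le> q * (y s)\<^sup>2" using q nn by (intro mult_right_mono) auto
      ultimately show "2 * (sqrt s / s\<^sup>2) * (y s)\<^sup>2 + (x s / s\<^sup>2) * y s \<le> ?F s"
        using 1 sr by (simp add: v_def)
    qed (use B L in auto)
    finally show "\<bar>A_zero_diff_integrand s\<bar> \<le> B * L * ?F s" .
  qed
  also have "3 * q * L + q / 4 * 1 + 1 / (4 * q ^ 3) * (r powr (2 - 8) / (8 - 2)) = q * (3 * L + 7 / 24)"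
    unfolding qq using q by (simp add: field_simps power3_eq_cube power4_eq_xxxx)
  also have "B * L * (q * (3 * L + 7 / 24)) \<le> B * L * (q * (4 * L))"
    using B L q by (intro mult_left_mono) auto
  finally show ?thesis by (simp add: q_def power2_eq_square mult_ac)
qed

end

section \<open>The difference of the nonlinearities in L^(4/3)\<close>

text \<open>Pointwise form of 3/4 = 1/2 + 1/4, by which an L^2 factor times an L^4 factor lies in
  L^(4/3). The cases compare a with b^2, where the two terms balance.\<close>

lemma mult_powr_4_3_le:
  fixes a b :: real
  assumes a: "a \<ge> 0" and b: "b \<ge> 0"
  shows "(a * b) powr (4/3) \<le> a\<^sup>2 + b ^ 4"
proof (cases "a \<le> b\<^sup>2")
  case True
  have "(a * b) powr (4/3) \<le> (b\<^sup>2 * b) powr (4/3)"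
    using True a b by (intro powr_mono2 mult_right_mono) auto
  also have "\<dots> = b ^ 4"
  proof (cases "b = 0")
    case False
    then have "b > 0" using b by simp
    then have "(b\<^sup>2 * b) powr (4/3) = (b powr 3) powr (4/3)"
      by (simp add: power2_eq_square power3_eq_cube)
    also have "\<dots> = b powr 4" by (simp add: powr_powr)
    finally show ?thesis using \<open>b > 0\<close> by simp
  qed simp
  finally show ?thesis using zero_le_power2[of a] by linarith
next
  case False
  then have a0: "a > 0" using zero_le_power2[of b] by linarith
  have "b \<le> a powr (1/2)"
    using False b a by (simp add: powr_half_sqrt real_le_rsqrt)
  then have "(a * b) powr (4/3) \<le> (a * a powr (1/2)) powr (4/3)"
    using a b by (intro powr_mono2 mult_left_mono) auto
  also have "a * a powr (1/2) = a powr (3/2)" using powr_add[of a 1 "1/2"] a0 by simp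
  also have "(a powr (3/2)) powr (4/3) = a\<^sup>2" using a0 by (simp add: powr_powr)
  finally show ?thesis using zero_le_power[OF b, of 4] by linarith
qed

lemma sum3_powr_4_3_le:
  fixes a b c :: real
  assumes "a \<ge> 0" "b \<ge> 0" "c \<ge> 0"
  shows "(a + b + c) powr (4/3) \<le> 9 * (a powr (4/3) + b powr (4/3) + c powr (4/3))"
proof -
  define m where "m = max a (max b c)"
  have m: "m \<ge> 0" using assms by (simp add: m_def)
  have "(a + b + c) powr (4/3) \<le> (3 * m) powr (4/3)"
    using assms by (intro powr_mono2) (auto simp: m_def)
  also have "\<dots> = 3 powr (4/3) * m powr (4/3)" using m by (simp add: powr_mult)
  also have "\<dots> \<le> 9 * m powr (4/3)"
  proof (intro mult_right_mono)
    have "(3::real) powr (4/3) \<le> 3 powr 2" by (intro powr_mono) auto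
    then show "(3::real) powr (4/3) \<le> 9" by simp
  qed simp
  also have "m powr (4/3) \<le> a powr (4/3) + b powr (4/3) + c powr (4/3)"
    by (auto simp: m_def max_def)
  finally show ?thesis by simp
qed

context profile_pair
begin

lemma A_zero_diff_decay:
  assumes r: "r > 0"
  shows "\<bar>A_zero f r - A_zero h r\<bar> \<le> 20 * B * L\<^sup>2 * decay r"
proof (cases "r \<le> 1")
  case False
  have "\<bar>A_zero f r - A_zero h r\<bar> \<le> 4 * B * L\<^sup>2 * decay r"
    using A_zero_diff_tail[of r] False by (simp add: decay_def)
  also have "\<dots> \<le> 20 * B * L\<^sup>2 * decay r" using B by (intro mult_right_mono decay_bounds) auto
  finally show ?thesis .
qed (use A_zero_diff_uniform[OF r] in \<open>simp add: decay_def\<close>)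

lemma A_theta_square_diff_decay:
  assumes r: "r > 0"
  shows "\<bar>(A_theta f r)\<^sup>2 / r\<^sup>2 - (A_theta h r)\<^sup>2 / r\<^sup>2\<bar> \<le> 4 * B * L\<^sup>2 * decay r"
proof -
  have eq: "\<bar>(A_theta f r)\<^sup>2 / r\<^sup>2 - (A_theta h r)\<^sup>2 / r\<^sup>2\<bar> = \<bar>A_theta f r - A_theta h r\<bar> * \<bar>A_theta f r + A_theta h r\<bar> / r\<^sup>2"
    by (simp add: abs_mult[symmetric] diff_divide_distrib[symmetric] power2_eq_square algebra_simps)
  show ?thesis
  proof (cases "r \<le> 1")
    case True
    have "\<bar>A_theta f r + A_theta h r\<bar> \<le> 2 * L * r"
      using f.A_theta_bound_linear[OF r] h.A_theta_bound_linear[OF r] by linarith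
    then have "\<bar>A_theta f r - A_theta h r\<bar> * \<bar>A_theta f r + A_theta h r\<bar> / r\<^sup>2 \<le> (B * L * r) * (2 * L * r) / r\<^sup>2"
      using B L r by (intro divide_right_mono mult_mono A_theta_diff_linear) auto
    also have "\<dots> = 2 * B * L\<^sup>2" using r by (simp add: power2_eq_square)
    also have "\<dots> \<le> 4 * B * L\<^sup>2 * decay r" using B True by (simp add: decay_def mult_right_mono)
    finally show ?thesis unfolding eq .
  next
    case False
    have "\<bar>A_theta f r + A_theta h r\<bar> \<le> 2 * L"
      using f.A_theta_bound[of r] h.A_theta_bound[of r] by linarith
    then have "\<bar>A_theta f r - A_theta h r\<bar> * \<bar>A_theta f r + A_theta h r\<bar> / r\<^sup>2 \<le> (2 * B * L * sqrt r) * (2 * L) / r\<^sup>2"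
      using B L r by (intro divide_right_mono mult_mono A_theta_diff_sqrt) auto
    also have "\<dots> = 4 * B * L\<^sup>2 * (r powr (1/2) * r powr (-2))"
      using r by (simp add: powr_half_sqrt powr_minus_divide power2_eq_square)
    also have "r powr (1/2) * r powr (-2) = r powr (-3/2)" unfolding powr_add[symmetric] by simp
    finally show ?thesis unfolding eq using False by (simp add: decay_def)
  qed
qed

text \<open>The coefficient 24 L^2 collects 20 L^2 and 4 L^2 from the differences of the two
  potentials, and 2 |g| comes from the two summands of the cubic term.\<close>

lemma css_nonlinearity_diff_le:
  assumes r: "r > 0"
  shows "cmod (css_nonlinearity g f r - css_nonlinearity g h r)
     \<le> B * (24 * L\<^sup>2 + 2 * \<bar>g\<bar>) * (decay r * x r + y r * decay r + (y r)\<^sup>2 * x r)"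
proof -
  let ?u = "decay r"
  note nn = f.y_nonneg[of r] x_nonneg[of r] decay_bounds(1)[of r]
  have hy: "cmod (h r) \<le> y r" and fy: "cmod (f r) \<le> y r" by (rule h.f_le, rule f.f_le)
  \<comment> \<open>Telescoping: each of the three products is changed one factor at a time, so
    every summand contains exactly one difference.\<close>
  have "css_nonlinearity g f r - css_nonlinearity g h r
    = of_real (A_zero f r) * (f r - h r) + of_real (A_zero f r - A_zero h r) * h r
      + of_real ((A_theta f r)\<^sup>2 / r\<^sup>2) * (f r - h r) + of_real ((A_theta f r)\<^sup>2 / r\<^sup>2 - (A_theta h r)\<^sup>2 / r\<^sup>2) * h r
      + (of_real (- g * (cmod (f r))\<^sup>2) * (f r - h r) + of_real (- g * ((cmod (f r))\<^sup>2 - (cmod (h r))\<^sup>2)) * h r)"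
    by (simp add: css_nonlinearity_def algebra_simps add_divide_distrib diff_divide_distrib)
  then have "cmod (css_nonlinearity g f r - css_nonlinearity g h r)
    \<le> cmod (of_real (A_zero f r) * (f r - h r)) + cmod (of_real (A_zero f r - A_zero h r) * h r)
      + cmod (of_real ((A_theta f r)\<^sup>2 / r\<^sup>2) * (f r - h r)) + cmod (of_real ((A_theta f r)\<^sup>2 / r\<^sup>2 - (A_theta h r)\<^sup>2 / r\<^sup>2) * h r)
      + (cmod (of_real (- g * (cmod (f r))\<^sup>2) * (f r - h r)) + cmod (of_real (- g * ((cmod (f r))\<^sup>2 - (cmod (h r))\<^sup>2)) * h r))"
    by (simp only:) (intro order_trans[OF norm_triangle_ineq] add_mono order_refl)
  also have "\<dots> = \<bar>A_zero f r\<bar> * cmod (f r - h r) + \<bar>A_zero f r - A_zero h r\<bar> * cmod (h r)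
      + (A_theta f r)\<^sup>2 / r\<^sup>2 * cmod (f r - h r) + \<bar>(A_theta f r)\<^sup>2 / r\<^sup>2 - (A_theta h r)\<^sup>2 / r\<^sup>2\<bar> * cmod (h r)
      + (\<bar>g\<bar> * ((cmod (f r))\<^sup>2 * cmod (f r - h r)) + \<bar>g\<bar> * (\<bar>(cmod (f r))\<^sup>2 - (cmod (h r))\<^sup>2\<bar> * cmod (h r)))"
    by (simp only: norm_mult norm_of_real abs_mult abs_minus_cancel) (simp add: abs_mult mult.assoc)
  also have "\<dots> \<le> (4 * L\<^sup>2 * ?u) * (B * x r) + (20 * B * L\<^sup>2 * ?u) * y r
      + (L\<^sup>2 * ?u) * (B * x r) + (4 * B * L\<^sup>2 * ?u) * y r
      + (\<bar>g\<bar> * ((y r)\<^sup>2 * (B * x r)) + \<bar>g\<bar> * ((B * (x r * y r)) * y r))"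
    using B nn by (intro add_mono mult_mono f.A_zero_decay A_zero_diff_decay f.A_theta_decay A_theta_square_diff_decay
          diff_le hy f.f_square_le square_diff_le order_refl r) auto
  also have "\<dots> = B * (5 * L\<^sup>2 * (?u * x r) + 24 * L\<^sup>2 * (y r * ?u) + 2 * \<bar>g\<bar> * ((y r)\<^sup>2 * x r))"
    by (simp add: algebra_simps power2_eq_square)
  also have "\<dots> \<le> B * ((24 * L\<^sup>2 + 2 * \<bar>g\<bar>) * (?u * x r) + (24 * L\<^sup>2 + 2 * \<bar>g\<bar>) * (y r * ?u) + (24 * L\<^sup>2 + 2 * \<bar>g\<bar>) * ((y r)\<^sup>2 * x r))"
    using B nn by (intro mult_left_mono add_mono mult_right_mono) auto
  finally show ?thesis by (simp add: algebra_simps)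
qed

text \<open>Each product pairs an L^2 factor with an L^4 factor: \<open>decay\<close> with
  \<open>x\<close>, \<open>y\<close> with \<open>decay\<close>, and y^2 with \<open>x\<close>. The
  constant 63 is 9 times 7, from \<open>sum3_powr_4_3_le\<close> and 2 L + 5 <= 7 L.\<close>

lemma css_nonlinearity_diff_int:
  "int_le (\<lambda>r. cmod (css_nonlinearity g f r - css_nonlinearity g h r) powr (4/3))
     (63 * L * (B * (24 * L\<^sup>2 + 2 * \<bar>g\<bar>)) powr (4/3))"
proof -
  define K where "K = B * (24 * L\<^sup>2 + 2 * \<bar>g\<bar>)"
  have K: "K \<ge> 0" using B by (simp add: K_def)
  define c where "c = K powr (4/3) * 9"
  have i: "int_le (\<lambda>s. c * (((decay s)\<^sup>2 + x s ^ 4) + ((y s)\<^sup>2 + (decay s)\<^sup>2) + (y s ^ 4 + x s ^ 4)))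
     (c * ((3/2 + 1) + (L + 3/2) + (L + 1)))"
    unfolding c_def by (intro int_le_cmult int_le_add int_le_decay x4 y2 y4) auto
  have "int_le (\<lambda>r. cmod (css_nonlinearity g f r - css_nonlinearity g h r) powr (4/3)) (c * ((3/2 + 1) + (L + 3/2) + (L + 1)))"
  proof (rule int_le_mono[OF i])
    fix r :: real assume r: "r > 0"
    note nn = f.y_nonneg[of r] x_nonneg[of r] decay_bounds(1)[of r]
    let ?a = "decay r * x r" and ?b = "y r * decay r" and ?c = "(y r)\<^sup>2 * x r"
    have "cmod (css_nonlinearity g f r - css_nonlinearity g h r) powr (4/3) \<le> (K * (?a + ?b + ?c)) powr (4/3)"
      unfolding K_def by (intro powr_mono2 css_nonlinearity_diff_le r) auto
    also have "\<dots> = K powr (4/3) * (?a + ?b + ?c) powr (4/3)"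
      by (rule powr_mult)
    also have "\<dots> \<le> K powr (4/3) * (9 * (?a powr (4/3) + ?b powr (4/3) + ?c powr (4/3)))"
      using nn by (intro mult_left_mono sum3_powr_4_3_le) auto
    also have "\<dots> \<le> K powr (4/3) * (9 * (((decay r)\<^sup>2 + x r ^ 4) + ((y r)\<^sup>2 + (decay r) ^ 4) + (((y r)\<^sup>2)\<^sup>2 + x r ^ 4)))"
      using nn by (intro mult_left_mono add_mono mult_powr_4_3_le) auto
    also have "\<dots> \<le> K powr (4/3) * (9 * (((decay r)\<^sup>2 + x r ^ 4) + ((y r)\<^sup>2 + (decay r)\<^sup>2) + (y r ^ 4 + x r ^ 4)))"
    proof (intro mult_left_mono add_mono order_refl)
      show "(decay r) ^ 4 \<le> (decay r)\<^sup>2" using decay_bounds[of r] by (simp add: power_decreasing)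
    qed (auto simp: power_mult[symmetric])
    finally show "cmod (css_nonlinearity g f r - css_nonlinearity g h r) powr (4/3)
       \<le> c * (((decay r)\<^sup>2 + x r ^ 4) + ((y r)\<^sup>2 + (decay r)\<^sup>2) + (y r ^ 4 + x r ^ 4))"
      by (simp add: c_def mult.assoc)
  qed auto
  then show ?thesis
  proof (rule int_le_weaken)
    have "c * ((3/2 + 1) + (L + 3/2) + (L + 1)) \<le> c * (7 * L)"
      using L by (intro mult_left_mono) (auto simp: c_def)
    then show "c * ((3/2 + 1) + (L + 3/2) + (L + 1)) \<le> 63 * L * (B * (24 * L\<^sup>2 + 2 * \<bar>g\<bar>)) powr (4/3)"
      by (simp add: c_def K_def mult_ac)
  qed
qed

end

section \<open>Uniqueness\<close>

text \<open>Measurability of \<open>radial f\<close> says nothing about \<open>f\<close> at negative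
  arguments. Composing with the absolute value gives a profile that is Borel on all of
  \<open>real\<close> without changing the potentials at nonnegative radii.\<close>

lemma A_theta_abs: "A_theta (\<lambda>s. f \<bar>s\<bar>) r = A_theta f r"
  unfolding A_theta_def set_lebesgue_integral_def
  by (intro arg_cong[where f="\<lambda>i. - (1/2) * i"] Bochner_Integration.integral_cong) (auto split: split_indicator)

lemma A_zero_abs: "r \<ge> 0 \<Longrightarrow> A_zero (\<lambda>s. f \<bar>s\<bar>) r = A_zero f r"
  unfolding A_zero_def set_lebesgue_integral_def
  by (intro arg_cong[where f=uminus] Bochner_Integration.integral_cong) (auto split: split_indicator simp: A_theta_abs)

lemma radial_css_nonlinearity_abs:
  "radial (css_nonlinearity g f) = (\<lambda>x. css_nonlinearity g (\<lambda>s. f \<bar>s\<bar>) (norm x))"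
  by (simp add: radial_def css_nonlinearity_def A_theta_abs A_zero_abs fun_eq_iff)

lemma profile_abs_measurable:
  assumes "radial f \<in> borel_measurable borel"
  shows "(\<lambda>s. f \<bar>s\<bar>) \<in> borel_measurable borel"
proof -
  have "(\<lambda>s. radial f (s *\<^sub>R axis 1 1)) \<in> borel_measurable borel"
    by (rule measurable_compose[OF _ assms]) measurable
  then show ?thesis by (simp add: radial_def norm_axis_1)
qed

lemma int_le_plane:
  assumes "int_le F b"
  shows "(\<integral>\<^sup>+x. ennreal (F (norm (x::plane))) \<partial>lborel) \<le> ennreal (2 * pi * b)"
proof -
  have [measurable]: "F \<in> borel_measurable borel" using assms by (simp add: int_le_def)
  have "(\<integral>\<^sup>+x. ennreal (F (norm (x::plane))) \<partial>lborel) = ennreal (2 * pi) * (\<integral>\<^sup>+s. ennreal (F s) \<partial>radial_measure)"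
    by (rule nn_integral_norm_plane) measurable
  also have "\<dots> \<le> ennreal (2 * pi) * ennreal b"
    using assms by (intro mult_left_mono) (auto simp: int_le_def)
  finally show ?thesis by (simp add: ennreal_mult')
qed

lemma int_le_from_plane:
  assumes [measurable]: "F \<in> borel_measurable borel" and F: "\<And>s. F s \<ge> 0" and b: "b \<ge> 0"
    and le: "(\<integral>\<^sup>+x. ennreal (F (norm (x::plane))) \<partial>lborel) \<le> ennreal (2 * pi * b)"
  shows "int_le F b"
proof -
  let ?I = "\<integral>\<^sup>+s. ennreal (F s) \<partial>radial_measure"
  have "ennreal (2 * pi) * ?I \<le> ennreal (2 * pi * b)"
    using le by (subst (asm) nn_integral_norm_plane) auto
  then have "ennreal (1 / (2 * pi)) * (ennreal (2 * pi) * ?I) \<le> ennreal (1 / (2 * pi)) * ennreal (2 * pi * b)"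
    by (rule mult_left_mono) simp
  moreover have "ennreal (1 / (2 * pi)) * (ennreal (2 * pi) * ?I) = ?I"
    by (simp add: mult.assoc[symmetric] ennreal_mult'[symmetric])
  moreover have "ennreal (1 / (2 * pi)) * ennreal (2 * pi * b) = ennreal b"
    by (simp add: ennreal_mult'[symmetric])
  ultimately show ?thesis using F b by (simp add: int_le_def)
qed

text \<open>\<open>M\<close> depends on \<open>C\<close> alone, so one constant will serve at almost
  every time.\<close>

lemma sobolev_profile:
  "\<exists>M\<ge>1. \<forall>f. radial f \<in> sobolev (2/3) \<longrightarrow> sobolev_norm (2/3) (radial f) \<le> C \<longrightarrow>
     int_le (\<lambda>s. (cmod (f \<bar>s\<bar>))\<^sup>2) M \<and> int_le (\<lambda>s. cmod (f \<bar>s\<bar>) ^ 6) M"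
proof -
  \<comment> \<open>The added 1 keeps \<open>N\<close> positive, as \<open>sobolev_L6\<close>
    requires, even for C = 0.\<close>
  define N where "N = C\<^sup>2 + 1"
  have N: "N > 0" by (simp add: N_def add_nonneg_pos)
  define M where "M = 1 + N + 96 * (3 * N / (4 * pi))\<^sup>2 * N"
  have M: "M \<ge> 1" "N \<le> M" "96 * (3 * N / (4 * pi))\<^sup>2 * N \<le> M" using N by (auto simp: M_def)
  have "int_le (\<lambda>s. (cmod (f \<bar>s\<bar>))\<^sup>2) M \<and> int_le (\<lambda>s. cmod (f \<bar>s\<bar>) ^ 6) M"
    if S: "radial f \<in> sobolev (2/3)" and C: "sobolev_norm (2/3) (radial f) \<le> C" for f
  proof -
    have fL: "radial f \<in> L2" using S by (simp add: sobolev_def)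
    have [measurable]: "(\<lambda>s. f \<bar>s\<bar>) \<in> borel_measurable borel"
      using fL by (intro profile_abs_measurable L2_measurable)
    let ?w = "\<lambda>\<xi>::plane. (1 + (norm \<xi>)\<^sup>2) powr (2/3) * (cmod (fourier (radial f) \<xi>))\<^sup>2"
    have wi: "integrable lborel ?w" using S by (simp add: sobolev_def)
    have w0: "0 \<le> (\<integral>\<xi>. ?w \<xi> \<partial>lborel)" by (rule integral_nonneg_AE) simp
    have "sqrt (\<integral>\<xi>. ?w \<xi> \<partial>lborel) \<le> C" using C by (simp add: sobolev_norm_def)
    then have "(sqrt (\<integral>\<xi>. ?w \<xi> \<partial>lborel))\<^sup>2 \<le> C\<^sup>2" using w0 by (intro power_mono) auto
    then have wN: "(\<integral>\<xi>. ?w \<xi> \<partial>lborel) \<le> N" using w0 by (simp add: N_def)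
    have pm: "M \<le> 2 * pi * M" using M(1) pi_ge_two by (simp add: mult_le_cancel_right1)
    have "(L2_norm (radial f))\<^sup>2 = (\<integral>\<xi>. (cmod (fourier (radial f) \<xi>))\<^sup>2 \<partial>lborel)"
      using Plancherel[OF has_fourier_fourier[OF fL]] by (simp add: L2_norm_power2[symmetric])
    also have "\<dots> \<le> (\<integral>\<xi>. ?w \<xi> \<partial>lborel)"
    proof (rule integral_mono'[OF wi])
      fix \<xi> :: plane
      have "1 \<le> (1 + (norm \<xi>)\<^sup>2) powr (2/3)" by (intro ge_one_powr_ge_zero) auto
      then show "(cmod (fourier (radial f) \<xi>))\<^sup>2 \<le> ?w \<xi>" by (simp add: mult_le_cancel_right1)
    qed simp
    finally have n2: "(L2_norm (radial f))\<^sup>2 \<le> 2 * pi * M" using wN M pm by linarith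
    have "(\<integral>\<^sup>+x. ennreal ((cmod (f \<bar>norm (x::plane)\<bar>))\<^sup>2) \<partial>lborel) \<le> ennreal (2 * pi * M)"
      using L2_norm_nn_integral[OF fL] ennreal_leI[OF n2] by (simp add: radial_def)
    then have 1: "int_le (\<lambda>s. (cmod (f \<bar>s\<bar>))\<^sup>2) M"
      using M by (intro int_le_from_plane) auto
    have "(\<integral>\<^sup>+x. ennreal (cmod (radial f x) ^ 6) \<partial>lborel) \<le> ennreal (96 * (3 * N / (4 * pi))\<^sup>2 * N)"
      by (rule sobolev_L6[OF S wN N])
    also have "\<dots> \<le> ennreal (2 * pi * M)" using M pm by (intro ennreal_leI) linarith
    finally have "(\<integral>\<^sup>+x. ennreal (cmod (f \<bar>norm (x::plane)\<bar>) ^ 6) \<partial>lborel) \<le> ennreal (2 * pi * M)"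
      by (simp add: radial_def)
    then have "int_le (\<lambda>s. cmod (f \<bar>s\<bar>) ^ 6) M"
      using M by (intro int_le_from_plane) auto
    with 1 show ?thesis by blast
  qed
  then show ?thesis using M(1) by blast
qed

text \<open>The constants are 4 for the square, 2^6 + 2^6 = 128 for the sixth power, and their sum
  132 for the fourth, which follows from y^4 <= y^2 + y^6.\<close>

lemma profile_sum_bounds:
  assumes [measurable]: "f \<in> borel_measurable borel" "h \<in> borel_measurable borel"
    and M: "M \<ge> 1"
    and f2: "int_le (\<lambda>s. (cmod (f s))\<^sup>2) M" and f6: "int_le (\<lambda>s. cmod (f s) ^ 6) M"
    and h2: "int_le (\<lambda>s. (cmod (h s))\<^sup>2) M" and h6: "int_le (\<lambda>s. cmod (h s) ^ 6) M"
  shows "int_le (\<lambda>s. (cmod (f s) + cmod (h s))\<^sup>2) (132 * M)"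
    and "int_le (\<lambda>s. (cmod (f s) + cmod (h s)) ^ 4) (132 * M)"
    and "int_le (\<lambda>s. (cmod (f s) + cmod (h s)) ^ 6) (132 * M)"
proof -
  let ?y = "\<lambda>s. cmod (f s) + cmod (h s)"
  have y2: "int_le (\<lambda>s. (?y s)\<^sup>2) (4 * M)"
  proof (rule int_le_mono)
    show "int_le (\<lambda>s. 2 * (cmod (f s))\<^sup>2 + 2 * (cmod (h s))\<^sup>2) (4 * M)"
      using int_le_add[OF int_le_cmult[OF f2, of 2] int_le_cmult[OF h2, of 2]] by simp
    show "(?y s)\<^sup>2 \<le> 2 * (cmod (f s))\<^sup>2 + 2 * (cmod (h s))\<^sup>2" for s
      using sum_squares_bound[of "cmod (f s)" "cmod (h s)"] by (simp add: power2_sum)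
  qed auto
  have y6: "int_le (\<lambda>s. (?y s) ^ 6) (128 * M)"
  proof (rule int_le_mono)
    show "int_le (\<lambda>s. 64 * cmod (f s) ^ 6 + 64 * cmod (h s) ^ 6) (128 * M)"
      using int_le_add[OF int_le_cmult[OF f6, of 64] int_le_cmult[OF h6, of 64]] by simp
    fix s
    let ?m = "max (cmod (f s)) (cmod (h s))"
    have "(?y s) ^ 6 \<le> (2 * ?m) ^ 6" by (intro power_mono) auto
    also have "\<dots> = 64 * ?m ^ 6" by (simp add: power_mult_distrib)
    also have "\<dots> \<le> 64 * (cmod (f s) ^ 6 + cmod (h s) ^ 6)" by (intro mult_left_mono) (auto simp: max_def)
    finally show "(?y s) ^ 6 \<le> 64 * cmod (f s) ^ 6 + 64 * cmod (h s) ^ 6" by simp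
  qed auto
  show "int_le (\<lambda>s. (?y s)\<^sup>2) (132 * M)" by (rule int_le_weaken[OF y2]) (use M in simp)
  show "int_le (\<lambda>s. (?y s) ^ 6) (132 * M)" by (rule int_le_weaken[OF y6]) (use M in simp)
  have "int_le (\<lambda>s. (?y s) ^ 4) (4 * M + 128 * M)"
  proof (rule int_le_mono[OF int_le_add[OF y2 y6]])
    fix s
    have "?y s * ?y s ^ 3 \<le> (?y s)\<^sup>2 + (?y s ^ 3)\<^sup>2" by (rule mult_le_squares)
    also have "?y s * ?y s ^ 3 = ?y s ^ 4" by (simp add: power4_eq_xxxx power3_eq_cube)
    also have "(?y s ^ 3)\<^sup>2 = ?y s ^ 6" by (simp add: power_mult[symmetric])
    finally show "(?y s) ^ 4 \<le> (?y s)\<^sup>2 + (?y s) ^ 6" .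
  qed auto
  then show "int_le (\<lambda>s. (?y s) ^ 4) (132 * M)" by simp
qed

lemma profile_pairI:
  assumes m: "f \<in> borel_measurable borel" "h \<in> borel_measurable borel"
    and M: "M \<ge> 1"
    and "int_le (\<lambda>s. (cmod (f s))\<^sup>2) M" "int_le (\<lambda>s. cmod (f s) ^ 6) M"
    and "int_le (\<lambda>s. (cmod (h s))\<^sup>2) M" "int_le (\<lambda>s. cmod (h s) ^ 6) M"
    and B: "B > 0" and d: "int_le (\<lambda>s. cmod (f s - h s) ^ 4) (B ^ 4)"
  shows "profile_pair f h (\<lambda>s. cmod (f s - h s) / B) (\<lambda>s. cmod (f s) + cmod (h s)) B (132 * M)"
proof
  have "int_le (\<lambda>s. (1 / B ^ 4) * cmod (f s - h s) ^ 4) ((1 / B ^ 4) * B ^ 4)"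
    using B by (intro int_le_cmult d) auto
  then show "int_le (\<lambda>s. (cmod (f s - h s) / B) ^ 4) 1"
    using B by (simp add: power_divide)
qed (use M B m profile_sum_bounds[OF assms(1-7)] in auto)

text \<open>\<open>free_propagator\<close> chooses a representative for each function and is not
  literally linear. The difference of two choices still has the right transform, and this is what
  \<open>dispersive_L4\<close> asks for.\<close>

lemma free_propagator_diff_L4:
  assumes f: "f1 \<in> L2" "f2 \<in> L2" and t: "t \<noteq> 0"
    and S: "(\<integral>\<^sup>+x. ennreal (cmod (f1 x - f2 x) powr (4/3)) \<partial>lborel) \<le> ennreal S" "S > 0"
  shows "(\<integral>\<^sup>+x. ennreal (cmod (free_propagator t f1 x - free_propagator t f2 x) ^ 4) \<partial>lborel)
     \<le> ennreal (32 * (1 / (4 * pi * \<bar>t\<bar>))\<^sup>2 * S ^ 3)"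
proof (rule dispersive_L4[OF has_fourier_diff[OF f[THEN has_fourier_fourier]] t _ S])
  show "has_fourier (\<lambda>x. free_propagator t f1 x - free_propagator t f2 x)
     (\<lambda>\<xi>. cis (- t * (norm \<xi>)\<^sup>2) * (fourier f1 \<xi> - fourier f2 \<xi>))"
    using has_fourier_diff[OF f[THEN has_fourier_free_propagator[where t=t]]] by (simp add: right_diff_distrib)
qed

text \<open>Hoelder with exponents 4 and 4/3 by two applications of Cauchy-Schwarz, to |u|^2 times
  |w|^2 and to |u| |w| times |w|^2.\<close>

lemma L4_duality_bound:
  fixes u w :: "plane \<Rightarrow> complex"
  assumes [measurable]: "u \<in> borel_measurable borel" "w \<in> borel_measurable borel"
    and P: "(\<integral>\<^sup>+x. ennreal (cmod (u x) ^ 4) \<partial>lborel) \<le> ennreal (P ^ 4)" "P \<ge> 0"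
    and Q: "(\<integral>\<^sup>+x. ennreal (cmod (w x) ^ 4) \<partial>lborel) \<le> ennreal (Q ^ 4)" "Q \<ge> 0"
  shows "cmod (L2_inner u (\<lambda>x. of_real ((cmod (w x))\<^sup>2) * w x)) \<le> P * Q ^ 3"
proof -
  let ?u = "\<lambda>x. ennreal (cmod (u x))" and ?w = "\<lambda>x. ennreal (cmod (w x))"
  have u4: "(\<integral>\<^sup>+x. (?u x ^ 2) ^ 2 \<partial>lborel) \<le> ennreal (P ^ 4)"
    using P by (simp add: ennreal_power power_mult[symmetric])
  have w4: "(\<integral>\<^sup>+x. (?w x ^ 2) ^ 2 \<partial>lborel) \<le> ennreal (Q ^ 4)"
    using Q by (simp add: ennreal_power power_mult[symmetric])
  have "(\<integral>\<^sup>+x. ?u x ^ 2 * ?w x ^ 2 \<partial>lborel)\<^sup>2 \<le> (\<integral>\<^sup>+x. (?u x ^ 2) ^ 2 \<partial>lborel) * (\<integral>\<^sup>+x. (?w x ^ 2) ^ 2 \<partial>lborel)"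
    by (rule Cauchy_Schwarz_nn_integral) measurable
  also have "\<dots> \<le> ennreal (P ^ 4) * ennreal (Q ^ 4)" by (intro mult_mono u4 w4) auto
  also have "\<dots> = ennreal (P\<^sup>2 * Q\<^sup>2) ^ 2"
    by (simp add: ennreal_mult[symmetric] ennreal_power power_mult_distrib power_mult[symmetric])
  finally have 1: "(\<integral>\<^sup>+x. ?u x ^ 2 * ?w x ^ 2 \<partial>lborel) \<le> ennreal (P\<^sup>2 * Q\<^sup>2)"
    by (rule ennreal_power2_le_imp_le) simp
  have "(\<integral>\<^sup>+x. (?u x * ?w x) * ?w x ^ 2 \<partial>lborel)\<^sup>2 \<le> (\<integral>\<^sup>+x. (?u x * ?w x) ^ 2 \<partial>lborel) * (\<integral>\<^sup>+x. (?w x ^ 2) ^ 2 \<partial>lborel)"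
    by (rule Cauchy_Schwarz_nn_integral) measurable
  also have "\<dots> \<le> ennreal (P\<^sup>2 * Q\<^sup>2) * ennreal (Q ^ 4)"
    using 1 by (intro mult_mono w4) (auto simp: power_mult_distrib)
  also have "\<dots> = ennreal (P * Q ^ 3) ^ 2"
    using P Q by (simp add: ennreal_mult[symmetric] ennreal_power power_mult_distrib power_mult[symmetric] power_add[symmetric] mult.assoc)
  finally have 2: "(\<integral>\<^sup>+x. (?u x * ?w x) * ?w x ^ 2 \<partial>lborel) \<le> ennreal (P * Q ^ 3)"
    by (rule ennreal_power2_le_imp_le) (use P Q in simp)
  have "ennreal (cmod (L2_inner u (\<lambda>x. of_real ((cmod (w x))\<^sup>2) * w x)))
     \<le> (\<integral>\<^sup>+x. ennreal (cmod (u x * cnj (of_real ((cmod (w x))\<^sup>2) * w x))) \<partial>lborel)"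
    unfolding L2_inner_def by (rule integral_norm_le_nn_integral)
  also have "\<dots> = (\<integral>\<^sup>+x. (?u x * ?w x) * ?w x ^ 2 \<partial>lborel)"
    by (intro nn_integral_cong) (simp add: norm_mult norm_power ennreal_mult ennreal_power mult_ac)
  finally show ?thesis using 2 P Q by (meson ennreal_le_iff mult_nonneg_nonneg order_trans zero_le_power)
qed

section \<open>The weighted contraction\<close>

text \<open>Dominated convergence with the majorant s^(-1/2), integrable on [0, T]. A weight exp (n
  t) with large n makes the Duhamel map contract on the whole interval at once, with no restarting
  on short intervals.\<close>

lemma exp_sqrt_kernel_small:
  assumes T: "T > 0" and e: "e > 0"
  shows "\<exists>n::nat. (\<integral>\<^sup>+s. ennreal (exp (- (real n * s)) * s powr (-1/2)) * indicator {0..T} s \<partial>lborel) \<le> ennreal e"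
proof -
  have "(\<lambda>n. \<integral>\<^sup>+s. ennreal (exp (- (real n * s)) * s powr (-1/2)) * indicator {0..T} s \<partial>lborel) \<longlonglongrightarrow> (\<integral>\<^sup>+s. 0 \<partial>(lborel :: real measure))"
  proof (rule nn_integral_dominated_convergence)
    show "(\<integral>\<^sup>+s. ennreal (s powr (-1/2)) * indicator {0..T} s \<partial>lborel) < \<infinity>"
      using nn_integral_powr_from_0[of "-1/2" T] T by simp
    show "AE s in lborel. ennreal (exp (- (real n * s)) * s powr (-1/2)) * indicator {0..T} s \<le> ennreal (s powr (-1/2)) * indicator {0..T} s" for n
      by (intro AE_I2) (auto intro!: ennreal_leI mult_left_le_one_le split: split_indicator)
    show "AE s in lborel. (\<lambda>n. ennreal (exp (- (real n * s)) * s powr (-1/2)) * indicator {0..T} s) \<longlonglongrightarrow> 0"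
    proof (rule AE_I2)
      fix s :: real
      show "(\<lambda>n. ennreal (exp (- (real n * s)) * s powr (-1/2)) * indicator {0..T} s) \<longlonglongrightarrow> 0"
      proof (cases "s > 0 \<and> s \<le> T")
        case True
        have "(\<lambda>n. exp (- s) ^ n * s powr (-1/2)) \<longlonglongrightarrow> 0 * s powr (-1/2)"
          using True by (intro tendsto_mult LIMSEQ_power_zero tendsto_const) auto
        moreover have "exp (- s) ^ n = exp (- (real n * s))" for n
          by (simp add: exp_of_nat_mult[symmetric])
        ultimately have "(\<lambda>n. ennreal (exp (- (real n * s)) * s powr (-1/2))) \<longlonglongrightarrow> ennreal 0"
          by (intro tendsto_ennrealI) simp
        then show ?thesis using True by simp
      next
        case False
        then have "s = 0 \<or> s < 0 \<or> s > T" by auto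
        then show ?thesis by auto
      qed
    qed
  qed auto
  then have "\<forall>\<^sub>F n in sequentially. (\<integral>\<^sup>+s. ennreal (exp (- (real n * s)) * s powr (-1/2)) * indicator {0..T} s \<partial>lborel) < ennreal e"
    using e by (intro order_tendstoD(2)) auto
  then show ?thesis by (auto simp: eventually_sequentially intro: less_imp_le)
qed

text \<open>The fourth root of 32 / (4 pi)^2 = 2 / pi^2, from \<open>dispersive_L4\<close>, times
  the cube of the L^(4/3) constant in the plane for B = 1.\<close>

definition duhamel_const :: "real \<Rightarrow> real \<Rightarrow> real" where
  "duhamel_const g M = (let L = 132 * M in
     (2 / pi\<^sup>2 * (2 * pi * (63 * L * (24 * L\<^sup>2 + 2 * \<bar>g\<bar>) powr (4/3))) ^ 3) powr (1/4))"

definition controlled :: "real \<Rightarrow> (real \<Rightarrow> complex) \<Rightarrow> bool" where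
  "controlled M f \<longleftrightarrow> radial f \<in> L2 \<and>
     int_le (\<lambda>s. (cmod (f \<bar>s\<bar>))\<^sup>2) M \<and> int_le (\<lambda>s. cmod (f \<bar>s\<bar>) ^ 6) M"

text \<open>The fourth power keeps \<open>B\<close> on the scale of the norm, so it can halve along
  with it. As the integral is radial, \<open>B\<close> bounds the L^4 norm in the plane up to the
  factor (2 pi)^(1/4).\<close>

definition L4_close :: "real \<Rightarrow> (real \<Rightarrow> complex) \<Rightarrow> (real \<Rightarrow> complex) \<Rightarrow> bool" where
  "L4_close B f h \<longleftrightarrow> int_le (\<lambda>s. cmod (f \<bar>s\<bar> - h \<bar>s\<bar>) ^ 4) (B ^ 4)"

lemma controlled_measurable: "controlled M f \<Longrightarrow> (\<lambda>s. f \<bar>s\<bar>) \<in> borel_measurable borel"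
  by (auto simp: controlled_def intro!: profile_abs_measurable L2_measurable)

lemma controlled_profile_pair:
  assumes "controlled M f" "controlled M h" "L4_close B f h" "M \<ge> 1" "B > 0"
  shows "profile_pair (\<lambda>s. f \<bar>s\<bar>) (\<lambda>s. h \<bar>s\<bar>) (\<lambda>s. cmod (f \<bar>s\<bar> - h \<bar>s\<bar>) / B) (\<lambda>s. cmod (f \<bar>s\<bar>) + cmod (h \<bar>s\<bar>)) B (132 * M)"
  using assms controlled_measurable[OF assms(1)] controlled_measurable[OF assms(2)]
  by (intro profile_pairI) (auto simp: controlled_def L4_close_def)

lemma controlled_sum_power:
  assumes "controlled M f" "controlled M h" "M \<ge> 1"
  shows "int_le (\<lambda>s. cmod (f \<bar>s\<bar> - h \<bar>s\<bar>) ^ 4) (132 * M)" "int_le (\<lambda>s. cmod (f \<bar>s\<bar> - h \<bar>s\<bar>) ^ 6) (132 * M)"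
proof -
  have [measurable]: "(\<lambda>s. f \<bar>s\<bar>) \<in> borel_measurable borel" "(\<lambda>s. h \<bar>s\<bar>) \<in> borel_measurable borel"
    using assms by (auto intro: controlled_measurable)
  have b: "int_le (\<lambda>s. (cmod (f \<bar>s\<bar>) + cmod (h \<bar>s\<bar>)) ^ 4) (132 * M)"
    "int_le (\<lambda>s. (cmod (f \<bar>s\<bar>) + cmod (h \<bar>s\<bar>)) ^ 6) (132 * M)"
    using assms by (intro profile_sum_bounds; simp add: controlled_def)+
  show "int_le (\<lambda>s. cmod (f \<bar>s\<bar> - h \<bar>s\<bar>) ^ 4) (132 * M)"
    by (rule int_le_mono[OF b(1)]) (auto intro!: power_mono norm_triangle_ineq4)
  show "int_le (\<lambda>s. cmod (f \<bar>s\<bar> - h \<bar>s\<bar>) ^ 6) (132 * M)"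
    by (rule int_le_mono[OF b(2)]) (auto intro!: power_mono norm_triangle_ineq4)
qed

text \<open>Starting value of the iteration: the bounds on the two profiles already control their
  difference. As 132 M >= 1, it may be weakened to its own fourth power.\<close>

lemma L4_close_initial:
  assumes "controlled M f" "controlled M h" "M \<ge> 1"
  shows "L4_close (132 * M) f h"
  unfolding L4_close_def
proof (rule int_le_weaken[OF controlled_sum_power(1)[OF assms]])
  show "132 * M \<le> (132 * M) ^ 4"
    using assms(3) power_increasing[of 1 4 "132 * M"] by simp
qed

lemma L4_close_mono: "L4_close B f h \<Longrightarrow> 0 \<le> B \<Longrightarrow> B \<le> B' \<Longrightarrow> L4_close B' f h"
  unfolding L4_close_def by (erule int_le_weaken) (rule power_mono)

text \<open>Needed because \<open>fourier\<close> and \<open>free_propagator\<close> have no meaning outside \<open>L\<^sup>2\<close>.\<close>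

lemma css_nonlinearity_L2:
  assumes f: "controlled M f" and M: "M \<ge> 1"
  shows "radial (css_nonlinearity g f) \<in> L2"
proof -
  have m [measurable]: "(\<lambda>s. f \<bar>s\<bar>) \<in> borel_measurable borel" using f by (rule controlled_measurable)
  \<comment> \<open>Pairing \<open>f\<close> with itself, at distance 0 and with B = 1, gives access
    to the single-profile estimates inside \<open>profile_pair\<close>.\<close>
  have "int_le (\<lambda>s. cmod (f \<bar>s\<bar> - f \<bar>s\<bar>) ^ 4) (1 ^ 4)"
    by (simp add: int_le_def)
  then have "L4_close 1 f f" by (simp add: L4_close_def)
  then interpret profile_pair "\<lambda>s. f \<bar>s\<bar>" "\<lambda>s. f \<bar>s\<bar>" "\<lambda>s. cmod (f \<bar>s\<bar> - f \<bar>s\<bar>) / 1" "\<lambda>s. cmod (f \<bar>s\<bar>) + cmod (f \<bar>s\<bar>)" 1 "132 * M"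
    using f M by (intro controlled_profile_pair) auto
  have "(\<integral>\<^sup>+x. ennreal ((cmod (radial (css_nonlinearity g f) x))\<^sup>2) \<partial>lborel) < \<infinity>"
    unfolding radial_css_nonlinearity_abs
    using int_le_plane[OF f.css_nonlinearity_square[of g]] by (rule le_less_trans) simp
  moreover have "radial (css_nonlinearity g f) \<in> borel_measurable borel"
    unfolding radial_css_nonlinearity_abs by measurable
  ultimately show ?thesis by (simp add: L2_iff_nn_integral)
qed

text \<open>The scaling makes the bound linear in \<open>B\<close>: the L^(4/3) integral is
  proportional to B^(4/3), whose cube is B^4, and the dispersive factor t^(-2) is the fourth power
  of t^(-1/2).\<close>

lemma propagated_nonlinearity_diff:
  assumes f: "controlled M f" and h: "controlled M h" and M: "M \<ge> 1"
    and close: "L4_close B f h" and B: "B > 0" and t: "t > 0"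
  shows "(\<integral>\<^sup>+x. ennreal (cmod (free_propagator t (radial (css_nonlinearity g f)) x
            - free_propagator t (radial (css_nonlinearity g h)) x) ^ 4) \<partial>lborel)
     \<le> ennreal ((duhamel_const g M * B * t powr (-1/2)) ^ 4)"
proof -
  define L where "L = 132 * M"
  define K1 where "K1 = 24 * L\<^sup>2 + 2 * \<bar>g\<bar>"
  have L: "L \<ge> 1" using M by (simp add: L_def)
  have K1: "K1 > 0" using L by (simp add: K1_def add_pos_nonneg)
  define S0 where "S0 = 2 * pi * (63 * L * K1 powr (4/3))"
  have S0: "S0 > 0" using L K1 by (simp add: S0_def)
  have pp: "profile_pair (\<lambda>s. f \<bar>s\<bar>) (\<lambda>s. h \<bar>s\<bar>) (\<lambda>s. cmod (f \<bar>s\<bar> - h \<bar>s\<bar>) / B) (\<lambda>s. cmod (f \<bar>s\<bar>) + cmod (h \<bar>s\<bar>)) B L"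
    unfolding L_def by (rule controlled_profile_pair[OF f h close M B])
  interpret profile_pair "\<lambda>s. f \<bar>s\<bar>" "\<lambda>s. h \<bar>s\<bar>" "\<lambda>s. cmod (f \<bar>s\<bar> - h \<bar>s\<bar>) / B" "\<lambda>s. cmod (f \<bar>s\<bar>) + cmod (h \<bar>s\<bar>)" B L
    by (rule pp)
  have "(\<integral>\<^sup>+x. ennreal (cmod (radial (css_nonlinearity g f) x - radial (css_nonlinearity g h) x) powr (4/3)) \<partial>lborel)
     \<le> ennreal (2 * pi * (63 * L * (B * K1) powr (4/3)))"
    using int_le_plane[OF css_nonlinearity_diff_int[of g]] unfolding radial_css_nonlinearity_abs K1_def .
  also have "2 * pi * (63 * L * (B * K1) powr (4/3)) = S0 * B powr (4/3)"
    using B K1 by (simp add: S0_def powr_mult mult_ac)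
  finally have S: "(\<integral>\<^sup>+x. ennreal (cmod (radial (css_nonlinearity g f) x - radial (css_nonlinearity g h) x) powr (4/3)) \<partial>lborel)
     \<le> ennreal (S0 * B powr (4/3))" .
  have "(\<integral>\<^sup>+x. ennreal (cmod (free_propagator t (radial (css_nonlinearity g f)) x
            - free_propagator t (radial (css_nonlinearity g h)) x) ^ 4) \<partial>lborel)
     \<le> ennreal (32 * (1 / (4 * pi * \<bar>t\<bar>))\<^sup>2 * (S0 * B powr (4/3)) ^ 3)"
    using t S0 B by (intro free_propagator_diff_L4 css_nonlinearity_L2[OF f M] css_nonlinearity_L2[OF h M] S) auto
  also have "32 * (1 / (4 * pi * \<bar>t\<bar>))\<^sup>2 * (S0 * B powr (4/3)) ^ 3 = (duhamel_const g M * B * t powr (-1/2)) ^ 4"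
  proof -
    have pw: "(duhamel_const g M) ^ 4 = 2 / pi\<^sup>2 * S0 ^ 3"
    proof -
      have "duhamel_const g M = (2 / pi\<^sup>2 * S0 ^ 3) powr (1/4)"
        unfolding duhamel_const_def Let_def S0_def K1_def L_def ..
      then show ?thesis
        using powr_realpow_mult[of "2 / pi\<^sup>2 * S0 ^ 3" "1/4" 4] S0 by simp
    qed
    have Bp: "(B powr (4/3)) ^ 3 = B ^ 4" using powr_realpow_mult[OF B, of "4/3" 3] B by simp
    have tp: "(t powr (-1/2)) ^ 4 = 1 / t\<^sup>2"
      using powr_realpow_mult[OF t, of "-1/2" 4] t by (simp add: powr_minus_divide)
    show ?thesis
      unfolding power_mult_distrib pw Bp tp using t by (simp add: power_divide power_mult_distrib)
  qed
  finally show ?thesis .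
qed

lemma duhamel_const_pos:
  assumes "M \<ge> 1" shows "duhamel_const g M > 0"
proof -
  have "0 < 24 * (132 * M)\<^sup>2 + 2 * \<bar>g\<bar>" using assms by (intro add_pos_nonneg) auto
  then show ?thesis using assms by (auto simp: duhamel_const_def Let_def)
qed

text \<open>Testing the difference of the two Duhamel formulas against \<open>|w|\<^sup>2 w\<close> turns the \<open>L\<^sup>4\<close> norm of
  the difference \<open>w\<close> at time \<open>t\<close> into a time integral with the integrable kernel \<open>(t - s)\<^bsup>-1/2\<^esup>\<close>;
  the exponential weight makes that integral a contraction.\<close>

lemma duhamel_contraction:
  assumes M: "M \<ge> 1" and B: "B > 0" and t: "t \<in> {0..<T}"
    and n: "(\<integral>\<^sup>+s. ennreal (exp (- (n * s)) * s powr (-1/2)) * indicator {0..T} s \<partial>lborel)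
        \<le> ennreal (1 / (2 * duhamel_const g M))"
    and close: "AE s in lborel. s \<in> {0..<T} \<longrightarrow>
        controlled M (\<phi> s) \<and> controlled M (\<psi> s) \<and> L4_close (B * exp (n * s)) (\<phi> s) (\<psi> s)"
    and ct: "controlled M (\<phi> t)" "controlled M (\<psi> t)"
    and D1: "has_L2_integral (\<lambda>s. free_propagator (t - s) (radial (css_nonlinearity g (\<phi> s)))) {0..t} D1"
      "AE x in lborel. radial (\<phi> t) x = u0 x - \<i> * D1 x"
    and D2: "has_L2_integral (\<lambda>s. free_propagator (t - s) (radial (css_nonlinearity g (\<psi> s)))) {0..t} D2"
      "AE x in lborel. radial (\<psi> t) x = u0 x - \<i> * D2 x"
  shows "L4_close (B / 2 * exp (n * t)) (\<phi> t) (\<psi> t)"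
proof -
  define \<kappa> where "\<kappa> = duhamel_const g M"
  have \<kappa>: "\<kappa> > 0" unfolding \<kappa>_def by (rule duhamel_const_pos[OF M])
  define w where "w x = radial (\<phi> t) x - radial (\<psi> t) x" for x
  have wL: "w \<in> L2" unfolding w_def using ct by (intro L2_diff) (auto simp: controlled_def)
  have [measurable]: "w \<in> borel_measurable borel" using wL by (rule L2_measurable)
  have w_abs: "w x = \<phi> t \<bar>norm x\<bar> - \<psi> t \<bar>norm x\<bar>" for x by (simp add: w_def radial_def)
  have w4: "(\<integral>\<^sup>+x. ennreal (cmod (w x) ^ 4) \<partial>lborel) \<le> ennreal (2 * pi * (132 * M))"
    using int_le_plane[OF controlled_sum_power(1)[OF ct M]] by (simp add: w_abs)
  have w6: "(\<integral>\<^sup>+x. ennreal (cmod (w x) ^ 6) \<partial>lborel) \<le> ennreal (2 * pi * (132 * M))"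
    using int_le_plane[OF controlled_sum_power(2)[OF ct M]] by (simp add: w_abs)
  \<comment> \<open>The L^6 bound on \<open>w\<close> puts \<open>h\<close> into L^2, the class of
    test functions for which the weak time integral is known.\<close>
  define h where "h x = of_real ((cmod (w x))\<^sup>2) * w x" for x
  have [measurable]: "h \<in> borel_measurable borel" unfolding h_def by measurable
  have "(cmod (h x))\<^sup>2 = cmod (w x) ^ 6" for x
    by (simp add: h_def norm_mult norm_power power_mult_distrib power_mult[symmetric] power_add[symmetric])
  then have "(\<integral>\<^sup>+x. ennreal ((cmod (h x))\<^sup>2) \<partial>lborel) < \<infinity>"
    using w6 by (auto intro: le_less_trans)
  then have hL: "h \<in> L2" by (simp add: L2_iff_nn_integral)
  have w4i: "integrable lborel (\<lambda>x. cmod (w x) ^ 4)"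
    by (rule integrableI_bounded) (use w4 in \<open>auto intro: le_less_trans\<close>)
  define Q where "Q = (\<integral>x. cmod (w x) ^ 4 \<partial>lborel) powr (1/4)"
  have I0: "0 \<le> (\<integral>x. cmod (w x) ^ 4 \<partial>lborel)" by (rule integral_nonneg_AE) simp
  have Q: "Q \<ge> 0" "Q ^ 4 = (\<integral>x. cmod (w x) ^ 4 \<partial>lborel)"
  proof -
    show "Q ^ 4 = (\<integral>x. cmod (w x) ^ 4 \<partial>lborel)"
      using powr_realpow_mult[of "\<integral>x. cmod (w x) ^ 4 \<partial>lborel" "1/4" 4] I0
      by (cases "(\<integral>x. cmod (w x) ^ 4 \<partial>lborel) = 0") (auto simp: Q_def)
  qed (simp add: Q_def)
  have wQ: "(\<integral>\<^sup>+x. ennreal (cmod (w x) ^ 4) \<partial>lborel) = ennreal (Q ^ 4)"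
    unfolding Q(2) by (rule nn_integral_eq_integral[OF w4i]) simp
  have "w x * cnj (h x) = complex_of_real (cmod (w x) ^ 4)" for x
  proof -
    have "w x * cnj (h x) = of_real ((cmod (w x))\<^sup>2) * (w x * cnj (w x))" by (simp add: h_def)
    also have "\<dots> = complex_of_real ((cmod (w x))\<^sup>2 * (cmod (w x))\<^sup>2)"
      by (simp only: complex_norm_square[symmetric] of_real_mult of_real_power)
    finally show ?thesis by (simp add: power_add[symmetric])
  qed
  then have wh: "L2_inner w h = complex_of_real (Q ^ 4)"
    unfolding L2_inner_def Q(2) by (simp only: integral_complex_of_real)
  let ?G1 = "\<lambda>s. free_propagator (t - s) (radial (css_nonlinearity g (\<phi> s)))"
  let ?G2 = "\<lambda>s. free_propagator (t - s) (radial (css_nonlinearity g (\<psi> s)))"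
  have DL: "D1 \<in> L2" "D2 \<in> L2" using D1 D2 by (auto simp: has_L2_integral_def)
  \<comment> \<open>The free evolution \<open>u0\<close> is common to both formulas and
    cancels.\<close>
  have "L2_inner w h = L2_inner (\<lambda>x. - \<i> * (D1 x - D2 x)) h"
  proof (rule L2_inner_cong)
    show "AE x in lborel. w x = - \<i> * (D1 x - D2 x)"
      using D1(2) D2(2) by eventually_elim (simp add: w_def algebra_simps)
  qed (use DL in \<open>auto dest!: L2_measurable\<close>)
  also have "\<dots> = - \<i> * (L2_inner D1 h - L2_inner D2 h)"
    by (simp only: L2_inner_cmult_left L2_inner_diff_left[OF DL hL])
  finally have Q4: "Q ^ 4 = cmod (L2_inner D1 h - L2_inner D2 h)"
    using arg_cong[OF wh, of cmod] Q(1) by (simp add: norm_mult norm_power)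
  have si: "set_integrable lebesgue {0..t} (\<lambda>s. L2_inner (?G1 s) h)" "set_integrable lebesgue {0..t} (\<lambda>s. L2_inner (?G2 s) h)"
    and Dh: "L2_inner D1 h = (LINT s:{0..t}|lebesgue. L2_inner (?G1 s) h)" "L2_inner D2 h = (LINT s:{0..t}|lebesgue. L2_inner (?G2 s) h)"
    using D1(1) D2(1) hL by (auto simp: has_L2_integral_def)
  let ?k = "\<lambda>s. ennreal (\<kappa> * B * Q ^ 3 * exp (n * s) * (t - s) powr (-1/2)) * indicator {0..t} s"
  \<comment> \<open>The kernel is singular at s = t; this single time is discarded as a null
    set.\<close>
  have bound: "AE s in lborel. ennreal (cmod (indicator {0..t} s *\<^sub>R (L2_inner (?G1 s) h - L2_inner (?G2 s) h))) \<le> ?k s"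
    using close AE_lborel_singleton[of t]
  proof eventually_elim
    case (elim s)
    show ?case
    proof (cases "s \<in> {0..t}")
      case True
      then have s: "t - s > 0" "s \<in> {0..<T}" using elim t by auto
      then have cs: "controlled M (\<phi> s)" "controlled M (\<psi> s)" "L4_close (B * exp (n * s)) (\<phi> s) (\<psi> s)"
        using elim by auto
      have GL: "?G1 s \<in> L2" "?G2 s \<in> L2"
        using cs(1,2) by (intro has_fourier_L2(1)[OF has_fourier_free_propagator] css_nonlinearity_L2[OF _ M]; simp)+
      have "cmod (L2_inner (\<lambda>x. ?G1 s x - ?G2 s x) h) \<le> (\<kappa> * (B * exp (n * s)) * (t - s) powr (-1/2)) * Q ^ 3"
        unfolding h_def
      proof (rule L4_duality_bound)
        show "(\<integral>\<^sup>+x. ennreal (cmod (?G1 s x - ?G2 s x) ^ 4) \<partial>lborel) \<le> ennreal ((\<kappa> * (B * exp (n * s)) * (t - s) powr (-1/2)) ^ 4)"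
          unfolding \<kappa>_def using B s by (intro propagated_nonlinearity_diff cs M) auto
      qed (use GL Q wQ B \<kappa> in \<open>auto dest!: L2_measurable\<close>)
      then have "cmod (L2_inner (?G1 s) h - L2_inner (?G2 s) h) \<le> \<kappa> * B * Q ^ 3 * exp (n * s) * (t - s) powr (-1/2)"
        unfolding L2_inner_diff_left[OF GL hL] by (simp only: mult_ac)
      from ennreal_leI[OF this] show ?thesis using True by simp
    qed simp
  qed
  have "L2_inner D1 h - L2_inner D2 h = (LINT s:{0..t}|lebesgue. L2_inner (?G1 s) h - L2_inner (?G2 s) h)"
    unfolding Dh by (rule set_integral_diff(2)[OF si, symmetric])
  then have "ennreal (Q ^ 4) = ennreal (cmod (\<integral>s. indicator {0..t} s *\<^sub>R (L2_inner (?G1 s) h - L2_inner (?G2 s) h) \<partial>lebesgue))"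
    unfolding Q4 set_lebesgue_integral_def by simp
  also have "\<dots> \<le> (\<integral>\<^sup>+s. ennreal (cmod (indicator {0..t} s *\<^sub>R (L2_inner (?G1 s) h - L2_inner (?G2 s) h))) \<partial>lebesgue)"
    by (rule integral_norm_le_nn_integral)
  also have "\<dots> \<le> (\<integral>\<^sup>+s. ?k s \<partial>lebesgue)"
    by (rule nn_integral_mono_AE[OF AE_completion[OF bound]])
  \<comment> \<open>Completion does not change the nonnegative integral, so the bound returns to
    \<open>lborel\<close>, where the affine substitution is available.\<close>
  also have "\<dots> = (\<integral>\<^sup>+s. ?k s \<partial>lborel)"
    by (rule nn_integral_completion)
  \<comment> \<open>The reflection of s to t - s splits exp (n (t - s)) into the target weight exp
    (n t) and the factor exp (- n s) that makes the kernel integral small.\<close>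
  also have "\<dots> = (\<integral>\<^sup>+s. ?k (t - s) \<partial>lborel)"
    using nn_integral_real_affine[of ?k "-1" t] by simp
  also have "\<dots> \<le> (\<integral>\<^sup>+s. ennreal (\<kappa> * B * Q ^ 3 * exp (n * t)) * (ennreal (exp (- (n * s)) * s powr (-1/2)) * indicator {0..T} s) \<partial>lborel)"
  proof (rule nn_integral_mono)
    fix s :: real
    show "?k (t - s) \<le> ennreal (\<kappa> * B * Q ^ 3 * exp (n * t)) * (ennreal (exp (- (n * s)) * s powr (-1/2)) * indicator {0..T} s)"
    proof (cases "0 \<le> s \<and> s \<le> t")
      case True
      have "exp (n * (t - s)) = exp (n * t) * exp (- (n * s))"
        unfolding exp_add[symmetric] by (simp add: right_diff_distrib)
      then have "\<kappa> * B * Q ^ 3 * exp (n * (t - s)) * s powr (-1/2) = (\<kappa> * B * Q ^ 3 * exp (n * t)) * (exp (- (n * s)) * s powr (-1/2))"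
        by (simp only: mult.assoc)
      moreover have "ennreal ((\<kappa> * B * Q ^ 3 * exp (n * t)) * (exp (- (n * s)) * s powr (-1/2)))
         = ennreal (\<kappa> * B * Q ^ 3 * exp (n * t)) * ennreal (exp (- (n * s)) * s powr (-1/2))"
        using \<kappa> B Q by (intro ennreal_mult) auto
      ultimately have "ennreal (\<kappa> * B * Q ^ 3 * exp (n * (t - s)) * s powr (-1/2))
         = ennreal (\<kappa> * B * Q ^ 3 * exp (n * t)) * ennreal (exp (- (n * s)) * s powr (-1/2))"
        by (simp only:)
      moreover have "indicator {0..t} (t - s) = (1::ennreal)" "indicator {0..T} s = (1::ennreal)" "t - (t - s) = s"
        using True t by auto
      ultimately show ?thesis by (simp only: mult_1_right order_refl)
    next
      case False
      then have "indicator {0..t} (t - s) = (0::ennreal)" by auto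
      then show ?thesis by (simp only: mult_zero_right zero_le)
    qed
  qed
  also have "\<dots> = ennreal (\<kappa> * B * Q ^ 3 * exp (n * t)) * (\<integral>\<^sup>+s. ennreal (exp (- (n * s)) * s powr (-1/2)) * indicator {0..T} s \<partial>lborel)"
    by (rule nn_integral_cmult) measurable
  also have "\<dots> \<le> ennreal (\<kappa> * B * Q ^ 3 * exp (n * t)) * ennreal (1 / (2 * \<kappa>))"
    unfolding \<kappa>_def by (intro mult_left_mono n) simp
  also have "\<dots> = ennreal (\<kappa> * B * Q ^ 3 * exp (n * t) * (1 / (2 * \<kappa>)))"
    using \<kappa> B Q by (intro ennreal_mult[symmetric]) auto
  also have "\<kappa> * B * Q ^ 3 * exp (n * t) * (1 / (2 * \<kappa>)) = (B / 2 * exp (n * t)) * Q ^ 3"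
    using \<kappa> by simp
  finally have "Q ^ 4 \<le> (B / 2 * exp (n * t)) * Q ^ 3"
    using B Q by (subst (asm) ennreal_le_iff) auto
  \<comment> \<open>Q^3 can be divided out because \<open>Q\<close> is a finite real number, by the
    bounds on both profiles; Q = 0 is settled separately.\<close>
  then have QB: "Q \<le> B / 2 * exp (n * t)"
    using B Q(1) by (cases "Q = 0") (auto simp: power4_eq_xxxx power3_eq_cube)
  show ?thesis
    unfolding L4_close_def
  proof (rule int_le_from_plane)
    have [measurable]: "(\<lambda>s. \<phi> t \<bar>s\<bar>) \<in> borel_measurable borel" "(\<lambda>s. \<psi> t \<bar>s\<bar>) \<in> borel_measurable borel"
      using ct by (auto intro: controlled_measurable)
    show "(\<lambda>s. cmod (\<phi> t \<bar>s\<bar> - \<psi> t \<bar>s\<bar>) ^ 4) \<in> borel_measurable borel" by measurable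
    have "Q ^ 4 \<le> (B / 2 * exp (n * t)) ^ 4" using QB Q(1) by (intro power_mono)
    also have "\<dots> \<le> 2 * pi * (B / 2 * exp (n * t)) ^ 4"
      using pi_ge_two mult_right_mono[of 1 "2 * pi" "(B / 2 * exp (n * t)) ^ 4"] by simp
    finally show "(\<integral>\<^sup>+x. ennreal (cmod (\<phi> t \<bar>norm (x::plane)\<bar> - \<psi> t \<bar>norm x\<bar>) ^ 4) \<partial>lborel) \<le> ennreal (2 * pi * (B / 2 * exp (n * t)) ^ 4)"
      using wQ unfolding w_abs by (simp add: ennreal_leI)
  qed auto
qed

lemma css_mild_solution_sobolev:
  assumes "css_mild_solution g T \<phi>0 \<phi>"
  obtains C where "AE t in lborel. t \<in> {0..<T} \<longrightarrow>
        radial (\<phi> t) \<in> sobolev (2/3) \<and> sobolev_norm (2/3) (radial (\<phi> t)) \<le> C"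
  using assms unfolding css_mild_solution_def Linf_sobolev_def by blast

theorem theorem1p2:
  fixes g T :: real
    and \<phi>0 :: "real \<Rightarrow> complex"
    and \<phi> \<psi> :: "real \<Rightarrow> real \<Rightarrow> complex"
  assumes "T > 0"
    and "radial \<phi>0 \<in> L2"
    and "css_mild_solution g T \<phi>0 \<phi>"
    and "css_mild_solution g T \<phi>0 \<psi>"
  shows "AE t in lborel. t \<in> {0..<T} \<longrightarrow> (AE x in lborel. radial (\<phi> t) x = radial (\<psi> t) x)"
proof -
  obtain C1 where C1: "AE t in lborel. t \<in> {0..<T} \<longrightarrow>
        radial (\<phi> t) \<in> sobolev (2/3) \<and> sobolev_norm (2/3) (radial (\<phi> t)) \<le> C1"
    using css_mild_solution_sobolev[OF assms(3)] .
  obtain C2 where C2: "AE t in lborel. t \<in> {0..<T} \<longrightarrow>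
        radial (\<psi> t) \<in> sobolev (2/3) \<and> sobolev_norm (2/3) (radial (\<psi> t)) \<le> C2"
    using css_mild_solution_sobolev[OF assms(4)] .
  \<comment> \<open>One \<open>M\<close> for both solutions, hence the maximum of their essential
    bounds.\<close>
  obtain M where M: "M \<ge> 1" and MC: "\<And>f. radial f \<in> sobolev (2/3) \<Longrightarrow> sobolev_norm (2/3) (radial f) \<le> max C1 C2 \<Longrightarrow>
     int_le (\<lambda>s. (cmod (f \<bar>s\<bar>))\<^sup>2) M \<and> int_le (\<lambda>s. cmod (f \<bar>s\<bar>) ^ 6) M"
    using sobolev_profile[of "max C1 C2"] by blast
  have con: "AE t in lborel. t \<in> {0..<T} \<longrightarrow> controlled M (\<phi> t) \<and> controlled M (\<psi> t)"
    using C1 C2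
  proof eventually_elim
    case (elim t)
    show ?case
      using elim MC[of "\<phi> t"] MC[of "\<psi> t"] by (auto simp: controlled_def sobolev_def)
  qed
  \<comment> \<open>Fixed before the iteration, so that every round gains the factor 1/2 for one and
    the same weight.\<close>
  obtain n :: nat where n: "(\<integral>\<^sup>+s. ennreal (exp (- (real n * s)) * s powr (-1/2)) * indicator {0..T} s \<partial>lborel)
        \<le> ennreal (1 / (2 * duhamel_const g M))"
    using exp_sqrt_kernel_small[OF assms(1), of "1 / (2 * duhamel_const g M)"] duhamel_const_pos[OF M, of g] by auto
  have duhamel: "AE t in lborel. t \<in> {0..<T} \<longrightarrow> (\<exists>D.
      has_L2_integral (\<lambda>s. free_propagator (t - s) (radial (css_nonlinearity g (\<eta> s)))) {0..t} D \<and>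
      (AE x in lborel. radial (\<eta> t) x = free_propagator t (radial \<phi>0) x - \<i> * D x))"
    if "css_mild_solution g T \<phi>0 \<eta>" for \<eta>
    using that unfolding css_mild_solution_def by blast
  \<comment> \<open>Starts at the constant of \<open>L4_close_initial\<close>; multiplying by exp (n
    t) >= 1 only weakens that bound.\<close>
  define b where "b k = 132 * M * (1/2) ^ k" for k :: nat
  have b: "b k > 0" for k using M by (simp add: b_def)
  \<comment> \<open>Each round may have its own null set of times. This is harmless, since the
    Duhamel integral at time t uses the previous round only at almost every earlier time.\<close>
  have close: "AE t in lborel. t \<in> {0..<T} \<longrightarrow> L4_close (b k * exp (real n * t)) (\<phi> t) (\<psi> t)" for k
  proof (induction k)
    case 0
    show ?case
      using con
    proof eventually_elim
      case (elim t)
      show ?case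
      proof
        assume t: "t \<in> {0..<T}"
        have "1 \<le> exp (real n * t)" using t by simp
        then have "132 * M \<le> b 0 * exp (real n * t)" using M by (simp add: b_def)
        then show "L4_close (b 0 * exp (real n * t)) (\<phi> t) (\<psi> t)"
          using elim t M L4_close_initial[of M "\<phi> t" "\<psi> t"] by (auto elim: L4_close_mono)
      qed
    qed
  next
    case (Suc k)
    have ae: "AE s in lborel. s \<in> {0..<T} \<longrightarrow>
        controlled M (\<phi> s) \<and> controlled M (\<psi> s) \<and> L4_close (b k * exp (real n * s)) (\<phi> s) (\<psi> s)"
      using con Suc.IH by eventually_elim auto
    show ?case
      using con duhamel[OF assms(3)] duhamel[OF assms(4)]
    proof eventually_elim
      case (elim t)
      show ?case
      proof
        assume t: "t \<in> {0..<T}"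
        obtain D1 where D1: "has_L2_integral (\<lambda>s. free_propagator (t - s) (radial (css_nonlinearity g (\<phi> s)))) {0..t} D1"
          "AE x in lborel. radial (\<phi> t) x = free_propagator t (radial \<phi>0) x - \<i> * D1 x"
          using elim t by blast
        obtain D2 where D2: "has_L2_integral (\<lambda>s. free_propagator (t - s) (radial (css_nonlinearity g (\<psi> s)))) {0..t} D2"
          "AE x in lborel. radial (\<psi> t) x = free_propagator t (radial \<phi>0) x - \<i> * D2 x"
          using elim t by blast
        have "L4_close (b k / 2 * exp (real n * t)) (\<phi> t) (\<psi> t)"
          using elim t by (intro duhamel_contraction[OF M b t n ae _ _ D1 D2]) auto
        then show "L4_close (b (Suc k) * exp (real n * t)) (\<phi> t) (\<psi> t)"
          by (simp add: b_def)
      qed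
    qed
  qed
  \<comment> \<open>There are countably many rounds, so one null set of times serves them all, and k
    may tend to infinity at a fixed t.\<close>
  then have all_close: "AE t in lborel. \<forall>k. t \<in> {0..<T} \<longrightarrow> L4_close (b k * exp (real n * t)) (\<phi> t) (\<psi> t)"
    unfolding AE_all_countable by blast
  show ?thesis
    using all_close con
  proof eventually_elim
    case (elim t)
    show ?case
    proof
      assume t: "t \<in> {0..<T}"
      define w where "w x = radial (\<phi> t) x - radial (\<psi> t) x" for x
      have [measurable]: "w \<in> borel_measurable borel"
        unfolding w_def using elim t by (intro L2_measurable L2_diff) (auto simp: controlled_def)
      have le: "(\<integral>\<^sup>+x. ennreal (cmod (w x) ^ 4) \<partial>lborel) \<le> ennreal (2 * pi * (b k * exp (real n * t)) ^ 4)" for k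
      proof -
        have "int_le (\<lambda>s. cmod (\<phi> t \<bar>s\<bar> - \<psi> t \<bar>s\<bar>) ^ 4) ((b k * exp (real n * t)) ^ 4)"
          using elim t by (simp add: L4_close_def)
        from int_le_plane[OF this] show ?thesis by (simp add: w_def radial_def)
      qed
      have "(\<lambda>k. 2 * pi * (132 * M * (1/2) ^ k * exp (real n * t)) ^ 4) \<longlonglongrightarrow> 2 * pi * (132 * M * 0 * exp (real n * t)) ^ 4"
        by (intro tendsto_intros LIMSEQ_power_zero) auto
      then have "(\<lambda>k. ennreal (2 * pi * (b k * exp (real n * t)) ^ 4)) \<longlonglongrightarrow> ennreal 0"
        unfolding b_def by (intro tendsto_ennrealI) simp
      then have "(\<integral>\<^sup>+x. ennreal (cmod (w x) ^ 4) \<partial>lborel) \<le> ennreal 0"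
        by (rule LIMSEQ_le_const) (use le in blast)
      then have "(\<integral>\<^sup>+x. ennreal (cmod (w x) ^ 4) \<partial>lborel) = 0" by simp
      then have "AE x in lborel. ennreal (cmod (w x) ^ 4) = 0"
        by (subst (asm) nn_integral_0_iff_AE) auto
      then show "AE x in lborel. radial (\<phi> t) x = radial (\<psi> t) x"
        by eventually_elim (simp add: w_def)
    qed
  qed
qed

end
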